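(* Let $\beta\in(0,K)$, and assume (A1) and (A2) (see context). Let $\mathcal{F}$ be a convex set of score functions such that $\|f\|_\infty\le B$ for all $f\in\mathcal{F}$, and let $M_n=\mathcal{N}(1/n,L_\infty,\mathcal{F})$ be the cardinality of the set of closed balls with radius $1/n$ in $L_\infty$-norm needed to cover $\mathcal{F}$. Assume that: (a) $\phi$ is confidence set calibrated, and there exist constants $C_0>0$ and $s\ge1$ such that for every $k\in\{1,\dots,K\}$, $|p_k(X)-G^{-1}(\beta)|^s\le C_0\,\Delta R_\phi^k(-\delta^* )$, where $\delta^*$ is the real number associated with $\beta$ in the definition of calibration and $-\delta^*$ stands for the constant score $(-\delta^*,\dots,-\delta^* )$; (b) the modulus of convexity of $R_\phi$ satisfies $\delta(\varepsilon)\ge c_1\varepsilon^2$ for all $\varepsilon>0$, with some $c_1>0$; (c) $\phi$ is $L$-Lipschitz with $L>0$; (d) for some $\alpha>0$ and every $k\in\{1,\dots,K\}$ the margin condition $\mathrm{M}^k_\alpha$ holds: there is a constant $c_2>0$ such that $\mathbb{P}_X(0<|p_k(X)-G^{-1}(\beta)|\le t)\le c_2t^\alpha$ for all $t>0$. Then $$\mathbf{E}\left[|\Delta\mathcal{R}(\hat\Gamma_\beta)|\right]\le C(B,L,s,\alpha)\,K^{1-\alpha/(\alpha+s)}\left\{\inf_{f\in\mathcal{F}}\Delta R_\phi(f)+\frac{K\log(M_n)}{n}\right\}^{\alpha/(\alpha+s)}+C'\frac{K}{\sqrt N},$$ where $C'>0$ is an absolute constant and $C(B,L,s,\alpha)>0$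 is a constant that depends only on $L,B,s$ and $\alpha$ (the numerical constants $C_0,c_1,c_2$ of the hypotheses being regarded as fixed).
   Context: Let $K\ge 2$, $\mathcal{Y}=\{1,\dots,K\}$, and $(X,Y)$ a random pair in $\mathcal{X}\times\mathcal{Y}$ with distribution $\mathbb{P}$; $\mathbb{P}_X$ is the law of $X$ and $p_k(x)=\mathbb{P}(Y=k\mid X=x)$. A confidence set is a measurable map $\Gamma:\mathcal{X}\to2^{\mathcal{Y}}$, with risk $\mathcal{R}(\Gamma)=\mathbb{P}(Y\notin\Gamma(X))$ and information $\mathcal{I}(\Gamma)=\mathbb{E}[|\Gamma(X)|]$. (A1): for all $k$ the c.d.f. $F_{p_k}$ of $p_k(X)$ is continuous. Let $G(t)=\sum_{k=1}^K(1-F_{p_k}(t))$, $t\in[0,1]$, and $G^{-1}(\beta)=\inf\{t\in[0,1]:G(t)\le\beta\}$. The Oracle $\beta$-set is $\Gamma^*_\beta(X)=\{k:p_k(X)\ge G^{-1}(\beta)\}$. $\phi$-risk. $\phi:\mathbb{R}\to\mathbb{R}$ is a convex function. A score function is a measurable $f=(f_1,\dots,f_K):\mathcal{X}\to\mathbb{R}^K$; its $\phi$-risk is $R_\phi(f)=\mathbb{E}[\sum_{k=1}^K\phi(Z_kf_k(X))]$ with $Z_k=2\cdot\mathbf{1}_{\{Y=k\}}-1$. $f^*$ denotes a minimizer of $R_\phi$ over all measurable score functions, and $\Delta R_\phi(f)=R_\phi(f)-R_\phi(f^* )$. For a score $f$ and $\delta\in\mathbb{R}$, $\Gamma_{f,\delta}(X)=\{k:f_k(X)\ge-\delta\}$.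 $\phi$ is confidence set calibrated if for every information level $\beta\in(0,K)$ there is $\delta^*\in\mathbb{R}$ with $\Gamma_{f^*,\delta^*}=\Gamma_\beta^*$. The marginal conditional excess $\phi$-risk is $$\Delta R_\phi^k(f(X))=p_k(X)(\phi(f_k(X))-\phi(f_k^*(X)))+(1-p_k(X))(\phi(-f_k(X))-\phi(-f_k^*(X))).$$ Modulus of convexity: $\delta(\varepsilon)=\inf\{\frac{R_\phi(f)+R_\phi(g)}{2}-R_\phi(\frac{f+g}{2}):\ f,g\in\mathcal{F},\ \sum_{k=1}^K\mathbb{E}_X[(f_k-g_k)^2(X)]\ge\varepsilon^2\}$. Data-driven procedure. $\mathcal{D}_n=\{(X_i,Y_i),i=1,\dots,n\}$ consists of independent copies of $(X,Y)$; $\mathcal{D}_N=\{X'_1,\dots,X'_N\}$ consists of independent copies of $X$ and is independent of $\mathcal{D}_n$; $(X,Y)$ is independent of both. $\hat R_\phi(f)=\frac1n\sum_{i=1}^n\sum_{k=1}^K\phi(Z_k^if_k(X_i))$ with $Z^i_k=2\cdot\mathbf{1}_{\{Y_i=k\}}-1$, and $\hat f\in\arg\min_{f\in\mathcal{F}}\hat R_\phi(f)$. (A2): for each $k$ the conditional c.d.f. $F_{\hat f_k}(t)=\mathbb{P}_X(\hat f_k(X)\le t\mid\mathcal{D}_n)$ is continuous. The empirical $\beta$-set is $\hat\Gamma_\beta(X)=\{k:\hat G(\hat f_k(X))\le\beta\}$, where $\hat G(t)=\frac1N\sum_{i=1}^N\sum_{k=1}^K\mathbf{1}_{\{\hat f_k(X'_i)\ge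 t\}}$. Its excess risk is $\Delta\mathcal{R}(\hat\Gamma_\beta)=\mathcal{R}(\hat\Gamma_\beta)-\mathcal{R}(\Gamma^*_\beta)$, where $\mathcal{R}(\hat\Gamma_\beta)$ is the conditional probability of $Y\notin\hat\Gamma_\beta(X)$ given the data $(\mathcal{D}_n,\mathcal{D}_N)$; $\mathbf{E}$ denotes expectation over all random quantities.
   Formalization: The formal theorem assumes that the covering number M_n is finite and at least 2; for M_n = 1 the term K log(M_n)/n vanishes and the stated bound can fail. The L_infinity norm is the supremum norm, and C, C' are chosen per pair of underlying types of the sample and feature spaces. *)

theory Defs
  imports "HOL-Probability.Probability"
begin

text \<open>The labels are \<open>1, \<dots>, K\<close>. A score function is a family \<open>f k\<close>, where only the components
  with \<open>k \<in> {1..K}\<close> and the points of \<open>space S\<close> are relevant.\<close>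

type_synonym 'x score = "nat \<Rightarrow> 'x \<Rightarrow> real"

abbreviation pair_space :: "'x measure \<Rightarrow> nat \<Rightarrow> ('x \<times> nat) measure" where
  "pair_space S K \<equiv> S \<Otimes>\<^sub>M count_space {1..K}"

definition random_pair ::
    "'w measure \<Rightarrow> 'x measure \<Rightarrow> nat \<Rightarrow> ('w \<Rightarrow> 'x) \<Rightarrow> ('w \<Rightarrow> nat) \<Rightarrow> bool" where
  "random_pair M S K X Y \<longleftrightarrow>
     prob_space M \<and> X \<in> M \<rightarrow>\<^sub>M S \<and> Y \<in> M \<rightarrow>\<^sub>M count_space {1..K}"

definition generated_algebra :: "'w measure \<Rightarrow> ('w \<Rightarrow> 'a) \<Rightarrow> 'a measure \<Rightarrow> 'w measure" where
  "generated_algebra M A MA = vimage_algebra (space M) A MA"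

text \<open>\<open>p k\<close> is a version of \<open>x \<mapsto> P(Y = k | X = x)\<close>.\<close>

definition class_prob ::
    "'w measure \<Rightarrow> 'x measure \<Rightarrow> nat \<Rightarrow> ('w \<Rightarrow> 'x) \<Rightarrow> ('w \<Rightarrow> nat) \<Rightarrow> (nat \<Rightarrow> 'x \<Rightarrow> real) \<Rightarrow> bool" where
  "class_prob M S K X Y p \<longleftrightarrow>
     (\<forall>k\<in>{1..K}. p k \<in> borel_measurable S \<and>
        (AE \<omega> in M. p k (X \<omega>) =
           real_cond_exp M (generated_algebra M X S) (indicator {\<omega> \<in> space M. Y \<omega> = k}) \<omega>))"

definition cdf_of :: "'w measure \<Rightarrow> ('w \<Rightarrow> real) \<Rightarrow> real \<Rightarrow> real" where
  "cdf_of M V = cdf (distr M borel V)"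


subsection \<open>Confidence sets\<close>

definition risk :: "'w measure \<Rightarrow> ('w \<Rightarrow> 'x) \<Rightarrow> ('w \<Rightarrow> nat) \<Rightarrow> ('x \<Rightarrow> nat set) \<Rightarrow> real" where
  "risk M X Y \<Gamma> = measure M {\<omega> \<in> space M. Y \<omega> \<notin> \<Gamma> (X \<omega>)}"

definition G_fun :: "'w measure \<Rightarrow> nat \<Rightarrow> ('w \<Rightarrow> 'x) \<Rightarrow> (nat \<Rightarrow> 'x \<Rightarrow> real) \<Rightarrow> real \<Rightarrow> real" where
  "G_fun M K X p t = (\<Sum>k=1..K. 1 - cdf_of M (\<lambda>\<omega>. p k (X \<omega>)) t)"

definition G_inv :: "'w measure \<Rightarrow> nat \<Rightarrow> ('w \<Rightarrow> 'x) \<Rightarrow> (nat \<Rightarrow> 'x \<Rightarrow> real) \<Rightarrow> real \<Rightarrow> real" where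
  "G_inv M K X p \<beta> = Inf {t \<in> {0..1}. G_fun M K X p t \<le> \<beta>}"

definition oracle_set ::
    "'w measure \<Rightarrow> nat \<Rightarrow> ('w \<Rightarrow> 'x) \<Rightarrow> (nat \<Rightarrow> 'x \<Rightarrow> real) \<Rightarrow> real \<Rightarrow> 'x \<Rightarrow> nat set" where
  "oracle_set M K X p \<beta> x = {k \<in> {1..K}. p k x \<ge> G_inv M K X p \<beta>}"

definition level_set :: "nat \<Rightarrow> 'x score \<Rightarrow> real \<Rightarrow> 'x \<Rightarrow> nat set" where
  "level_set K f \<delta> x = {k \<in> {1..K}. f k x \<ge> - \<delta>}"


subsection \<open>The \<open>\<phi>\<close>-risk\<close>

definition score_functions :: "'x measure \<Rightarrow> nat \<Rightarrow> 'x score set" where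
  "score_functions S K = {f. \<forall>k\<in>{1..K}. f k \<in> borel_measurable S}"

definition phi_loss :: "nat \<Rightarrow> (real \<Rightarrow> real) \<Rightarrow> 'x score \<Rightarrow> 'x \<Rightarrow> nat \<Rightarrow> real" where
  "phi_loss K \<phi> f x y = (\<Sum>k=1..K. \<phi> ((2 * of_bool (y = k) - 1) * f k x))"

definition phi_risk ::
    "'w measure \<Rightarrow> nat \<Rightarrow> ('w \<Rightarrow> 'x) \<Rightarrow> ('w \<Rightarrow> nat) \<Rightarrow> (real \<Rightarrow> real) \<Rightarrow> 'x score \<Rightarrow> real" where
  "phi_risk M K X Y \<phi> f = (\<integral>\<omega>. phi_loss K \<phi> f (X \<omega>) (Y \<omega>) \<partial>M)"

text \<open>The integral of a non-integrable function is \<open>0\<close> by convention, hence the restriction to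
  scores with an integrable loss.\<close>

definition phi_minimizer ::
    "'w measure \<Rightarrow> 'x measure \<Rightarrow> nat \<Rightarrow> ('w \<Rightarrow> 'x) \<Rightarrow> ('w \<Rightarrow> nat) \<Rightarrow> (real \<Rightarrow> real) \<Rightarrow> 'x score \<Rightarrow> bool" where
  "phi_minimizer M S K X Y \<phi> fs \<longleftrightarrow>
     is_arg_min (phi_risk M K X Y \<phi>)
       (\<lambda>f. f \<in> score_functions S K \<and> integrable M (\<lambda>\<omega>. phi_loss K \<phi> f (X \<omega>) (Y \<omega>))) fs"

definition excess_phi_risk ::
    "'w measure \<Rightarrow> nat \<Rightarrow> ('w \<Rightarrow> 'x) \<Rightarrow> ('w \<Rightarrow> nat) \<Rightarrow> (real \<Rightarrow> real) \<Rightarrow> 'x score \<Rightarrow> 'x score \<Rightarrow> real" where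
  "excess_phi_risk M K X Y \<phi> fs f = phi_risk M K X Y \<phi> f - phi_risk M K X Y \<phi> fs"

definition marginal_excess ::
    "(nat \<Rightarrow> 'x \<Rightarrow> real) \<Rightarrow> (real \<Rightarrow> real) \<Rightarrow> 'x score \<Rightarrow> nat \<Rightarrow> 'x score \<Rightarrow> 'x \<Rightarrow> real" where
  "marginal_excess p \<phi> fs k f x =
     p k x * (\<phi> (f k x) - \<phi> (fs k x)) + (1 - p k x) * (\<phi> (- f k x) - \<phi> (- fs k x))"

text \<open>Scores and conditional probabilities are only determined up to null sets, so equality of
  the confidence sets is almost sure equality.\<close>

definition calibrated_at ::
    "'w measure \<Rightarrow> nat \<Rightarrow> ('w \<Rightarrow> 'x) \<Rightarrow> (nat \<Rightarrow> 'x \<Rightarrow> real) \<Rightarrow> 'x score \<Rightarrow> real \<Rightarrow> real \<Rightarrow> bool" where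
  "calibrated_at M K X p fs \<beta> \<delta> \<longleftrightarrow>
     (AE \<omega> in M. level_set K fs \<delta> (X \<omega>) = oracle_set M K X p \<beta> (X \<omega>))"

definition confidence_set_calibrated ::
    "'w measure \<Rightarrow> nat \<Rightarrow> ('w \<Rightarrow> 'x) \<Rightarrow> (nat \<Rightarrow> 'x \<Rightarrow> real) \<Rightarrow> 'x score \<Rightarrow> bool" where
  "confidence_set_calibrated M K X p fs \<longleftrightarrow>
     (\<forall>\<beta>. 0 < \<beta> \<and> \<beta> < real K \<longrightarrow> (\<exists>\<delta>. calibrated_at M K X p fs \<beta> \<delta>))"


subsection \<open>Classes of score functions\<close>

definition convex_scores :: "'x score set \<Rightarrow> bool" where
  "convex_scores F \<longleftrightarrow>
     (\<forall>f\<in>F. \<forall>g\<in>F. \<forall>t\<in>{0..1}. (\<lambda>k x. (1 - t) * f k x + t * g k x) \<in> F)"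

definition Linf_norm :: "'x measure \<Rightarrow> nat \<Rightarrow> 'x score \<Rightarrow> ereal" where
  "Linf_norm S K f = (SUP k\<in>{1..K}. SUP x\<in>space S. ereal \<bar>f k x\<bar>)"

definition Linf_cball :: "'x measure \<Rightarrow> nat \<Rightarrow> 'x score \<Rightarrow> real \<Rightarrow> 'x score set" where
  "Linf_cball S K g r = {f. Linf_norm S K (\<lambda>k x. f k x - g k x) \<le> ereal r}"

text \<open>The value is \<open>\<infinity>\<close> if there is no finite cover.\<close>

definition covering_number :: "'x measure \<Rightarrow> nat \<Rightarrow> real \<Rightarrow> 'x score set \<Rightarrow> enat" where
  "covering_number S K r F =
     (INF C\<in>{C. finite C \<and> C \<subseteq> score_functions S K \<and> F \<subseteq> (\<Union>g\<in>C. Linf_cball S K g r)}. enat (card C))"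

text \<open>With values in \<open>ereal\<close>, the infimum over an empty set of pairs is \<open>\<infinity>\<close>.\<close>

definition convexity_modulus ::
    "'w measure \<Rightarrow> nat \<Rightarrow> ('w \<Rightarrow> 'x) \<Rightarrow> ('w \<Rightarrow> nat) \<Rightarrow> (real \<Rightarrow> real) \<Rightarrow> 'x score set \<Rightarrow> real \<Rightarrow> ereal" where
  "convexity_modulus M K X Y \<phi> F \<epsilon> =
     (INF (f, g)\<in>{(f, g). f \<in> F \<and> g \<in> F \<and>
                    (\<Sum>k=1..K. \<integral>\<omega>. (f k (X \<omega>) - g k (X \<omega>))\<^sup>2 \<partial>M) \<ge> \<epsilon>\<^sup>2}.
        ereal ((phi_risk M K X Y \<phi> f + phi_risk M K X Y \<phi> g) / 2
               - phi_risk M K X Y \<phi> (\<lambda>k x. (f k x + g k x) / 2)))"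


subsection \<open>Samples and the empirical procedure\<close>

text \<open>Stated through the generated \<open>\<sigma>\<close>-algebras, since \<open>indep_var\<close> needs both variables to have
  the same type of values.\<close>

definition indep_of ::
    "'w measure \<Rightarrow> 'a measure \<Rightarrow> ('w \<Rightarrow> 'a) \<Rightarrow> 'b measure \<Rightarrow> ('w \<Rightarrow> 'b) \<Rightarrow> bool" where
  "indep_of M MA A MB B \<longleftrightarrow>
     A \<in> M \<rightarrow>\<^sub>M MA \<and> B \<in> M \<rightarrow>\<^sub>M MB \<and>
     prob_space.indep_set M (sets (generated_algebra M A MA)) (sets (generated_algebra M B MB))"

definition sample :: "nat \<Rightarrow> (nat \<Rightarrow> 'w \<Rightarrow> 'a) \<Rightarrow> 'w \<Rightarrow> nat \<Rightarrow> 'a" where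
  "sample n V \<omega> = (\<lambda>i\<in>{..<n}. V i \<omega>)"

abbreviation labelled_space :: "'x measure \<Rightarrow> nat \<Rightarrow> nat \<Rightarrow> (nat \<Rightarrow> 'x \<times> nat) measure" where
  "labelled_space S K n \<equiv> PiM {..<n} (\<lambda>_. pair_space S K)"

abbreviation unlabelled_space :: "'x measure \<Rightarrow> nat \<Rightarrow> (nat \<Rightarrow> 'x) measure" where
  "unlabelled_space S N \<equiv> PiM {..<N} (\<lambda>_. S)"

definition independent_copies ::
    "'w measure \<Rightarrow> 'a measure \<Rightarrow> nat \<Rightarrow> (nat \<Rightarrow> 'w \<Rightarrow> 'a) \<Rightarrow> ('w \<Rightarrow> 'a) \<Rightarrow> bool" where
  "independent_copies M MA n V V0 \<longleftrightarrow>
     prob_space.indep_vars M (\<lambda>_. MA) V {..<n} \<and> (\<forall>i<n. distr M MA (V i) = distr M MA V0)"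

definition data_samples ::
    "'w measure \<Rightarrow> 'x measure \<Rightarrow> nat \<Rightarrow> ('w \<Rightarrow> 'x) \<Rightarrow> ('w \<Rightarrow> nat) \<Rightarrow>
     nat \<Rightarrow> nat \<Rightarrow> (nat \<Rightarrow> 'w \<Rightarrow> 'x \<times> nat) \<Rightarrow> (nat \<Rightarrow> 'w \<Rightarrow> 'x) \<Rightarrow> bool" where
  "data_samples M S K X Y n N D U \<longleftrightarrow>
     independent_copies M (pair_space S K) n D (\<lambda>\<omega>. (X \<omega>, Y \<omega>)) \<and>
     independent_copies M S N U X \<and>
     indep_of M (labelled_space S K n) (sample n D) (unlabelled_space S N) (sample N U) \<and>
     indep_of M (pair_space S K) (\<lambda>\<omega>. (X \<omega>, Y \<omega>))
       (labelled_space S K n \<Otimes>\<^sub>M unlabelled_space S N) (\<lambda>\<omega>. (sample n D \<omega>, sample N U \<omega>))"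

definition empirical_phi_risk ::
    "nat \<Rightarrow> nat \<Rightarrow> (real \<Rightarrow> real) \<Rightarrow> (nat \<Rightarrow> 'x \<times> nat) \<Rightarrow> 'x score \<Rightarrow> real" where
  "empirical_phi_risk K n \<phi> d f = (1 / real n) * (\<Sum>i<n. phi_loss K \<phi> f (fst (d i)) (snd (d i)))"

text \<open>An estimator maps a labelled sample to a score function, measurably in the sample and the
  point jointly.\<close>

definition phi_erm ::
    "'w measure \<Rightarrow> 'x measure \<Rightarrow> nat \<Rightarrow> nat \<Rightarrow> (nat \<Rightarrow> 'w \<Rightarrow> 'x \<times> nat) \<Rightarrow> (real \<Rightarrow> real) \<Rightarrow> 'x score set \<Rightarrow>
     ((nat \<Rightarrow> 'x \<times> nat) \<Rightarrow> 'x score) \<Rightarrow> bool" where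
  "phi_erm M S K n D \<phi> F fhat \<longleftrightarrow>
     (\<forall>k\<in>{1..K}. (\<lambda>(d, x). fhat d k x) \<in> borel_measurable (labelled_space S K n \<Otimes>\<^sub>M S)) \<and>
     (AE \<omega> in M. is_arg_min (empirical_phi_risk K n \<phi> (sample n D \<omega>)) (\<lambda>f. f \<in> F) (fhat (sample n D \<omega>)))"

definition empirical_G :: "nat \<Rightarrow> nat \<Rightarrow> (nat \<Rightarrow> 'x) \<Rightarrow> 'x score \<Rightarrow> real \<Rightarrow> real" where
  "empirical_G K N u f t = (1 / real N) * (\<Sum>i<N. \<Sum>k=1..K. of_bool (f k (u i) \<ge> t))"

definition empirical_set :: "nat \<Rightarrow> nat \<Rightarrow> (nat \<Rightarrow> 'x) \<Rightarrow> 'x score \<Rightarrow> real \<Rightarrow> 'x \<Rightarrow> nat set" where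
  "empirical_set K N u f \<beta> x = {k \<in> {1..K}. empirical_G K N u f (f k x) \<le> \<beta>}"

text \<open>Conditional probability of \<open>Y \<notin> \<Gamma>(X)\<close> given both samples, for the empirical set \<open>\<Gamma>\<close>.\<close>

definition empirical_set_risk ::
    "'w measure \<Rightarrow> 'x measure \<Rightarrow> nat \<Rightarrow> ('w \<Rightarrow> 'x) \<Rightarrow> ('w \<Rightarrow> nat) \<Rightarrow>
     nat \<Rightarrow> nat \<Rightarrow> (nat \<Rightarrow> 'w \<Rightarrow> 'x \<times> nat) \<Rightarrow> (nat \<Rightarrow> 'w \<Rightarrow> 'x) \<Rightarrow>
     ((nat \<Rightarrow> 'x \<times> nat) \<Rightarrow> 'x score) \<Rightarrow> real \<Rightarrow> 'w \<Rightarrow> real" where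
  "empirical_set_risk M S K X Y n N D U fhat \<beta> =
     real_cond_exp M
       (generated_algebra M (\<lambda>\<omega>. (sample n D \<omega>, sample N U \<omega>))
          (labelled_space S K n \<Otimes>\<^sub>M unlabelled_space S N))
       (indicator {\<omega> \<in> space M.
          Y \<omega> \<notin> empirical_set K N (sample N U \<omega>) (fhat (sample n D \<omega>)) \<beta> (X \<omega>)})"

end

theory Submission
  imports Defs
begin

text \<open>The empirical set \<open>\<Gamma>\<close> and the level set of the estimated score \<open>f\<close> at the oracle threshold
  \<open>-\<delta>\<close> are nested, so their risks differ by at most the difference of their informations. Since
  the oracle set has information \<open>\<beta>\<close>, the excess risk is at most \<open>\<bar>I(\<Gamma>) - \<beta>\<bar>\<close> plus twice the expected
  size \<open>\<Delta>\<close> of the symmetric difference of the level set and the oracle set.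

  The first term is \<open>O(K / sqrt N)\<close> by Hoeffding's inequality. For the second, \<open>-\<delta>\<close> lies between
  \<open>f k x\<close> and \<open>fs k x\<close> wherever the two sets differ, so convexity and the noise condition bound
  \<open>\<bar>p k x - t\<bar> powr s\<close> by the marginal excess of \<open>f\<close>; splitting at \<open>\<bar>p k x - t\<bar> = h\<close> gives
  \<open>\<Delta> \<le> K c\<^sub>2 h powr \<alpha> + C\<^sub>0 h powr (- s) E\<close> with \<open>E\<close> the excess \<open>\<phi>\<close>-risk of \<open>f\<close>. This is linear in \<open>E\<close>,
  so \<open>h\<close> can be chosen from the bound on the mean of \<open>E\<close>.

  That bound has the fast rate because the modulus of convexity yields a Bernstein condition for
  the loss differences, so that an exponential moment of half the mean minus the empirical mean is
  at most one.\<close>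

subsection \<open>Conditional expectations and class probabilities\<close>

text \<open>The threshold that \<open>empirical_G\<close> induces is random. Comparing with the
  level set at the fixed threshold -\<delta> removes it, and only a scalar, the information, has to
  concentrate. Conditioning on the labelled sample freezes the score, so Hoeffding's inequality is
  applied to one score and one threshold at a time and no uniform bound is involved.

  \<open>fs\<close> minimizes over all measurable scores and may be unbounded, with only its total
  loss known to be integrable; splitting the excess risk into marginal excesses therefore goes
  through truncation. \<open>F\<close> need neither contain \<open>fs\<close> nor attain its
  infimum, so the Bernstein condition is centred at an almost minimizer inside \<open>F\<close>, and
  the approximation error enters additively.

  The level h is the deterministic number at which K h^\<alpha> and h^(-s) q agree, with q the
  expression in braces of the claim. The constant 3 in front of K / sqrt N is 1 plus twice a
  geometric series with sum at most 1.\<close>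

lemma subalgebra_generated_algebra:
  assumes "A \<in> M \<rightarrow>\<^sub>M MA"
  shows "subalgebra M (generated_algebra M A MA)"
proof -
  have "A \<in> space M \<rightarrow> space MA"
    using assms by (auto dest: measurable_space)
  then show ?thesis
    using assms
    by (auto simp: subalgebra_def generated_algebra_def sets_vimage_algebra2 intro: measurable_sets)
qed

lemma measurable_generated_algebra:
  assumes "A \<in> M \<rightarrow>\<^sub>M MA" "h \<in> MA \<rightarrow>\<^sub>M N"
  shows "(\<lambda>\<omega>. h (A \<omega>)) \<in> generated_algebra M A MA \<rightarrow>\<^sub>M N"
proof -
  have "A \<in> space M \<rightarrow> space MA"
    using assms by (auto dest: measurable_space)
  then have "A \<in> generated_algebra M A MA \<rightarrow>\<^sub>M MA"
    unfolding generated_algebra_def by (rule measurable_vimage_algebra1)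
  then show ?thesis
    using assms(2) by (rule measurable_compose)
qed

lemma (in prob_space) sigma_finite_generated_algebra:
  assumes "A \<in> M \<rightarrow>\<^sub>M MA"
  shows "sigma_finite_subalgebra M (generated_algebra M A MA)"
  by (intro finite_measure_subalgebra_is_sigma_finite)
     (simp add: finite_measure_subalgebra_def finite_measure_subalgebra_axioms_def
       finite_measure_axioms subalgebra_generated_algebra[OF assms])

text \<open>On rectangles this is the product rule for the two generated algebras, and rectangles
  determine a product of probability measures.\<close>

lemma (in prob_space) indep_of_distr:
  assumes "indep_of M MA A MB B"
  shows "distr M (MA \<Otimes>\<^sub>M MB) (\<lambda>\<omega>. (A \<omega>, B \<omega>)) = distr M MA A \<Otimes>\<^sub>M distr M MB B"
proof -
  have A [measurable]: "A \<in> M \<rightarrow>\<^sub>M MA" and B [measurable]: "B \<in> M \<rightarrow>\<^sub>M MB"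
    and ind: "indep_set (sets (generated_algebra M A MA)) (sets (generated_algebra M B MB))"
    using assms by (auto simp: indep_of_def)
  interpret A: prob_space "distr M MA A" by (rule prob_space_distr) simp
  interpret B: prob_space "distr M MB B" by (rule prob_space_distr) simp
  show ?thesis
  proof (rule sym, rule pair_measure_eqI)
    show "sets (distr M MA A \<Otimes>\<^sub>M distr M MB B) =
        sets (distr M (MA \<Otimes>\<^sub>M MB) (\<lambda>\<omega>. (A \<omega>, B \<omega>)))"
      by (simp cong: sets_pair_measure_cong)
  next
    fix a b assume "a \<in> sets (distr M MA A)" "b \<in> sets (distr M MB B)"
    then have a [measurable]: "a \<in> sets MA" and b [measurable]: "b \<in> sets MB" by auto
    have sp: "A \<in> space M \<rightarrow> space MA" "B \<in> space M \<rightarrow> space MB"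
      using measurable_space[OF A] measurable_space[OF B] by auto
    have "A -` a \<inter> space M \<in> sets (generated_algebra M A MA)"
      "B -` b \<inter> space M \<in> sets (generated_algebra M B MB)"
      using sp a b by (auto simp: generated_algebra_def sets_vimage_algebra2)
    from indep_setD[OF ind this]
    have "prob ((A -` a \<inter> space M) \<inter> (B -` b \<inter> space M)) = prob (A -` a \<inter> space M) * prob (B -` b \<inter> space M)" .
    moreover have "(\<lambda>\<omega>. (A \<omega>, B \<omega>)) -` (a \<times> b) \<inter> space M = (A -` a \<inter> space M) \<inter> (B -` b \<inter> space M)"
      by auto
    ultimately show "emeasure (distr M MA A) a * emeasure (distr M MB B) b =
        emeasure (distr M (MA \<Otimes>\<^sub>M MB) (\<lambda>\<omega>. (A \<omega>, B \<omega>))) (a \<times> b)"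
      by (simp add: emeasure_distr emeasure_eq_measure ennreal_mult[symmetric])
  qed (unfold_locales)
qed

text \<open>Fubini for the product law: \<open>B\<close> is evaluated at a fresh point \<omega>',
  which leaves \<open>A \<omega>\<close> frozen in the inner integral. Every argument given a sample
  rests on this form.\<close>

lemma (in prob_space) indep_of_nn_integral:
  assumes "indep_of M MA A MB B" and [measurable]: "case_prod h \<in> borel_measurable (MA \<Otimes>\<^sub>M MB)"
  shows "(\<integral>\<^sup>+\<omega>. h (A \<omega>) (B \<omega>) \<partial>M) = (\<integral>\<^sup>+\<omega>. \<integral>\<^sup>+\<omega>'. h (A \<omega>) (B \<omega>') \<partial>M \<partial>M)"
proof -
  have A [measurable]: "A \<in> M \<rightarrow>\<^sub>M MA" and B [measurable]: "B \<in> M \<rightarrow>\<^sub>M MB"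
    using assms by (auto simp: indep_of_def)
  interpret B: prob_space "distr M MB B" by (rule prob_space_distr) simp
  have "(\<integral>\<^sup>+\<omega>. h (A \<omega>) (B \<omega>) \<partial>M) = (\<integral>\<^sup>+z. case_prod h z \<partial>distr M (MA \<Otimes>\<^sub>M MB) (\<lambda>\<omega>. (A \<omega>, B \<omega>)))"
    by (subst nn_integral_distr) auto
  also have "\<dots> = (\<integral>\<^sup>+a. \<integral>\<^sup>+b. h a b \<partial>distr M MB B \<partial>distr M MA A)"
    unfolding indep_of_distr[OF assms(1)]
    by (subst B.nn_integral_fst[symmetric]) (auto cong: measurable_cong_sets)
  also have "\<dots> = (\<integral>\<^sup>+\<omega>. (\<integral>\<^sup>+b. h (A \<omega>) b \<partial>distr M MB B) \<partial>M)"
    by (subst nn_integral_distr) (auto cong: measurable_cong_sets)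
  also have "\<dots> = (\<integral>\<^sup>+\<omega>. \<integral>\<^sup>+\<omega>'. h (A \<omega>) (B \<omega>') \<partial>M \<partial>M)"
    by (intro nn_integral_cong, subst nn_integral_distr)
       (auto intro: measurable_Pair2[where f="case_prod h", simplified] dest: measurable_space[OF A])
  finally show ?thesis .
qed

section \<open>Labelled pairs and versions of the class probabilities\<close>

locale labelled_pair = prob_space M for M :: "'w measure" +
  fixes S :: "'x measure" and K :: nat and X :: "'w \<Rightarrow> 'x" and Y :: "'w \<Rightarrow> nat"
  assumes X [measurable]: "X \<in> M \<rightarrow>\<^sub>M S" and Y: "Y \<in> M \<rightarrow>\<^sub>M count_space {1..K}"
begin

lemma Y_measurable [measurable]: "Y \<in> M \<rightarrow>\<^sub>M count_space UNIV"
  using measurable_compose[OF Y, of id "count_space UNIV"] by simp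

lemma Y_in: "\<omega> \<in> space M \<Longrightarrow> Y \<omega> \<in> {1..K}"
  using measurable_space[OF Y] by simp

end

locale class_prob_pair = labelled_pair M S K X Y for M :: "'w measure" and S :: "'x measure" and K X Y +
  fixes p :: "nat \<Rightarrow> 'x \<Rightarrow> real"
  assumes class_prob: "class_prob M S K X Y p"
begin

lemma p_measurable [measurable]: "k \<in> {1..K} \<Longrightarrow> p k \<in> borel_measurable S"
  using class_prob by (simp add: class_prob_def)

lemma p_eq_cond_exp:
  assumes "k \<in> {1..K}"
  shows "AE \<omega> in M. p k (X \<omega>) =
    real_cond_exp M (generated_algebra M X S) (indicator {\<omega> \<in> space M. Y \<omega> = k}) \<omega>"
  using class_prob assms by (simp add: class_prob_def)

text \<open>\<open>p k\<close> is only a version of a conditional expectation, so the bounds pass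
  from the indicator to it almost surely and not at every point.\<close>

lemma p_bounds:
  assumes "k \<in> {1..K}"
  shows "AE \<omega> in M. 0 \<le> p k (X \<omega>) \<and> p k (X \<omega>) \<le> 1"
proof -
  interpret sigma_finite_subalgebra M "generated_algebra M X S"
    by (rule sigma_finite_generated_algebra) simp
  have [simp]: "integrable M (indicator {\<omega> \<in> space M. Y \<omega> = k} :: 'w \<Rightarrow> real)"
    by (simp add: emeasure_eq_measure less_top[symmetric])
  have "AE \<omega> in M. real_cond_exp M (generated_algebra M X S) (indicator {\<omega> \<in> space M. Y \<omega> = k}) \<omega> \<ge> 0"
    "AE \<omega> in M. real_cond_exp M (generated_algebra M X S) (indicator {\<omega> \<in> space M. Y \<omega> = k}) \<omega> \<le> 1"
    by (intro real_cond_exp_ge_c real_cond_exp_le_c; simp add: indicator_def)+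
  with p_eq_cond_exp[OF assms] show ?thesis
    by eventually_elim simp
qed

text \<open>\<open>h (X \<omega>)\<close> is measurable for the algebra generated by
  \<open>X\<close>, so the defining property of conditional expectation exchanges the indicator of
  the class for \<open>p k\<close>; the bound on \<open>h\<close> supplies integrability.\<close>

lemma integral_indicator_class:
  assumes k: "k \<in> {1..K}" and [measurable]: "h \<in> borel_measurable S"
    and bd: "\<And>x. x \<in> space S \<Longrightarrow> \<bar>h x\<bar> \<le> c"
  shows "(\<integral>\<omega>. h (X \<omega>) * of_bool (Y \<omega> = k) \<partial>M) = (\<integral>\<omega>. h (X \<omega>) * p k (X \<omega>) \<partial>M)"
proof -
  let ?F = "generated_algebra M X S"
  let ?I = "indicator {\<omega> \<in> space M. Y \<omega> = k} :: 'w \<Rightarrow> real"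
  interpret sigma_finite_subalgebra M ?F
    by (rule sigma_finite_generated_algebra) simp
  have [measurable]: "p k \<in> borel_measurable S" using k by simp
  have "0 \<le> c"
    using bd measurable_space[OF X] not_empty by (meson abs_ge_zero ex_in_conv order_trans)
  have "integrable M (\<lambda>\<omega>. h (X \<omega>) * ?I \<omega>)"
    by (rule integrable_const_bound[where B=c])
       (use bd measurable_space[OF X] \<open>0 \<le> c\<close> in \<open>auto simp: indicator_def\<close>)
  from real_cond_exp_intg(2)[OF this measurable_generated_algebra[OF X \<open>h \<in> borel_measurable S\<close>]]
  have "(\<integral>\<omega>. h (X \<omega>) * ?I \<omega> \<partial>M) = (\<integral>\<omega>. h (X \<omega>) * real_cond_exp M ?F ?I \<omega> \<partial>M)"
    by simp
  also have "\<dots> = (\<integral>\<omega>. h (X \<omega>) * p k (X \<omega>) \<partial>M)"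
  proof (rule integral_cong_AE)
    show "(\<lambda>\<omega>. h (X \<omega>) * real_cond_exp M ?F ?I \<omega>) \<in> borel_measurable M"
      using borel_measurable_cond_exp2 by measurable
    show "AE \<omega> in M. h (X \<omega>) * real_cond_exp M ?F ?I \<omega> = h (X \<omega>) * p k (X \<omega>)"
      using p_eq_cond_exp[OF k] by eventually_elim simp
  qed measurable
  finally show ?thesis
    by (simp add: indicator_def of_bool_def cong: Bochner_Integration.integral_cong)
qed

text \<open>The k-th term of the \<phi>-loss depends on the label only through Y = k. Integrating
  such a term weights its two values by p and 1 - p, which is the shape of
  \<open>marginal_excess\<close>.\<close>

lemma integral_class_choice:
  assumes k: "k \<in> {1..K}" and [measurable]: "a \<in> borel_measurable S" "b \<in> borel_measurable S"
    and bd: "\<And>x. x \<in> space S \<Longrightarrow> \<bar>a x\<bar> \<le> c" "\<And>x. x \<in> space S \<Longrightarrow> \<bar>b x\<bar> \<le> c"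
  shows "integrable M (\<lambda>\<omega>. if Y \<omega> = k then a (X \<omega>) else b (X \<omega>))"
    and "integrable M (\<lambda>\<omega>. p k (X \<omega>) * a (X \<omega>) + (1 - p k (X \<omega>)) * b (X \<omega>))"
    and "(\<integral>\<omega>. (if Y \<omega> = k then a (X \<omega>) else b (X \<omega>)) \<partial>M) =
      (\<integral>\<omega>. p k (X \<omega>) * a (X \<omega>) + (1 - p k (X \<omega>)) * b (X \<omega>) \<partial>M)"
proof -
  have [measurable]: "p k \<in> borel_measurable S" using k by simp
  have bd': "\<bar>a (X \<omega>)\<bar> \<le> c" "\<bar>b (X \<omega>)\<bar> \<le> c" if "\<omega> \<in> space M" for \<omega>
    using bd measurable_space[OF X that] by auto
  have "0 \<le> c"
    using bd' not_empty by (meson abs_ge_zero ex_in_conv order_trans)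
  have [simp]: "integrable M (\<lambda>\<omega>. a (X \<omega>))" "integrable M (\<lambda>\<omega>. b (X \<omega>))"
    using bd' by (auto intro!: integrable_const_bound[where B=c])
  have 1: "integrable M (\<lambda>\<omega>. g (X \<omega>) * of_bool (Y \<omega> = k))"
    if "\<And>\<omega>. \<omega> \<in> space M \<Longrightarrow> \<bar>g (X \<omega>)\<bar> \<le> c" and [measurable]: "g \<in> borel_measurable S" for g
    using that(1) \<open>0 \<le> c\<close> by (intro integrable_const_bound[where B=c]) auto
  have 2: "integrable M (\<lambda>\<omega>. g (X \<omega>) * p k (X \<omega>))"
    if bg: "\<And>\<omega>. \<omega> \<in> space M \<Longrightarrow> \<bar>g (X \<omega>)\<bar> \<le> c" and [measurable]: "g \<in> borel_measurable S" for g
  proof (intro integrable_const_bound[where B=c])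
    show "AE \<omega> in M. norm (g (X \<omega>) * p k (X \<omega>)) \<le> c"
      using p_bounds[OF k] AE_space
    proof eventually_elim
      case (elim \<omega>)
      then have "\<bar>g (X \<omega>)\<bar> * \<bar>p k (X \<omega>)\<bar> \<le> c * 1"
        by (intro mult_mono bg) (auto intro: order_trans[OF abs_ge_zero bg])
      then show ?case by (simp add: abs_mult)
    qed
  qed measurable
  have i: "integrable M (\<lambda>\<omega>. a (X \<omega>) * of_bool (Y \<omega> = k))" "integrable M (\<lambda>\<omega>. b (X \<omega>) * of_bool (Y \<omega> = k))"
    "integrable M (\<lambda>\<omega>. a (X \<omega>) * p k (X \<omega>))" "integrable M (\<lambda>\<omega>. b (X \<omega>) * p k (X \<omega>))"
    by (intro 1 2 bd'; simp)+
  \<comment> \<open>Both integrands are the same affine expression, once in the indicator of the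
    class and once in \<open>p k\<close>, so \<open>integral_indicator_class\<close> applies to each
    product.\<close>
  have e1: "(\<lambda>\<omega>. if Y \<omega> = k then a (X \<omega>) else b (X \<omega>)) =
    (\<lambda>\<omega>. b (X \<omega>) + a (X \<omega>) * of_bool (Y \<omega> = k) - b (X \<omega>) * of_bool (Y \<omega> = k))"
    by auto
  have e2: "(\<lambda>\<omega>. p k (X \<omega>) * a (X \<omega>) + (1 - p k (X \<omega>)) * b (X \<omega>)) =
    (\<lambda>\<omega>. b (X \<omega>) + a (X \<omega>) * p k (X \<omega>) - b (X \<omega>) * p k (X \<omega>))"
    by (auto simp: algebra_simps)
  show "integrable M (\<lambda>\<omega>. if Y \<omega> = k then a (X \<omega>) else b (X \<omega>))"
    unfolding e1 using i by simp
  show "integrable M (\<lambda>\<omega>. p k (X \<omega>) * a (X \<omega>) + (1 - p k (X \<omega>)) * b (X \<omega>))"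
    unfolding e2 using i by simp
  show "(\<integral>\<omega>. (if Y \<omega> = k then a (X \<omega>) else b (X \<omega>)) \<partial>M) =
      (\<integral>\<omega>. p k (X \<omega>) * a (X \<omega>) + (1 - p k (X \<omega>)) * b (X \<omega>) \<partial>M)"
    unfolding e1 e2 using i integral_indicator_class[OF k, of a c] integral_indicator_class[OF k, of b c] bd
    by simp
qed

end

subsection \<open>The marginal excess risk\<close>

lemma phi_loss_measurable [measurable]:
  assumes [measurable]: "\<phi> \<in> borel_measurable borel" and f: "f \<in> score_functions S K"
  shows "(\<lambda>z. phi_loss K \<phi> f (fst z) (snd z)) \<in> borel_measurable (pair_space S K)"
proof -
  have [measurable]: "f k \<in> borel_measurable S" if "k \<in> {1..K}" for k
    using f that by (simp add: score_functions_def)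
  have [measurable]: "(\<lambda>z. of_bool (snd z = k) :: real) \<in> borel_measurable (pair_space S K)" for k
    by (rule measurable_compose[OF measurable_snd]) simp
  show ?thesis
    unfolding phi_loss_def by measurable
qed

text \<open>Applied with u and v the values of the estimated and of the optimal score: a threshold
  on which they disagree lies on the segment between them, where convexity of \<phi> can be
  used.\<close>

lemma between_convex_comb:
  fixes a u v :: real
  assumes "(a \<le> u) \<noteq> (a \<le> v)"
  obtains \<tau> where "0 \<le> \<tau>" "\<tau> \<le> 1" "a = (1 - \<tau>) * u + \<tau> * v"
proof -
  have "a \<in> closed_segment u v"
    using assms by (auto simp: closed_segment_eq_real_ivl)
  then show ?thesis
    using that by (auto simp: closed_segment_def)
qed

section \<open>Marginal excesses: nonnegativity, sum, behaviour between two scores\<close>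

locale phi_risk_pair = class_prob_pair M S K X Y p
  for M :: "'w measure" and S :: "'x measure" and K X Y p +
  fixes \<phi> :: "real \<Rightarrow> real" and L :: real and fs :: "'x score"
  assumes convex: "convex_on UNIV \<phi>" and lipschitz: "L-lipschitz_on UNIV \<phi>"
    and minimizer: "phi_minimizer M S K X Y \<phi> fs"
begin

abbreviation loss :: "'x score \<Rightarrow> 'x \<Rightarrow> nat \<Rightarrow> real" where
  "loss \<equiv> phi_loss K \<phi>"

abbreviation excess :: "'x score \<Rightarrow> real" where
  "excess \<equiv> excess_phi_risk M K X Y \<phi> fs"

abbreviation marg :: "nat \<Rightarrow> 'x score \<Rightarrow> 'x \<Rightarrow> real" where
  "marg \<equiv> marginal_excess p \<phi> fs"

text \<open>The bound holds at every point of \<open>space S\<close>, as \<open>Linf_norm\<close>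
  gives it, and hence also at the sample points that enter the empirical risk.\<close>

definition bounded_scores :: "real \<Rightarrow> 'x score set" where
  "bounded_scores B = {f \<in> score_functions S K. \<forall>k\<in>{1..K}. \<forall>x\<in>space S. \<bar>f k x\<bar> \<le> B}"

lemma phi_measurable [measurable]: "\<phi> \<in> borel_measurable borel"
  using lipschitz by (intro borel_measurable_continuous_onI lipschitz_on_continuous_on)

lemma phi_bound: "\<bar>u\<bar> \<le> b \<Longrightarrow> \<bar>\<phi> u\<bar> \<le> \<bar>\<phi> 0\<bar> + L * b"
proof -
  assume u: "\<bar>u\<bar> \<le> b"
  have "\<bar>\<phi> u - \<phi> 0\<bar> \<le> L * \<bar>u - 0\<bar>"
    using lipschitz_onD[OF lipschitz, of u 0] by (simp add: dist_real_def)
  also have "\<dots> \<le> L * b"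
    using u lipschitz_on_nonneg[OF lipschitz] by (intro mult_left_mono) auto
  finally show ?thesis by simp
qed

lemma scoreD [measurable_dest]: "f \<in> score_functions S K \<Longrightarrow> k \<in> {1..K} \<Longrightarrow> f k \<in> borel_measurable S"
  by (simp add: score_functions_def)

lemma minimizer_score: "fs \<in> score_functions S K"
  and minimizer_integrable: "integrable M (\<lambda>\<omega>. loss fs (X \<omega>) (Y \<omega>))"
  and minimizer_le: "f \<in> score_functions S K \<Longrightarrow> integrable M (\<lambda>\<omega>. loss f (X \<omega>) (Y \<omega>)) \<Longrightarrow>
     phi_risk M K X Y \<phi> fs \<le> phi_risk M K X Y \<phi> f"
  using minimizer by (auto simp: phi_minimizer_def is_arg_min_def not_less)

lemma loss_measurable [measurable]:
  assumes "f \<in> score_functions S K"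
  shows "(\<lambda>\<omega>. loss f (X \<omega>) (Y \<omega>)) \<in> borel_measurable M"
  using measurable_compose[OF measurable_Pair[OF X Y] phi_loss_measurable[OF phi_measurable assms]]
  by simp

lemma bounded_scoresD:
  assumes "f \<in> bounded_scores B"
  shows "f \<in> score_functions S K" "\<And>k x. k \<in> {1..K} \<Longrightarrow> x \<in> space S \<Longrightarrow> \<bar>f k x\<bar> \<le> B"
  using assms by (auto simp: bounded_scores_def)

lemma loss_bound:
  assumes "f \<in> bounded_scores B" "x \<in> space S"
  shows "\<bar>loss f x y\<bar> \<le> real K * (\<bar>\<phi> 0\<bar> + L * B)"
proof -
  have "\<bar>loss f x y\<bar> \<le> (\<Sum>k=1..K. \<bar>\<phi> ((2 * of_bool (y = k) - 1) * f k x)\<bar>)"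
    unfolding phi_loss_def by (rule sum_abs)
  also have "\<dots> \<le> (\<Sum>k=1..K. \<bar>\<phi> 0\<bar> + L * B)"
    using bounded_scoresD[OF assms(1)] assms(2)
    by (intro sum_mono phi_bound) (auto simp: abs_mult)
  finally show ?thesis by simp
qed

lemma loss_integrable:
  assumes "f \<in> bounded_scores B"
  shows "integrable M (\<lambda>\<omega>. loss f (X \<omega>) (Y \<omega>))"
  using loss_bound[OF assms] measurable_space[OF X] bounded_scoresD(1)[OF assms]
  by (intro integrable_const_bound[where B="real K * (\<bar>\<phi> 0\<bar> + L * B)"]) auto

lemma excess_nonneg:
  assumes "f \<in> bounded_scores B"
  shows "0 \<le> excess f"
  using minimizer_le[OF bounded_scoresD(1)[OF assms] loss_integrable[OF assms]]
  by (simp add: excess_phi_risk_def)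

lemma marg_measurable [measurable]:
  assumes [measurable]: "f \<in> score_functions S K" "k \<in> {1..K}"
  shows "marg k f \<in> borel_measurable S"
  using minimizer_score unfolding marginal_excess_def by measurable

text \<open>Restricting to a set where \<open>fs k\<close> is bounded makes the individual terms of the loss
  integrable, which is not known for \<open>fs\<close> itself.\<close>

lemma integral_marg_on:
  assumes f: "f \<in> bounded_scores B" and k: "k \<in> {1..K}" and A [measurable]: "A \<in> sets S"
    and bd: "\<And>x. x \<in> A \<Longrightarrow> \<bar>fs k x\<bar> \<le> m"
  defines "d \<equiv> \<lambda>x y. if y = k then indicator A x * (\<phi> (f k x) - \<phi> (fs k x))
    else indicator A x * (\<phi> (- f k x) - \<phi> (- fs k x))"
  shows "integrable M (\<lambda>\<omega>. d (X \<omega>) (Y \<omega>))"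
    and "integrable M (\<lambda>\<omega>. indicator A (X \<omega>) * marg k f (X \<omega>))"
    and "(\<integral>\<omega>. d (X \<omega>) (Y \<omega>) \<partial>M) = (\<integral>\<omega>. indicator A (X \<omega>) * marg k f (X \<omega>) \<partial>M)"
proof -
  note [measurable] = scoreD[OF minimizer_score k] scoreD[OF bounded_scoresD(1)[OF f] k]
  define c where "c = (\<bar>\<phi> 0\<bar> + L * B) + (\<bar>\<phi> 0\<bar> + L * m)"
  have L: "0 \<le> L" using lipschitz by (rule lipschitz_on_nonneg)
  obtain x0 where x0: "x0 \<in> space S" using not_empty measurable_space[OF X] by blast
  have B: "0 \<le> B" using bounded_scoresD(2)[OF f k x0] by simp
  have c: "\<bar>indicator A x * (\<phi> (\<sigma> * f k x) - \<phi> (\<sigma> * fs k x))\<bar> \<le> max c 0"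
    if "x \<in> space S" "\<bar>\<sigma>\<bar> = 1" for x \<sigma>
  proof (cases "x \<in> A")
    case True
    have "\<bar>\<phi> (\<sigma> * f k x)\<bar> \<le> \<bar>\<phi> 0\<bar> + L * B" "\<bar>\<phi> (\<sigma> * fs k x)\<bar> \<le> \<bar>\<phi> 0\<bar> + L * m"
      using that bounded_scoresD(2)[OF f k \<open>x \<in> space S\<close>] bd[OF True]
      by (auto intro!: phi_bound simp: abs_mult)
    then show ?thesis using True unfolding c_def indicator_def by simp
  qed simp
  have e: "(\<lambda>\<omega>. indicator A (X \<omega>) * marg k f (X \<omega>)) = (\<lambda>\<omega>.
      p k (X \<omega>) * (indicator A (X \<omega>) * (\<phi> (f k (X \<omega>)) - \<phi> (fs k (X \<omega>)))) +
      (1 - p k (X \<omega>)) * (indicator A (X \<omega>) * (\<phi> (- f k (X \<omega>)) - \<phi> (- fs k (X \<omega>)))))"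
    by (auto simp: marginal_excess_def algebra_simps)
  note * = integral_class_choice[OF k,
    of "\<lambda>x. indicator A x * (\<phi> (f k x) - \<phi> (fs k x))"
       "\<lambda>x. indicator A x * (\<phi> (- f k x) - \<phi> (- fs k x))" "max c 0"]
  show "integrable M (\<lambda>\<omega>. d (X \<omega>) (Y \<omega>))"
    unfolding d_def using c[of _ 1] c[of _ "-1"] by (intro *) auto
  show "integrable M (\<lambda>\<omega>. indicator A (X \<omega>) * marg k f (X \<omega>))"
    unfolding e using c[of _ 1] c[of _ "-1"] by (intro *) auto
  show "(\<integral>\<omega>. d (X \<omega>) (Y \<omega>) \<partial>M) = (\<integral>\<omega>. indicator A (X \<omega>) * marg k f (X \<omega>) \<partial>M)"
    unfolding e d_def using c[of _ 1] c[of _ "-1"] by (intro *) auto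
qed

text \<open>Minimality over all measurable scores is a local property: overwriting
  \<open>fs k\<close> by \<open>f k\<close> where the marginal excess is negative must not lower the
  risk. The change is made in component k only and where \<bar>fs k\<bar> \<le> m, so that the loss
  of the competitor stays integrable; a countable union over m removes this restriction.\<close>

lemma marg_nonneg:
  assumes f: "f \<in> bounded_scores B" and k: "k \<in> {1..K}"
  shows "AE \<omega> in M. 0 \<le> marg k f (X \<omega>)"
proof -
  note [measurable] = scoreD[OF minimizer_score k] marg_measurable[OF bounded_scoresD(1)[OF f] k]
  define A where "A m = {x \<in> space S. \<bar>fs k x\<bar> \<le> real m \<and> marg k f x < 0}" for m :: nat
  have A [measurable]: "A m \<in> sets S" for m
    unfolding A_def by measurable
  have "AE \<omega> in M. X \<omega> \<notin> A m" for m
  proof -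
    define f' where "f' = fs(k := \<lambda>x. if x \<in> A m then f k x else fs k x)"
    define d where "d x y = (if y = k then indicator (A m) x * (\<phi> (f k x) - \<phi> (fs k x))
      else indicator (A m) x * (\<phi> (- f k x) - \<phi> (- fs k x)))" for x y
    note d = integral_marg_on[OF f k A, of m "real m", folded d_def]
    have d': "integrable M (\<lambda>\<omega>. d (X \<omega>) (Y \<omega>))"
      "integrable M (\<lambda>\<omega>. indicator (A m) (X \<omega>) * marg k f (X \<omega>))"
      "(\<integral>\<omega>. d (X \<omega>) (Y \<omega>) \<partial>M) = (\<integral>\<omega>. indicator (A m) (X \<omega>) * marg k f (X \<omega>) \<partial>M)"
      by (rule d; simp add: A_def)+
    have "f' \<in> score_functions S K"
      unfolding score_functions_def
    proof (intro CollectI ballI)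
      fix j assume j: "j \<in> {1..K}"
      note [measurable] = scoreD[OF minimizer_score j] scoreD[OF bounded_scoresD(1)[OF f] j]
      show "f' j \<in> borel_measurable S"
        using k \<open>f j \<in> _\<close> \<open>fs j \<in> _\<close> by (cases "j = k") (auto simp: f'_def intro!: measurable_If_set)
    qed
    moreover have loss': "loss f' x y = loss fs x y + d x y" for x y
    proof -
      have "(\<Sum>j\<in>{1..K} - {k}. \<phi> ((2 * of_bool (y = j) - 1) * f' j x)) =
          (\<Sum>j\<in>{1..K} - {k}. \<phi> ((2 * of_bool (y = j) - 1) * fs j x))"
        by (intro sum.cong) (auto simp: f'_def)
      then show ?thesis
        using k unfolding phi_loss_def
        by (subst (1 2) sum.remove[of "{1..K}" k]) (auto simp: f'_def d_def indicator_def)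
    qed
    moreover have "integrable M (\<lambda>\<omega>. loss f' (X \<omega>) (Y \<omega>))"
      unfolding loss' using minimizer_integrable d'(1) by simp
    ultimately have "phi_risk M K X Y \<phi> fs \<le> phi_risk M K X Y \<phi> f'"
      by (intro minimizer_le)
    also have "\<dots> = phi_risk M K X Y \<phi> fs + (\<integral>\<omega>. indicator (A m) (X \<omega>) * marg k f (X \<omega>) \<partial>M)"
      unfolding phi_risk_def loss' using minimizer_integrable d' by simp
    \<comment> \<open>On \<open>A m\<close> the marginal excess is negative, so the integrand is at
      most 0 while minimality makes its integral at least 0. It vanishes almost surely, which is
      possible only off \<open>A m\<close>.\<close>
    finally have 1: "0 \<le> (\<integral>\<omega>. indicator (A m) (X \<omega>) * marg k f (X \<omega>) \<partial>M)"
      by simp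
    have nn: "AE \<omega> in M. 0 \<le> - (indicator (A m) (X \<omega>) * marg k f (X \<omega>))"
      by (auto simp: A_def indicator_def)
    have i: "integrable M (\<lambda>\<omega>. - (indicator (A m) (X \<omega>) * marg k f (X \<omega>)))"
      using d'(2) by simp
    have "(\<integral>\<omega>. - (indicator (A m) (X \<omega>) * marg k f (X \<omega>)) \<partial>M) = 0"
      using integral_nonneg_AE[OF nn] 1 by simp
    then have "AE \<omega> in M. - (indicator (A m) (X \<omega>) * marg k f (X \<omega>)) = 0"
      using integral_nonneg_eq_0_iff_AE[OF i nn] by simp
    then show ?thesis
      by eventually_elim (auto simp: A_def indicator_def split: if_splits)
  qed
  then have "AE \<omega> in M. \<forall>m. X \<omega> \<notin> A m"
    by (simp add: AE_all_countable)
  with AE_space show ?thesis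
  proof eventually_elim
    case (elim \<omega>)
    have "\<bar>fs k (X \<omega>)\<bar> \<le> real (nat \<lceil>\<bar>fs k (X \<omega>)\<bar>\<rceil>)" by linarith
    moreover have "X \<omega> \<notin> A (nat \<lceil>\<bar>fs k (X \<omega>)\<bar>\<rceil>)" using elim by simp
    moreover have "X \<omega> \<in> space S" using elim measurable_space[OF X] by simp
    ultimately show ?case
      unfolding A_def by (simp add: not_less)
  qed
qed

text \<open>On the sets \<open>A m\<close> where all components of \<open>fs\<close> are bounded by
  m, the loss difference splits into its K terms. Nonnegativity permits monotone convergence on the
  side of the marginal excesses; on the other side the loss difference as a whole is integrable and
  dominates. Integrability of the sum is thereby a conclusion.\<close>

lemma sum_marg:
  assumes f: "f \<in> bounded_scores B"
  shows "has_bochner_integral M (\<lambda>\<omega>. \<Sum>k=1..K. marg k f (X \<omega>)) (excess f)"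
proof (rule has_bochner_integral_monotone_convergence)
  note [measurable] = scoreD[OF minimizer_score] marg_measurable[OF bounded_scoresD(1)[OF f]]
  define A where "A m = {x \<in> space S. \<forall>k\<in>{1..K}. \<bar>fs k x\<bar> \<le> real m}" for m :: nat
  have A [measurable]: "A m \<in> sets S" for m
    unfolding A_def by measurable
  define u where "u m \<omega> = (\<Sum>k=1..K. indicator (A m) (X \<omega>) * marg k f (X \<omega>))" for m \<omega>
  define d where "d m k x y = (if y = k then indicator (A m) x * (\<phi> (f k x) - \<phi> (fs k x))
      else indicator (A m) x * (\<phi> (- f k x) - \<phi> (- fs k x)))" for m k x y
  have d: "integrable M (\<lambda>\<omega>. d m k (X \<omega>) (Y \<omega>))"
    "integrable M (\<lambda>\<omega>. indicator (A m) (X \<omega>) * marg k f (X \<omega>))"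
    "(\<integral>\<omega>. d m k (X \<omega>) (Y \<omega>) \<partial>M) = (\<integral>\<omega>. indicator (A m) (X \<omega>) * marg k f (X \<omega>) \<partial>M)"
    if "k \<in> {1..K}" for m k
    unfolding d_def by (rule integral_marg_on[OF f that A, where m="real m"]; use that in \<open>simp add: A_def\<close>)+
  show "integrable M (u m)" for m
    unfolding u_def using d(2) by (intro Bochner_Integration.integrable_sum)
  have all: "AE \<omega> in M. \<forall>k\<in>{1..K}. 0 \<le> marg k f (X \<omega>)"
    using marg_nonneg[OF f] by (intro AE_finite_allI) auto
  show "AE \<omega> in M. mono (\<lambda>m. u m \<omega>)"
    using all
  proof eventually_elim
    case (elim \<omega>)
    show ?case
      unfolding u_def
    proof (intro monoI sum_mono mult_right_mono)
      fix m m' :: nat assume "m \<le> m'"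
      then show "indicator (A m) (X \<omega>) \<le> (indicator (A m') (X \<omega>) :: real)"
        by (auto simp: A_def indicator_def intro: order_trans)
    qed (use elim in auto)
  qed
  have ev: "eventually (\<lambda>m. X \<omega> \<in> A m) sequentially" if \<omega>: "\<omega> \<in> space M" for \<omega>
  proof -
    define m0 where "m0 = nat \<lceil>\<Sum>k=1..K. \<bar>fs k (X \<omega>)\<bar>\<rceil>"
    have "\<bar>fs k (X \<omega>)\<bar> \<le> real m0" if "k \<in> {1..K}" for k
    proof -
      have "\<bar>fs k (X \<omega>)\<bar> \<le> (\<Sum>k=1..K. \<bar>fs k (X \<omega>)\<bar>)"
        using that by (intro member_le_sum) auto
      also have "\<dots> \<le> real m0"
        unfolding m0_def by linarith
      finally show ?thesis .
    qed
    then show ?thesis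
      using measurable_space[OF X \<omega>]
      by (intro eventually_sequentiallyI[of m0]) (force simp: A_def intro: order_trans[OF _ of_nat_mono])
  qed
  show "AE \<omega> in M. (\<lambda>m. u m \<omega>) \<longlonglongrightarrow> (\<Sum>k=1..K. marg k f (X \<omega>))"
  proof (rule AE_I2)
    fix \<omega> assume "\<omega> \<in> space M"
    from ev[OF this] have "\<forall>\<^sub>F m in sequentially. u m \<omega> = (\<Sum>k=1..K. marg k f (X \<omega>))"
      by eventually_elim (simp add: u_def)
    then show "(\<lambda>m. u m \<omega>) \<longlonglongrightarrow> (\<Sum>k=1..K. marg k f (X \<omega>))"
      by (rule tendsto_eventually)
  qed
  have sum_d: "(\<Sum>k=1..K. d m k x y) = indicator (A m) x * (loss f x y - loss fs x y)" for m x y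
    unfolding phi_loss_def sum_subtractf[symmetric] sum_distrib_left
    by (intro sum.cong) (auto simp: d_def)
  have "(\<integral>\<omega>. u m \<omega> \<partial>M) = (\<integral>\<omega>. indicator (A m) (X \<omega>) * (loss f (X \<omega>) (Y \<omega>) - loss fs (X \<omega>) (Y \<omega>)) \<partial>M)" for m
  proof -
    have "(\<integral>\<omega>. u m \<omega> \<partial>M) = (\<Sum>k=1..K. \<integral>\<omega>. d m k (X \<omega>) (Y \<omega>) \<partial>M)"
      unfolding u_def using d by (subst Bochner_Integration.integral_sum) auto
    also have "\<dots> = (\<integral>\<omega>. (\<Sum>k=1..K. d m k (X \<omega>) (Y \<omega>)) \<partial>M)"
      using d by (subst Bochner_Integration.integral_sum) auto
    finally show ?thesis unfolding sum_d .
  qed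
  moreover have "(\<lambda>m. \<integral>\<omega>. indicator (A m) (X \<omega>) * (loss f (X \<omega>) (Y \<omega>) - loss fs (X \<omega>) (Y \<omega>)) \<partial>M)
      \<longlonglongrightarrow> (\<integral>\<omega>. loss f (X \<omega>) (Y \<omega>) - loss fs (X \<omega>) (Y \<omega>) \<partial>M)"
  proof (rule integral_dominated_convergence[where w="\<lambda>\<omega>. \<bar>loss f (X \<omega>) (Y \<omega>) - loss fs (X \<omega>) (Y \<omega>)\<bar>"])
    show "AE \<omega> in M. (\<lambda>m. indicator (A m) (X \<omega>) * (loss f (X \<omega>) (Y \<omega>) - loss fs (X \<omega>) (Y \<omega>)))
        \<longlonglongrightarrow> loss f (X \<omega>) (Y \<omega>) - loss fs (X \<omega>) (Y \<omega>)"
    proof (rule AE_I2)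
      fix \<omega> assume "\<omega> \<in> space M"
      from ev[OF this] have "\<forall>\<^sub>F m in sequentially. indicator (A m) (X \<omega>) * (loss f (X \<omega>) (Y \<omega>) - loss fs (X \<omega>) (Y \<omega>))
          = loss f (X \<omega>) (Y \<omega>) - loss fs (X \<omega>) (Y \<omega>)"
        by eventually_elim simp
      then show "(\<lambda>m. indicator (A m) (X \<omega>) * (loss f (X \<omega>) (Y \<omega>) - loss fs (X \<omega>) (Y \<omega>)))
        \<longlonglongrightarrow> loss f (X \<omega>) (Y \<omega>) - loss fs (X \<omega>) (Y \<omega>)"
        by (rule tendsto_eventually)
    qed
    show "integrable M (\<lambda>\<omega>. \<bar>loss f (X \<omega>) (Y \<omega>) - loss fs (X \<omega>) (Y \<omega>)\<bar>)"
      using loss_integrable[OF f] minimizer_integrable by auto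
    note [measurable] = loss_measurable[OF minimizer_score] loss_measurable[OF bounded_scoresD(1)[OF f]]
    show "(\<lambda>\<omega>. loss f (X \<omega>) (Y \<omega>) - loss fs (X \<omega>) (Y \<omega>)) \<in> borel_measurable M"
      by measurable
    show "(\<lambda>\<omega>. indicator (A m) (X \<omega>) * (loss f (X \<omega>) (Y \<omega>) - loss fs (X \<omega>) (Y \<omega>))) \<in> borel_measurable M" for m
      by measurable
    show "AE \<omega> in M. norm (indicator (A m) (X \<omega>) * (loss f (X \<omega>) (Y \<omega>) - loss fs (X \<omega>) (Y \<omega>)))
        \<le> \<bar>loss f (X \<omega>) (Y \<omega>) - loss fs (X \<omega>) (Y \<omega>)\<bar>" for m
      by (auto simp: indicator_def)
  qed
  moreover have "(\<integral>\<omega>. loss f (X \<omega>) (Y \<omega>) - loss fs (X \<omega>) (Y \<omega>) \<partial>M) = excess f"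
    using loss_integrable[OF f] minimizer_integrable
    by (simp add: excess_phi_risk_def phi_risk_def)
  ultimately show "(\<lambda>m. \<integral>\<omega>. u m \<omega> \<partial>M) \<longlonglongrightarrow> excess f"
    by simp
  show "(\<lambda>\<omega>. \<Sum>k=1..K. marg k f (X \<omega>)) \<in> borel_measurable M"
    by measurable
qed

text \<open>All terms are nonnegative almost surely, so each is dominated by their integrable
  sum.\<close>

lemma marg_integrable:
  assumes f: "f \<in> bounded_scores B" and k: "k \<in> {1..K}"
  shows "integrable M (\<lambda>\<omega>. marg k f (X \<omega>))"
proof (rule Bochner_Integration.integrable_bound)
  note [measurable] = marg_measurable[OF bounded_scoresD(1)[OF f] k]
  show "integrable M (\<lambda>\<omega>. \<Sum>k=1..K. marg k f (X \<omega>))"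
    using sum_marg[OF f] by (rule integrable.intros)
  show "(\<lambda>\<omega>. marg k f (X \<omega>)) \<in> borel_measurable M" by measurable
  have "AE \<omega> in M. \<forall>k\<in>{1..K}. 0 \<le> marg k f (X \<omega>)"
    using marg_nonneg[OF f] by (intro AE_finite_allI) auto
  then show "AE \<omega> in M. norm (marg k f (X \<omega>)) \<le> norm (\<Sum>k=1..K. marg k f (X \<omega>))"
  proof eventually_elim
    case (elim \<omega>)
    then have "marg k f (X \<omega>) \<le> (\<Sum>k=1..K. marg k f (X \<omega>))"
      using k by (intro member_le_sum) auto
    with elim k show ?case by simp
  qed
qed

lemma sum_integral_marg:
  assumes f: "f \<in> bounded_scores B"
  shows "(\<Sum>k=1..K. \<integral>\<omega>. marg k f (X \<omega>) \<partial>M) = excess f"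
  using has_bochner_integral_integral_eq[OF sum_marg[OF f]] marg_integrable[OF f]
  by (subst Bochner_Integration.integral_sum[symmetric]) auto

text \<open>As a function of the score value, the marginal excess is convex when p lies in [0, 1]
  and vanishes at \<open>fs k x\<close>; at a point of the segment towards \<open>f k x\<close> it
  is at most (1 - \<tau>) times its value at \<open>f k x\<close>. This carries the noise condition
  from the constant score to \<open>f\<close>.\<close>

lemma marg_between:
  assumes "0 \<le> p k x" "p k x \<le> 1" "0 \<le> marg k f x" "(a \<le> f k x) \<noteq> (a \<le> fs k x)"
  shows "marg k (\<lambda>_ _. a) x \<le> marg k f x"
proof -
  from assms(4) obtain \<tau> where \<tau>: "0 \<le> \<tau>" "\<tau> \<le> 1" "a = (1 - \<tau>) * f k x + \<tau> * fs k x"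
    by (rule between_convex_comb)
  have 1: "\<phi> a \<le> (1 - \<tau>) * \<phi> (f k x) + \<tau> * \<phi> (fs k x)"
    using convex_onD[OF convex \<tau>(1,2), of "f k x" "fs k x"] \<tau>(3) by simp
  have 2: "\<phi> (- a) \<le> (1 - \<tau>) * \<phi> (- f k x) + \<tau> * \<phi> (- fs k x)"
    using convex_onD[OF convex \<tau>(1,2), of "- f k x" "- fs k x"] unfolding \<tau>(3) by simp
  have "marg k (\<lambda>_ _. a) x \<le>
      p k x * ((1 - \<tau>) * \<phi> (f k x) + \<tau> * \<phi> (fs k x) - \<phi> (fs k x)) +
      (1 - p k x) * ((1 - \<tau>) * \<phi> (- f k x) + \<tau> * \<phi> (- fs k x) - \<phi> (- fs k x))"
    unfolding marginal_excess_def using assms 1 2 by (intro add_mono mult_left_mono) auto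
  also have "\<dots> = (1 - \<tau>) * marg k f x"
    by (simp add: marginal_excess_def algebra_simps)
  also have "\<dots> \<le> 1 * marg k f x"
    using \<tau> assms by (intro mult_right_mono) auto
  finally show ?thesis by simp
qed

text \<open>At a point of disagreement either \<bar>p k - t\<bar> \<le> h, which the margin
  condition controls, or the marginal excess is at least h^s / C0, which Markov's inequality
  controls. The margin condition leaves out p k = t, hence the separate null event. The level h
  stays free, to be chosen after taking expectations.\<close>

lemma prob_threshold_diff_le:
  assumes f: "f \<in> bounded_scores B" and k: "k \<in> {1..K}"
    and pos: "0 < h" "0 < C\<^sub>0" "0 \<le> s"
    and noise: "AE \<omega> in M. \<bar>p k (X \<omega>) - t\<bar> powr s \<le> C\<^sub>0 * marg k (\<lambda>_ _. a) (X \<omega>)"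
    and margin: "prob {\<omega> \<in> space M. 0 < \<bar>p k (X \<omega>) - t\<bar> \<and> \<bar>p k (X \<omega>) - t\<bar> \<le> h} \<le> c\<^sub>2 * h powr \<alpha>"
    and null: "prob {\<omega> \<in> space M. p k (X \<omega>) = t} = 0"
  shows "prob {\<omega> \<in> space M. (a \<le> f k (X \<omega>)) \<noteq> (a \<le> fs k (X \<omega>))} \<le>
    c\<^sub>2 * h powr \<alpha> + C\<^sub>0 * h powr (- s) * (\<integral>\<omega>. marg k f (X \<omega>) \<partial>M)"
proof -
  note [measurable] = marg_measurable[OF bounded_scoresD(1)[OF f] k]
    scoreD[OF minimizer_score k] scoreD[OF bounded_scoresD(1)[OF f] k] p_measurable[OF k]
  let ?A = "{\<omega> \<in> space M. 0 < \<bar>p k (X \<omega>) - t\<bar> \<and> \<bar>p k (X \<omega>) - t\<bar> \<le> h}"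
  let ?B = "{\<omega> \<in> space M. p k (X \<omega>) = t}"
  let ?C = "{\<omega> \<in> space M. h powr s / C\<^sub>0 \<le> marg k f (X \<omega>)}"
  let ?D = "{\<omega> \<in> space M. (a \<le> f k (X \<omega>)) \<noteq> (a \<le> fs k (X \<omega>))}"
  have "AE \<omega> in M. \<omega> \<in> ?D \<longrightarrow> \<omega> \<in> ?A \<union> ?B \<union> ?C"
    using noise marg_nonneg[OF f k] p_bounds[OF k]
  proof eventually_elim
    case (elim \<omega>)
    show ?case
    proof
      assume D: "\<omega> \<in> ?D"
      show "\<omega> \<in> ?A \<union> ?B \<union> ?C"
      proof (cases "\<bar>p k (X \<omega>) - t\<bar> \<le> h")
        case False
        then have "h powr s \<le> \<bar>p k (X \<omega>) - t\<bar> powr s"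
          using pos by (intro powr_mono2) auto
        also have "\<dots> \<le> C\<^sub>0 * marg k (\<lambda>_ _. a) (X \<omega>)" using elim by simp
        also have "\<dots> \<le> C\<^sub>0 * marg k f (X \<omega>)"
          using elim D pos by (intro mult_left_mono marg_between) auto
        finally show ?thesis
          using D pos by (auto simp: field_simps)
      qed (use D in auto)
    qed
  qed
  then have "prob ?D \<le> prob (?A \<union> ?B \<union> ?C)"
    by (intro finite_measure_mono_AE) auto
  also have "\<dots> \<le> prob ?A + prob ?B + prob ?C"
    by (intro order_trans[OF measure_Un_le] add_mono order_refl) auto
  also have "prob ?C \<le> (\<integral>\<omega>. marg k f (X \<omega>) \<partial>M) / (h powr s / C\<^sub>0)"
    using pos by (intro integral_Markov_inequality_measure[where A="{}"] marg_integrable[OF f k] marg_nonneg[OF f k]) auto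
  also have "(\<integral>\<omega>. marg k f (X \<omega>) \<partial>M) / (h powr s / C\<^sub>0) = C\<^sub>0 * h powr (- s) * (\<integral>\<omega>. marg k f (X \<omega>) \<partial>M)"
    by (simp add: powr_minus field_simps)
  finally show ?thesis
    using margin null by linarith
qed

end

subsection \<open>Confidence sets and their information\<close>

text \<open>Measurability of section probabilities. It makes the information of a data-dependent set
  a random variable.\<close>

lemma (in prob_space) measurable_prob:
  assumes "Measurable.pred (N \<Otimes>\<^sub>M M) (\<lambda>z. P (fst z) (snd z))"
  shows "(\<lambda>x. prob {\<omega> \<in> space M. P x \<omega>}) \<in> borel_measurable N"
proof -
  have "(\<lambda>x. emeasure M {\<omega> \<in> space M. P x \<omega>}) \<in> borel_measurable N"
  proof (rule measurable_emeasure)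
    have "{z \<in> space (N \<Otimes>\<^sub>M M). P (fst z) (snd z)} \<in> sets (N \<Otimes>\<^sub>M M)"
      using assms by (simp add: pred_def)
    moreover have "{z \<in> space (N \<Otimes>\<^sub>M M). snd z \<in> {\<omega> \<in> space M. P (fst z) \<omega>}} =
        {z \<in> space (N \<Otimes>\<^sub>M M). P (fst z) (snd z)}"
      by (auto simp: space_pair_measure)
    ultimately show "{z \<in> space (N \<Otimes>\<^sub>M M). snd z \<in> {\<omega> \<in> space M. P (fst z) \<omega>}} \<in> sets (N \<Otimes>\<^sub>M M)"
      by simp
  qed auto
  then show ?thesis
    by (simp add: measure_def)
qed

section \<open>Tails of variables with continuous distribution function\<close>

context prob_space
begin

lemma cdf_of_eq:
  assumes [measurable]: "V \<in> borel_measurable M"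
  shows "cdf_of M V t = prob {\<omega> \<in> space M. V \<omega> \<le> t}"
  unfolding cdf_of_def cdf_def by (subst measure_distr) (auto intro!: arg_cong[where f=prob])

lemma prob_atom:
  assumes [measurable]: "V \<in> borel_measurable M" and "continuous_on UNIV (cdf_of M V)"
  shows "prob {\<omega> \<in> space M. V \<omega> = t} = 0"
proof -
  interpret V: real_distribution "distr M borel V" by (rule real_distribution_distr) simp
  have "isCont (cdf (distr M borel V)) t"
    using assms(2) by (simp add: cdf_of_def continuous_on_eq_continuous_at)
  then have "measure (distr M borel V) {t} = 0"
    by (simp add: V.isCont_cdf)
  also have "measure (distr M borel V) {t} = prob {\<omega> \<in> space M. V \<omega> = t}"
    by (subst measure_distr) (auto intro!: arg_cong[where f=prob])
  finally show ?thesis .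
qed

lemma prob_greater:
  assumes [measurable]: "V \<in> borel_measurable M"
  shows "prob {\<omega> \<in> space M. t < V \<omega>} = 1 - cdf_of M V t"
  unfolding cdf_of_eq[OF assms]
  by (subst prob_compl[symmetric]) (auto intro!: arg_cong[where f=prob])

lemma prob_atLeast:
  assumes [measurable]: "V \<in> borel_measurable M" and "continuous_on UNIV (cdf_of M V)"
  shows "prob {\<omega> \<in> space M. t \<le> V \<omega>} = 1 - cdf_of M V t"
proof -
  have "prob {\<omega> \<in> space M. t \<le> V \<omega>} = prob ({\<omega> \<in> space M. t < V \<omega>} \<union> {\<omega> \<in> space M. V \<omega> = t})"
    by (intro arg_cong[where f=prob]) auto
  also have "\<dots> = prob {\<omega> \<in> space M. t < V \<omega>} + prob {\<omega> \<in> space M. V \<omega> = t}"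
    by (intro finite_measure_Union) auto
  finally show ?thesis
    using prob_atom[OF assms] prob_greater[OF assms(1)] by simp
qed

end

text \<open>A layer-cake bound on the grid of step b: z exceeds the last grid point below it by at
  most one step. It turns tail bounds at multiples of b into a bound for a mean through a finite
  sum.\<close>

lemma le_mult_count:
  fixes b z :: real
  assumes "0 < b" "z \<le> (real J + 1) * b"
  shows "z \<le> b * (1 + (\<Sum>j=1..J. of_bool (real j * b < z)))"
proof -
  \<comment> \<open>Truncating z makes the claim hold for every J; the bound on z available for the
    final J would not pass to smaller ones in the induction.\<close>
  have "min z ((real J + 1) * b) \<le> b * (1 + (\<Sum>j=1..J. of_bool (real j * b < z)))"
  proof (induction J)
    case (Suc J)
    let ?P = "\<Sum>j=1..J. of_bool (real j * b < z) :: real"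
    have sum: "(\<Sum>j=1..Suc J. of_bool (real j * b < z)) = ?P + of_bool ((real J + 1) * b < z)"
      by (simp add: algebra_simps del: sum_of_bool_eq)
    show ?case
    proof (cases "(real J + 1) * b < z")
      case True
      have "min z ((real (Suc J) + 1) * b) \<le> (real J + 1) * b + b"
        by (simp add: algebra_simps)
      also have "(real J + 1) * b \<le> b * (1 + ?P)"
        using Suc True by (simp add: min_def del: sum_of_bool_eq)
      finally show ?thesis
        using True unfolding sum by (simp add: algebra_simps del: sum_of_bool_eq)
    next
      case False
      then have "min z ((real (Suc J) + 1) * b) \<le> min z ((real J + 1) * b)"
        by simp
      with Suc show ?thesis
        using False unfolding sum by (simp del: sum_of_bool_eq)
    qed
  qed (simp add: min_def)
  then show ?thesis
    using assms(2) by simp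
qed

section \<open>Information, disagreement and population tail functions\<close>

context labelled_pair
begin

text \<open>(A1) puts \<open>p\<close> and (A2) puts the estimated score into this one class, so the
  facts on \<open>G_fun\<close> serve both.\<close>

definition continuous_scores :: "(nat \<Rightarrow> 'x \<Rightarrow> real) set" where
  "continuous_scores = {q \<in> score_functions S K. \<forall>k\<in>{1..K}. continuous_on UNIV (cdf_of M (\<lambda>\<omega>. q k (X \<omega>)))}"

text \<open>The expected cardinality, written by linearity as a sum of inclusion
  probabilities.\<close>

definition info :: "('x \<Rightarrow> nat set) \<Rightarrow> real" where
  "info \<Gamma> = (\<Sum>k=1..K. prob {\<omega> \<in> space M. k \<in> \<Gamma> (X \<omega>)})"

definition measurable_confidence_set :: "('x \<Rightarrow> nat set) \<Rightarrow> bool" where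
  "measurable_confidence_set \<Gamma> \<longleftrightarrow> (\<forall>k\<in>{1..K}. Measurable.pred M (\<lambda>\<omega>. k \<in> \<Gamma> (X \<omega>)))"

text \<open>The expected size of the symmetric difference, again summed over labels. It dominates
  differences of risks as well as of informations.\<close>

definition disagreement :: "('x \<Rightarrow> nat set) \<Rightarrow> ('x \<Rightarrow> nat set) \<Rightarrow> real" where
  "disagreement \<Gamma> \<Gamma>' = (\<Sum>k=1..K. prob {\<omega> \<in> space M. (k \<in> \<Gamma> (X \<omega>)) \<noteq> (k \<in> \<Gamma>' (X \<omega>))})"

lemma info_bounds: "0 \<le> info \<Gamma>" "info \<Gamma> \<le> real K"
proof -
  show "0 \<le> info \<Gamma>"
    unfolding info_def by (intro sum_nonneg) simp
  have "info \<Gamma> \<le> (\<Sum>k=1..K. 1)"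
    unfolding info_def by (intro sum_mono) simp
  then show "info \<Gamma> \<le> real K" by simp
qed

text \<open>If one set contains the label \<open>Y\<close> and the other does not, then
  \<open>Y\<close> is itself a label of disagreement; a union bound over all labels follows. The
  one-sided claim \<open>le\<close> is stated for generic sets so as to serve both
  directions.\<close>

lemma risk_diff_le:
  assumes "measurable_confidence_set \<Gamma>" "measurable_confidence_set \<Gamma>'"
  shows "\<bar>risk M X Y \<Gamma> - risk M X Y \<Gamma>'\<bar> \<le> disagreement \<Gamma> \<Gamma>'"
proof -
  have le: "risk M X Y \<Gamma>1 \<le> risk M X Y \<Gamma>2 + disagreement \<Gamma> \<Gamma>'"
    if meas: "measurable_confidence_set \<Gamma>1" "measurable_confidence_set \<Gamma>2"
      and eq: "disagreement \<Gamma>1 \<Gamma>2 = disagreement \<Gamma> \<Gamma>'" for \<Gamma>1 \<Gamma>2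
  proof -
    have m [measurable]: "Measurable.pred M (\<lambda>\<omega>. k \<in> \<Gamma>1 (X \<omega>))" "Measurable.pred M (\<lambda>\<omega>. k \<in> \<Gamma>2 (X \<omega>))"
      if "k \<in> {1..K}" for k using that meas by (auto simp: measurable_confidence_set_def)
    let ?R = "{\<omega> \<in> space M. Y \<omega> \<notin> \<Gamma>2 (X \<omega>)}"
    let ?D = "\<lambda>k. {\<omega> \<in> space M. (k \<in> \<Gamma>1 (X \<omega>)) \<noteq> (k \<in> \<Gamma>2 (X \<omega>))}"
    \<comment> \<open>Membership of the random label is measurable only after splitting according to
      its finitely many values.\<close>
    have R: "?R = {\<omega> \<in> space M. \<exists>k\<in>{1..K}. Y \<omega> = k \<and> k \<notin> \<Gamma>2 (X \<omega>)}"
      using Y_in by auto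
    have [measurable]: "?R \<in> sets M" unfolding R by measurable
    have D [measurable]: "?D k \<in> sets M" if "k \<in> {1..K}" for k using m[OF that] by measurable
    have "risk M X Y \<Gamma>1 \<le> prob (?R \<union> (\<Union>k\<in>{1..K}. ?D k))"
      unfolding risk_def
    proof (rule finite_measure_mono)
      show "{\<omega> \<in> space M. Y \<omega> \<notin> \<Gamma>1 (X \<omega>)} \<subseteq> ?R \<union> (\<Union>k\<in>{1..K}. ?D k)"
        using Y_in by fastforce
      show "?R \<union> (\<Union>k\<in>{1..K}. ?D k) \<in> sets M"
        by (intro sets.Un sets.finite_UN D) auto
    qed
    also have "\<dots> \<le> prob ?R + prob (\<Union>k\<in>{1..K}. ?D k)"
      by (intro measure_Un_le sets.finite_UN D) auto
    also have "prob (\<Union>k\<in>{1..K}. ?D k) \<le> (\<Sum>k=1..K. prob (?D k))"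
      using D by (intro finite_measure_subadditive_finite) auto
    finally show ?thesis
      unfolding eq[symmetric] by (simp add: risk_def disagreement_def)
  qed
  have "disagreement \<Gamma>' \<Gamma> = disagreement \<Gamma> \<Gamma>'"
    unfolding disagreement_def by (intro sum.cong refl arg_cong[where f=prob]) auto
  with le[OF assms refl] le[OF assms(2,1)] show ?thesis
    by (simp add: abs_le_iff)
qed

lemma info_diff_le:
  assumes "measurable_confidence_set \<Gamma>" "measurable_confidence_set \<Gamma>'"
  shows "\<bar>info \<Gamma> - info \<Gamma>'\<bar> \<le> disagreement \<Gamma> \<Gamma>'"
  unfolding info_def disagreement_def sum_subtractf[symmetric]
proof (intro order_trans[OF sum_abs] sum_mono)
  fix k assume k: "k \<in> {1..K}"
  have [measurable]: "Measurable.pred M (\<lambda>\<omega>. k \<in> \<Gamma> (X \<omega>))" "Measurable.pred M (\<lambda>\<omega>. k \<in> \<Gamma>' (X \<omega>))"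
    using assms k by (auto simp: measurable_confidence_set_def)
  let ?A = "{\<omega> \<in> space M. k \<in> \<Gamma> (X \<omega>)}" and ?B = "{\<omega> \<in> space M. k \<in> \<Gamma>' (X \<omega>)}"
  let ?D = "{\<omega> \<in> space M. (k \<in> \<Gamma> (X \<omega>)) \<noteq> (k \<in> \<Gamma>' (X \<omega>))}"
  have "prob ?A \<le> prob (?B \<union> ?D)" "prob ?B \<le> prob (?A \<union> ?D)"
    by (intro finite_measure_mono; auto)+
  moreover have "prob (?B \<union> ?D) \<le> prob ?B + prob ?D" "prob (?A \<union> ?D) \<le> prob ?A + prob ?D"
    by (intro measure_Un_le; simp)+
  ultimately show "\<bar>prob ?A - prob ?B\<bar> \<le> prob ?D"
    by linarith
qed

lemma disagreement_subset:
  assumes "measurable_confidence_set \<Gamma>" "measurable_confidence_set \<Gamma>'" "\<And>x. \<Gamma> x \<subseteq> \<Gamma>' x"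
  shows "disagreement \<Gamma> \<Gamma>' = info \<Gamma>' - info \<Gamma>"
  unfolding info_def disagreement_def sum_subtractf[symmetric]
proof (intro sum.cong refl)
  fix k assume k: "k \<in> {1..K}"
  have [measurable]: "Measurable.pred M (\<lambda>\<omega>. k \<in> \<Gamma> (X \<omega>))" "Measurable.pred M (\<lambda>\<omega>. k \<in> \<Gamma>' (X \<omega>))"
    using assms k by (auto simp: measurable_confidence_set_def)
  have "{\<omega> \<in> space M. (k \<in> \<Gamma> (X \<omega>)) \<noteq> (k \<in> \<Gamma>' (X \<omega>))} =
      {\<omega> \<in> space M. k \<in> \<Gamma>' (X \<omega>)} - {\<omega> \<in> space M. k \<in> \<Gamma> (X \<omega>)}"
    using assms(3) by auto
  then show "prob {\<omega> \<in> space M. (k \<in> \<Gamma> (X \<omega>)) \<noteq> (k \<in> \<Gamma>' (X \<omega>))} =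
      prob {\<omega> \<in> space M. k \<in> \<Gamma>' (X \<omega>)} - prob {\<omega> \<in> space M. k \<in> \<Gamma> (X \<omega>)}"
    using assms(3) by (simp add: finite_measure_Diff subset_iff Collect_mono_iff)
qed

text \<open>For arbitrary sets the disagreement only dominates the difference of informations.
  Nestedness makes it equal, which reduces a comparison of sets to a comparison of two
  numbers.\<close>

lemma disagreement_nested:
  assumes "measurable_confidence_set \<Gamma>" "measurable_confidence_set \<Gamma>'"
    and "(\<forall>x. \<Gamma> x \<subseteq> \<Gamma>' x) \<or> (\<forall>x. \<Gamma>' x \<subseteq> \<Gamma> x)"
  shows "disagreement \<Gamma> \<Gamma>' = \<bar>info \<Gamma> - info \<Gamma>'\<bar>"
proof -
  have "0 \<le> disagreement \<Gamma> \<Gamma>'" for \<Gamma> \<Gamma>'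
    unfolding disagreement_def by (intro sum_nonneg) simp
  moreover have "disagreement \<Gamma> \<Gamma>' = disagreement \<Gamma>' \<Gamma>"
    unfolding disagreement_def by (intro sum.cong refl arg_cong[where f=prob]) auto
  ultimately show ?thesis
    using assms disagreement_subset[of \<Gamma> \<Gamma>'] disagreement_subset[of \<Gamma>' \<Gamma>]
    by (smt (verit))
qed

lemma continuous_scoresD:
  assumes "q \<in> continuous_scores" "k \<in> {1..K}"
  shows "q k \<in> borel_measurable S" "(\<lambda>\<omega>. q k (X \<omega>)) \<in> borel_measurable M"
    "continuous_on UNIV (cdf_of M (\<lambda>\<omega>. q k (X \<omega>)))"
proof -
  show *: "q k \<in> borel_measurable S"
    using assms by (simp add: continuous_scores_def score_functions_def)
  show "(\<lambda>\<omega>. q k (X \<omega>)) \<in> borel_measurable M"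
    using * by measurable
  show "continuous_on UNIV (cdf_of M (\<lambda>\<omega>. q k (X \<omega>)))"
    using assms by (simp add: continuous_scores_def)
qed

text \<open>\<open>G_fun\<close> is built from strict tails whereas level sets use non-strict ones;
  they agree because continuous distribution functions have no atoms.\<close>

lemma G_fun_eq:
  assumes "q \<in> continuous_scores"
  shows "G_fun M K X q t = (\<Sum>k=1..K. prob {\<omega> \<in> space M. t \<le> q k (X \<omega>)})"
    and "G_fun M K X q t = (\<Sum>k=1..K. prob {\<omega> \<in> space M. t < q k (X \<omega>)})"
  using continuous_scoresD[OF assms] unfolding G_fun_def
  by (auto intro!: sum.cong simp: prob_atLeast prob_greater)

lemma G_fun_continuous:
  assumes "q \<in> continuous_scores"
  shows "continuous_on A (G_fun M K X q)"
  unfolding G_fun_def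
  by (intro continuous_intros continuous_on_subset[OF continuous_scoresD(3)[OF assms]]) auto

lemma G_fun_antimono:
  assumes "q \<in> continuous_scores" "t \<le> t'"
  shows "G_fun M K X q t' \<le> G_fun M K X q t"
  unfolding G_fun_eq(1)[OF assms(1)]
proof (intro sum_mono finite_measure_mono)
  fix k assume k: "k \<in> {1..K}"
  note [measurable] = continuous_scoresD[OF assms(1) k]
  show "{\<omega> \<in> space M. t \<le> q k (X \<omega>)} \<in> sets M" by measurable
qed (use assms(2) in auto)

text \<open>Intermediate values between the limits K at minus infinity and 0 at plus infinity. A
  general score has no bounded range like [0, 1], and the limits themselves may not be attained,
  hence the open interval for v.\<close>

lemma G_fun_attains:
  assumes q: "q \<in> continuous_scores" and v: "0 < v" "v < real K"
  obtains t where "G_fun M K X q t = v"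
proof -
  have d: "real_distribution (distr M borel (\<lambda>\<omega>. q k (X \<omega>)))" if "k \<in> {1..K}" for k
    using continuous_scoresD[OF q that] by (intro real_distribution_distr) simp
  have "(G_fun M K X q \<longlongrightarrow> (\<Sum>k=1..K. 1 - 0)) at_bot"
    unfolding G_fun_def cdf_of_def
    by (intro tendsto_intros finite_borel_measure.cdf_lim_at_bot real_distribution.finite_borel_measure_M d) auto
  then have "eventually (\<lambda>t. v < G_fun M K X q t) at_bot"
    by (rule order_tendstoD) (use v in simp)
  then obtain a where a: "\<And>t. t \<le> a \<Longrightarrow> v < G_fun M K X q t"
    by (auto simp: eventually_at_bot_linorder)
  have "(G_fun M K X q \<longlongrightarrow> (\<Sum>k=1..K. 1 - 1)) at_top"
    unfolding G_fun_def cdf_of_def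
    by (intro tendsto_intros real_distribution.cdf_lim_at_top_prob d) auto
  then have "eventually (\<lambda>t. G_fun M K X q t < v) at_top"
    by (rule order_tendstoD) (use v in simp)
  then obtain b where b: "\<And>t. b \<le> t \<Longrightarrow> G_fun M K X q t < v"
    by (auto simp: eventually_at_top_linorder)
  have "\<exists>t. a \<le> t \<and> t \<le> max a b \<and> G_fun M K X q t = v"
    using a[of a] b[of "max a b"] G_fun_continuous[OF q]
    by (intro IVT2') auto
  then show ?thesis using that by blast
qed

lemma empirical_G_antimono:
  assumes "t \<le> t'"
  shows "empirical_G K N u q t' \<le> empirical_G K N u q t"
  unfolding empirical_G_def using assms
  by (intro mult_left_mono sum_mono) auto

text \<open>The empirical tail function is nonincreasing, so both sets accept a score value exactly
  when it lies in some upward closed set of reals. Two such sets are always comparable, and the test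
  at -\<delta> decides the direction.\<close>

lemma empirical_set_nested:
  "(\<forall>x. empirical_set K N u q \<beta> x \<subseteq> level_set K q \<delta> x) \<or>
   (\<forall>x. level_set K q \<delta> x \<subseteq> empirical_set K N u q \<beta> x)"
proof (cases "empirical_G K N u q (- \<delta>) \<le> \<beta>")
  case True
  then have "level_set K q \<delta> x \<subseteq> empirical_set K N u q \<beta> x" for x
    using order_trans[OF empirical_G_antimono True] by (auto simp: level_set_def empirical_set_def)
  then show ?thesis by blast
next
  case False
  then have "- \<delta> \<le> t" if "empirical_G K N u q t \<le> \<beta>" for t
    using empirical_G_antimono[of t "- \<delta>" N u q] that by linarith
  then have "empirical_set K N u q \<beta> x \<subseteq> level_set K q \<delta> x" for x
    by (auto simp: level_set_def empirical_set_def)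
  then show ?thesis by blast
qed

lemma empirical_G_fixed_measurable [measurable]:
  "empirical_G K N u q \<in> borel_measurable borel"
  unfolding empirical_G_def by measurable

lemma measurable_confidence_level:
  assumes "q \<in> score_functions S K"
  shows "measurable_confidence_set (level_set K q \<delta>)" "measurable_confidence_set (empirical_set K N u q \<beta>)"
proof -
  have [measurable]: "q k \<in> borel_measurable S" if "k \<in> {1..K}" for k
    using assms that by (simp add: score_functions_def)
  show "measurable_confidence_set (level_set K q \<delta>)"
    unfolding measurable_confidence_set_def level_set_def mem_Collect_eq
    by (intro ballI pred_intros_logic) measurable
  show "measurable_confidence_set (empirical_set K N u q \<beta>)"
    unfolding measurable_confidence_set_def empirical_set_def mem_Collect_eq
    by (intro ballI pred_intros_logic) measurable
qed

end

subsection \<open>Information of the empirical set\<close>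

text \<open>Exchanging the Gaussian tail for a geometric one keeps the constant in the bound for the
  mean a small integer.\<close>

lemma exp_neg2_sq_le: "exp (- 2 * (real j)\<^sup>2) \<le> (1/2) ^ j"
proof -
  have "exp (- 2 * (real j)\<^sup>2) \<le> exp (- real j)"
  proof -
    have "real j \<le> 2 * (real j)\<^sup>2"
      by (cases j) (auto simp: power2_eq_square algebra_simps)
    then show ?thesis by simp
  qed
  also have "\<dots> = exp (-1) ^ j"
    by (simp add: exp_of_nat_mult[symmetric])
  also have "\<dots> \<le> (1/2) ^ j"
    using exp_ge_add_one_self[of 1] by (intro power_mono) (auto simp: exp_minus field_simps)
  finally show ?thesis .
qed

lemma sum_half_power_le: "(\<Sum>j=1..J. (1/2::real) ^ j) \<le> 1"
proof -
  have "(\<Sum>j=1..J. (1/2::real) ^ j) = 1 - (1/2) ^ J"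
    by (induction J) (auto simp: field_simps)
  then show ?thesis by simp
qed

lemma (in prob_space) integral_of_bool:
  assumes "Measurable.pred M P"
  shows "(\<integral>\<omega>. of_bool (P \<omega>) \<partial>M) = prob {\<omega> \<in> space M. P \<omega>}"
proof -
  have "(\<integral>\<omega>. of_bool (P \<omega>) \<partial>M) = (\<integral>\<omega>. indicator {\<omega> \<in> space M. P \<omega>} \<omega> \<partial>M :: real)"
    by (intro Bochner_Integration.integral_cong) auto
  also have "\<dots> = prob {\<omega> \<in> space M. P \<omega>}"
    using assms by (subst Bochner_Integration.integral_indicator) (auto simp: pred_def intro!: arg_cong[where f=prob])
  finally show ?thesis .
qed

context labelled_pair
begin

text \<open>The score may vary with the parameter z, as it does when it is estimated from the
  labelled sample.\<close>

lemma empirical_G_measurable: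
  assumes q: "\<And>k. k \<in> {1..K} \<Longrightarrow> (\<lambda>w. q (fst w) k (snd w)) \<in> borel_measurable (Q \<Otimes>\<^sub>M S)"
    and [measurable]: "V \<in> borel_measurable Q"
    and u [measurable]: "u \<in> Q \<rightarrow>\<^sub>M unlabelled_space S N"
  shows "(\<lambda>z. empirical_G K N (u z) (q z) (V z)) \<in> borel_measurable Q"
proof -
  have ui [measurable]: "(\<lambda>z. u z i) \<in> Q \<rightarrow>\<^sub>M S" if "i < N" for i
    using that by (intro measurable_compose[OF u] measurable_component_singleton) simp
  have [measurable]: "(\<lambda>z. q z k (u z i)) \<in> borel_measurable Q" if "k \<in> {1..K}" "i < N" for k i
    using measurable_compose[OF measurable_Pair[OF measurable_ident ui[OF that(2)]] q[OF that(1)]] by simp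
  show ?thesis
    unfolding empirical_G_def by measurable
qed

lemma empirical_G_pair_measurable:
  assumes q: "q \<in> score_functions S K" and "V \<in> borel_measurable Q" "u \<in> Q \<rightarrow>\<^sub>M unlabelled_space S N"
  shows "(\<lambda>z. empirical_G K N (u z) q (V z)) \<in> borel_measurable Q"
proof (rule empirical_G_measurable[where q="\<lambda>_. q"])
  fix k assume "k \<in> {1..K}"
  then have "q k \<in> borel_measurable S" using q by (simp add: score_functions_def)
  then show "(\<lambda>w. q k (snd w)) \<in> borel_measurable (Q \<Otimes>\<^sub>M S)" by measurable
qed fact+

lemma sample_measurable:
  assumes "\<And>i. i < N \<Longrightarrow> U i \<in> M \<rightarrow>\<^sub>M MA"
  shows "sample N U \<in> M \<rightarrow>\<^sub>M PiM {..<N} (\<lambda>_. MA)"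
  unfolding sample_def using assms by (intro measurable_restrict) auto

context
  fixes U :: "nat \<Rightarrow> 'w \<Rightarrow> 'x" and N :: nat
  assumes U: "independent_copies M S N U X" and N: "0 < N" and K: "0 < K"
begin

lemma U_measurable [measurable]: "i < N \<Longrightarrow> U i \<in> M \<rightarrow>\<^sub>M S"
  using U by (auto simp: independent_copies_def indep_vars_def)

lemma sample_U_measurable [measurable]: "sample N U \<in> M \<rightarrow>\<^sub>M unlabelled_space S N"
  by (rule sample_measurable) simp

text \<open>Hoeffding's inequality for the numbers h (U i) of labels with score at least t. The K
  indicators at one point are dependent, so they are summed first; the summands range over [0, K],
  whence the square of K in the exponent.\<close>

lemma empirical_G_concentration:
  assumes q: "q \<in> continuous_scores" and eps: "0 \<le> \<epsilon>"
  shows "prob {\<omega> \<in> space M. G_fun M K X q t + \<epsilon> \<le> empirical_G K N (sample N U \<omega>) q t} \<le> exp (- 2 * real N * \<epsilon>\<^sup>2 / (real K)\<^sup>2)"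
    and "prob {\<omega> \<in> space M. empirical_G K N (sample N U \<omega>) q t \<le> G_fun M K X q t - \<epsilon>} \<le> exp (- 2 * real N * \<epsilon>\<^sup>2 / (real K)\<^sup>2)"
proof -
  note [measurable] = continuous_scoresD(1)[OF q]
  define h where "h x = (\<Sum>k=1..K. of_bool (t \<le> q k x) :: real)" for x
  have [measurable]: "h \<in> borel_measurable S"
    unfolding h_def by measurable
  have h: "0 \<le> h x" "h x \<le> real K" for x
  proof -
    show "0 \<le> h x" unfolding h_def by (intro sum_nonneg) simp
    have "h x \<le> (\<Sum>k=1..K. 1)" unfolding h_def by (intro sum_mono) simp
    then show "h x \<le> real K" by simp
  qed
  have "expectation (\<lambda>\<omega>. h (U i \<omega>)) = G_fun M K X q t" if i: "i < N" for i
  proof -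
    note [measurable] = U_measurable[OF i]
    have "expectation (\<lambda>\<omega>. h (U i \<omega>)) = (\<integral>x. h x \<partial>distr M S (U i))"
      by (subst integral_distr) auto
    also have "\<dots> = (\<integral>x. h x \<partial>distr M S X)"
      using U i by (simp add: independent_copies_def)
    also have "\<dots> = expectation (\<lambda>\<omega>. h (X \<omega>))"
      by (subst integral_distr) auto
    also have "\<dots> = (\<Sum>k=1..K. expectation (\<lambda>\<omega>. of_bool (t \<le> q k (X \<omega>))))"
      unfolding h_def
    proof (rule Bochner_Integration.integral_sum)
      fix k assume k: "k \<in> {1..K}"
      then show "integrable M (\<lambda>\<omega>. of_bool (t \<le> q k (X \<omega>)) :: real)"
        by (intro integrable_const_bound[where B=1]) auto
    qed
    also have "\<dots> = G_fun M K X q t"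
      unfolding G_fun_eq(1)[OF q]
      by (intro sum.cong refl integral_of_bool) measurable
    finally show ?thesis .
  qed
  then have mu: "(\<Sum>i<N. expectation (\<lambda>\<omega>. h (U i \<omega>))) = N * G_fun M K X q t"
    by simp
  interpret Hoeffding_ineq M "{..<N}" "\<lambda>i \<omega>. h (U i \<omega>)" "\<lambda>_. 0" "\<lambda>_. real K" "\<Sum>i<N. expectation (\<lambda>\<omega>. h (U i \<omega>))"
  proof unfold_locales
    show "indep_vars (\<lambda>_. borel) (\<lambda>i \<omega>. h (U i \<omega>)) {..<N}"
      using indep_vars_compose2[where Y="\<lambda>_. h" and N="\<lambda>_. borel", of "\<lambda>_. S" U "{..<N}"] U
      by (simp add: independent_copies_def)
    show "AE \<omega> in M. h (U i \<omega>) \<in> {0..real K}" for i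
      by (simp add: h)
  qed simp
  have eG: "empirical_G K N (sample N U \<omega>) q t = (\<Sum>i<N. h (U i \<omega>)) / N" for \<omega>
    unfolding empirical_G_def h_def sample_def by simp
  have ex: "- 2 * (real N * \<epsilon>)\<^sup>2 / (\<Sum>i<N. (real K - 0)\<^sup>2) = - 2 * real N * \<epsilon>\<^sup>2 / (real K)\<^sup>2"
    using N by (simp add: power2_eq_square)
  have pos: "0 < (\<Sum>i<N. (real K - 0)\<^sup>2)" "0 \<le> real N * \<epsilon>"
    using N K eps by auto
  have "{\<omega> \<in> space M. G_fun M K X q t + \<epsilon> \<le> empirical_G K N (sample N U \<omega>) q t} =
      {\<omega> \<in> space M. N * G_fun M K X q t + N * \<epsilon> \<le> (\<Sum>i<N. h (U i \<omega>))}"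
    unfolding eG using N by (simp add: field_simps)
  with Hoeffding_ineq_ge[OF pos(2,1)]
  show "prob {\<omega> \<in> space M. G_fun M K X q t + \<epsilon> \<le> empirical_G K N (sample N U \<omega>) q t} \<le> exp (- 2 * real N * \<epsilon>\<^sup>2 / (real K)\<^sup>2)"
    unfolding ex mu by simp
  have "{\<omega> \<in> space M. empirical_G K N (sample N U \<omega>) q t \<le> G_fun M K X q t - \<epsilon>} =
      {\<omega> \<in> space M. (\<Sum>i<N. h (U i \<omega>)) \<le> N * G_fun M K X q t - N * \<epsilon>}"
    unfolding eG using N by (simp add: field_simps)
  with Hoeffding_ineq_le[OF pos(2,1)]
  show "prob {\<omega> \<in> space M. empirical_G K N (sample N U \<omega>) q t \<le> G_fun M K X q t - \<epsilon>} \<le> exp (- 2 * real N * \<epsilon>\<^sup>2 / (real K)\<^sup>2)"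
    unfolding ex mu by simp
qed

lemma info_empirical_measurable [measurable]:
  assumes q: "q \<in> continuous_scores"
  shows "(\<lambda>\<omega>. info (empirical_set K N (sample N U \<omega>) q \<beta>)) \<in> borel_measurable M"
  unfolding info_def empirical_set_def mem_Collect_eq
proof (intro borel_measurable_sum measurable_prob)
  fix k assume k: "k \<in> {1..K}"
  note [measurable] = continuous_scoresD(1)[OF q k]
  have [measurable]: "(\<lambda>z. empirical_G K N (sample N U (fst z)) q (q k (X (snd z)))) \<in> borel_measurable (M \<Otimes>\<^sub>M M)"
    using q by (intro empirical_G_pair_measurable) (auto simp: continuous_scores_def)
  show "Measurable.pred (M \<Otimes>\<^sub>M M) (\<lambda>z. k \<in> {1..K} \<and> empirical_G K N (sample N U (fst z)) q (q k (X (snd z))) \<le> \<beta>)"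
    by measurable
qed

text \<open>The information of the empirical set is compared with \<open>\<beta>\<close> through the empirical tail
  function at the single point where the population tail function equals \<open>\<beta> \<plusminus> \<epsilon>\<close>.\<close>

lemma info_empirical_concentration:
  assumes q: "q \<in> continuous_scores" and \<beta>: "0 < \<beta>" "\<beta> < real K" and eps: "0 < \<epsilon>"
  shows "prob {\<omega> \<in> space M. \<epsilon> < \<bar>info (empirical_set K N (sample N U \<omega>) q \<beta>) - \<beta>\<bar>} \<le>
    2 * exp (- 2 * real N * \<epsilon>\<^sup>2 / (real K)\<^sup>2)"
proof -
  let ?I = "\<lambda>\<omega>. info (empirical_set K N (sample N U \<omega>) q \<beta>)"
  let ?G = "\<lambda>\<omega>. empirical_G K N (sample N U \<omega>) q"
  let ?e = "exp (- 2 * real N * \<epsilon>\<^sup>2 / (real K)\<^sup>2)"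
  have q': "q \<in> score_functions S K" using q by (simp add: continuous_scores_def)
  note [measurable] = info_empirical_measurable[OF q]
  have [measurable]: "(\<lambda>\<omega>. ?G \<omega> t) \<in> borel_measurable M" for t
    using q' by (intro empirical_G_pair_measurable) auto
  have I_eq: "?I \<omega> = (\<Sum>k=1..K. prob {\<omega>' \<in> space M. ?G \<omega> (q k (X \<omega>')) \<le> \<beta>})" for \<omega>
    unfolding info_def empirical_set_def by (intro sum.cong) auto
  \<comment> \<open>Take t with population tail \<beta> + \<epsilon>. If the empirical tail at t
    exceeded \<beta>, only score values at least t would be accepted and the information would be at
    most \<beta> + \<epsilon>. So a large information forces a deviation of \<epsilon> at t. If
    \<beta> + \<epsilon> \<ge> K, the event is empty.\<close>
  have up: "prob {\<omega> \<in> space M. \<beta> + \<epsilon> < ?I \<omega>} \<le> ?e"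
  proof (cases "\<beta> + \<epsilon> < real K")
    case True
    then obtain t where t: "G_fun M K X q t = \<beta> + \<epsilon>"
      using G_fun_attains[OF q, of "\<beta> + \<epsilon>"] \<beta> eps by auto
    have "{\<omega> \<in> space M. \<beta> + \<epsilon> < ?I \<omega>} \<subseteq> {\<omega> \<in> space M. ?G \<omega> t \<le> G_fun M K X q t - \<epsilon>}"
    proof safe
      fix \<omega> assume "\<omega> \<in> space M" and I: "\<beta> + \<epsilon> < ?I \<omega>"
      show "?G \<omega> t \<le> G_fun M K X q t - \<epsilon>"
      proof (rule ccontr)
        assume "\<not> ?thesis"
        then have G: "\<beta> < ?G \<omega> t" using t by simp
        have "?I \<omega> \<le> (\<Sum>k=1..K. prob {\<omega>' \<in> space M. t \<le> q k (X \<omega>')})"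
          unfolding I_eq
        proof (intro sum_mono finite_measure_mono)
          fix k assume "k \<in> {1..K}"
          note [measurable] = continuous_scoresD(1)[OF q this]
          show "{\<omega>' \<in> space M. t \<le> q k (X \<omega>')} \<in> sets M" by measurable
          show "{\<omega>' \<in> space M. ?G \<omega> (q k (X \<omega>')) \<le> \<beta>} \<subseteq> {\<omega>' \<in> space M. t \<le> q k (X \<omega>')}"
            proof safe
              fix \<omega>' assume "?G \<omega> (q k (X \<omega>')) \<le> \<beta>"
              then show "t \<le> q k (X \<omega>')"
                using G empirical_G_antimono[of "q k (X \<omega>')" t N "sample N U \<omega>" q] by linarith
            qed
        qed
        then show False
          using I t by (simp add: G_fun_eq(1)[OF q])
      qed
    qed
    then have "prob {\<omega> \<in> space M. \<beta> + \<epsilon> < ?I \<omega>} \<le> prob {\<omega> \<in> space M. ?G \<omega> t \<le> G_fun M K X q t - \<epsilon>}"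
      by (intro finite_measure_mono) auto
    also have "\<dots> \<le> ?e"
      using eps by (intro empirical_G_concentration[OF q]) simp
    finally show ?thesis .
  next
    case False
    then have "{\<omega> \<in> space M. \<beta> + \<epsilon> < ?I \<omega>} = {}"
      using info_bounds(2) by (auto simp: not_less intro: order_trans)
    then show ?thesis by (simp only: measure_empty) simp
  qed
  \<comment> \<open>The mirror image: an empirical tail of at most \<beta> at t accepts every score
    value at least t, so the information is at least the population tail \<beta> -
    \<epsilon>.\<close>
  have low: "prob {\<omega> \<in> space M. ?I \<omega> < \<beta> - \<epsilon>} \<le> ?e"
  proof (cases "0 < \<beta> - \<epsilon>")
    case True
    then obtain t where t: "G_fun M K X q t = \<beta> - \<epsilon>"
      using G_fun_attains[OF q, of "\<beta> - \<epsilon>"] \<beta> eps by auto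
    have "{\<omega> \<in> space M. ?I \<omega> < \<beta> - \<epsilon>} \<subseteq> {\<omega> \<in> space M. G_fun M K X q t + \<epsilon> \<le> ?G \<omega> t}"
    proof safe
      fix \<omega> assume "\<omega> \<in> space M" and I: "?I \<omega> < \<beta> - \<epsilon>"
      show "G_fun M K X q t + \<epsilon> \<le> ?G \<omega> t"
      proof (rule ccontr)
        assume "\<not> ?thesis"
        then have G: "?G \<omega> t \<le> \<beta>" using t by simp
        have "(\<Sum>k=1..K. prob {\<omega>' \<in> space M. t \<le> q k (X \<omega>')}) \<le> ?I \<omega>"
          unfolding I_eq
        proof (intro sum_mono finite_measure_mono)
          fix k assume "k \<in> {1..K}"
          note [measurable] = continuous_scoresD(1)[OF q this]
          show "{\<omega>' \<in> space M. ?G \<omega> (q k (X \<omega>')) \<le> \<beta>} \<in> sets M" by measurable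
          show "{\<omega>' \<in> space M. t \<le> q k (X \<omega>')} \<subseteq> {\<omega>' \<in> space M. ?G \<omega> (q k (X \<omega>')) \<le> \<beta>}"
            using G empirical_G_antimono[of t _ N "sample N U \<omega>" q] by (force intro: order_trans)
        qed
        then show False
          using I t by (simp add: G_fun_eq(1)[OF q])
      qed
    qed
    then have "prob {\<omega> \<in> space M. ?I \<omega> < \<beta> - \<epsilon>} \<le> prob {\<omega> \<in> space M. G_fun M K X q t + \<epsilon> \<le> ?G \<omega> t}"
      by (intro finite_measure_mono) auto
    also have "\<dots> \<le> ?e"
      using eps by (intro empirical_G_concentration[OF q]) simp
    finally show ?thesis .
  next
    case False
    then have "{\<omega> \<in> space M. ?I \<omega> < \<beta> - \<epsilon>} = {}"
      using order_trans[OF _ info_bounds(1), of "\<beta> - \<epsilon>"] by (auto simp: not_less)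
    then show ?thesis by (simp only: measure_empty) simp
  qed
  have "prob {\<omega> \<in> space M. \<epsilon> < \<bar>?I \<omega> - \<beta>\<bar>} =
      prob ({\<omega> \<in> space M. \<beta> + \<epsilon> < ?I \<omega>} \<union> {\<omega> \<in> space M. ?I \<omega> < \<beta> - \<epsilon>})"
    by (intro arg_cong[where f=prob]) auto
  also have "\<dots> \<le> prob {\<omega> \<in> space M. \<beta> + \<epsilon> < ?I \<omega>} + prob {\<omega> \<in> space M. ?I \<omega> < \<beta> - \<epsilon>}"
    by (intro measure_Un_le) auto
  finally show ?thesis
    using up low by linarith
qed

text \<open>For the step b = K / sqrt N the tail bound at j b is 2 exp (-2 j^2), free of K and N.
  The grid may stop at J, since the deviation is at most K = sqrt N b. Summation gives b (1 +
  2).\<close>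

lemma expectation_info_empirical:
  assumes q: "q \<in> continuous_scores" and \<beta>: "0 < \<beta>" "\<beta> < real K"
  shows "expectation (\<lambda>\<omega>. \<bar>info (empirical_set K N (sample N U \<omega>) q \<beta>) - \<beta>\<bar>) \<le> 3 * real K / sqrt N"
proof -
  define b where "b = real K / sqrt N"
  define J where "J = nat \<lceil>sqrt N\<rceil>"
  let ?Z = "\<lambda>\<omega>. \<bar>info (empirical_set K N (sample N U \<omega>) q \<beta>) - \<beta>\<bar>"
  note [measurable] = info_empirical_measurable[OF q]
  have b: "0 < b" using N K by (simp add: b_def)
  have Z: "?Z \<omega> \<le> real K" for \<omega>
    using info_bounds[of "empirical_set K N (sample N U \<omega>) q \<beta>"] \<beta> by (simp add: abs_le_iff)
  have "real K = sqrt N * b" using N by (simp add: b_def)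
  also have "\<dots> \<le> (real J + 1) * b"
  proof -
    have "sqrt N \<le> real J" unfolding J_def by linarith
    then show ?thesis
      using b by (intro mult_right_mono) auto
  qed
  finally have KJ: "real K \<le> (real J + 1) * b" .
  have i: "integrable M (\<lambda>\<omega>. of_bool (real j * b < ?Z \<omega>) :: real)" for j
    by (intro integrable_const_bound[where B=1]) auto
  have "expectation ?Z \<le> expectation (\<lambda>\<omega>. b * (1 + (\<Sum>j=1..J. of_bool (real j * b < ?Z \<omega>))))"
  proof (rule integral_mono)
    show "integrable M ?Z"
      using Z by (intro integrable_const_bound[where B="real K"]) auto
    show "integrable M (\<lambda>\<omega>. b * (1 + (\<Sum>j=1..J. of_bool (real j * b < ?Z \<omega>))))"
      using i by (intro integrable_mult_right Bochner_Integration.integrable_add Bochner_Integration.integrable_sum) auto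
  qed (intro le_mult_count b order_trans[OF Z KJ])
  also have "\<dots> = b * (1 + (\<Sum>j=1..J. prob {\<omega> \<in> space M. real j * b < ?Z \<omega>}))"
  proof -
    have "expectation (\<lambda>\<omega>. b * (1 + (\<Sum>j=1..J. of_bool (real j * b < ?Z \<omega>)))) =
      b * (expectation (\<lambda>\<omega>. 1) + (\<Sum>j=1..J. expectation (\<lambda>\<omega>. of_bool (real j * b < ?Z \<omega>))))"
      using i by (subst Bochner_Integration.integral_sum[symmetric], blast,
        subst Bochner_Integration.integral_add[symmetric]) (auto intro!: Bochner_Integration.integrable_sum simp del: sum_of_bool_eq)
    also have "\<dots> = b * (1 + (\<Sum>j=1..J. prob {\<omega> \<in> space M. real j * b < ?Z \<omega>}))"
      by (simp add: prob_space integral_of_bool)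
    finally show ?thesis .
  qed
  also have "\<dots> \<le> b * (1 + 2 * (\<Sum>j=1..J. (1/2) ^ j))"
    unfolding sum_distrib_left
  proof (intro mult_left_mono add_left_mono sum_mono)
    fix j assume "j \<in> {1..J}"
    then have "prob {\<omega> \<in> space M. real j * b < ?Z \<omega>} \<le> 2 * exp (- 2 * real N * (real j * b)\<^sup>2 / (real K)\<^sup>2)"
      using b by (intro info_empirical_concentration[OF q \<beta>]) auto
    also have "- 2 * real N * (real j * b)\<^sup>2 / (real K)\<^sup>2 = - 2 * (real j)\<^sup>2"
      using N K by (simp add: b_def power_mult_distrib power_divide)
    finally show "prob {\<omega> \<in> space M. real j * b < ?Z \<omega>} \<le> 2 * (1/2) ^ j"
      using exp_neg2_sq_le[of j] by linarith
  qed (use b in auto)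
  also have "\<dots> \<le> b * (1 + 2 * 1)"
    using b sum_half_power_le by (intro mult_left_mono add_left_mono) auto
  finally show ?thesis by (simp add: b_def mult.commute)
qed

end

end

subsection \<open>Excess risk of the empirical minimizer\<close>

text \<open>For positive y it follows from (1 - y + y^2) (1 + y) = 1 + y^3 \<ge> 1 and 1 + y \<le>
  exp y.\<close>

lemma exp_neg_le:
  assumes "\<bar>y :: real\<bar> \<le> 1"
  shows "exp (- y) \<le> 1 - y + y\<^sup>2"
proof (cases "y \<le> 0")
  case True
  then show ?thesis
    using exp_bound[of "- y"] assms by simp
next
  case False
  then have "1 \<le> (1 - y + y\<^sup>2) * (1 + y)"
    by (simp add: algebra_simps power2_eq_square)
  also have "\<dots> \<le> (1 - y + y\<^sup>2) * exp y"
  proof (rule mult_left_mono)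
    show "0 \<le> 1 - y + y\<^sup>2" using assms by simp
  qed (use exp_ge_add_one_self[of y] in simp)
  finally show ?thesis
    by (simp add: exp_minus field_simps)
qed

text \<open>The Bernstein condition is the assumption \<open>var\<close>; the slack \<open>\<eta>\<close> is there because \<open>F\<close> need not
  contain a minimizer of the risk.\<close>

lemma (in prob_space) exp_moment_le_one:
  fixes l b A \<eta> :: real and g :: "'b \<Rightarrow> real"
  assumes V: "independent_copies M MA n V V0" and n: "0 < n"
    and V0 [measurable]: "V0 \<in> M \<rightarrow>\<^sub>M MA" and g [measurable]: "g \<in> borel_measurable MA"
    and bd: "\<And>z. z \<in> space MA \<Longrightarrow> \<bar>g z\<bar> \<le> b" and l: "0 < l" "l * b \<le> 1"
    and var: "expectation (\<lambda>\<omega>. (g (V0 \<omega>))\<^sup>2) \<le> A * (expectation (\<lambda>\<omega>. g (V0 \<omega>)) + 2 * \<eta>)" "0 < A" "l * A \<le> 1/2"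
  defines "m \<equiv> expectation (\<lambda>\<omega>. g (V0 \<omega>))"
  shows "integrable M (\<lambda>\<omega>. exp (l * n * (m / 2 - (\<Sum>i<n. g (V i \<omega>)) / n - \<eta>)))" (is "integrable M ?f")
    and "expectation (\<lambda>\<omega>. exp (l * n * (m / 2 - (\<Sum>i<n. g (V i \<omega>)) / n - \<eta>))) \<le> 1"
proof -
  have Vm [measurable]: "V i \<in> M \<rightarrow>\<^sub>M MA" if "i < n" for i
    using V that by (auto simp: independent_copies_def indep_vars_def)
  have bd': "\<bar>l * g z\<bar> \<le> 1" if "z \<in> space MA" for z
  proof -
    have "\<bar>l * g z\<bar> = l * \<bar>g z\<bar>" using l by (simp add: abs_mult)
    also have "\<dots> \<le> l * b" using l bd[OF that] by (intro mult_left_mono) auto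
    finally show ?thesis using l by simp
  qed
  have bV0: "\<bar>g (V0 \<omega>)\<bar> \<le> b" "\<bar>l * g (V0 \<omega>)\<bar> \<le> 1" if "\<omega> \<in> space M" for \<omega>
    using bd bd' measurable_space[OF V0 that] by auto
  have int: "integrable M (\<lambda>\<omega>. g (V0 \<omega>))"
    using bV0 by (intro integrable_const_bound[where B=b]) auto
  have int2: "integrable M (\<lambda>\<omega>. (g (V0 \<omega>))\<^sup>2)"
    using bV0 by (intro integrable_const_bound[where B="b\<^sup>2"]) (auto simp: abs_le_square_iff[symmetric] intro: order_trans[OF _ abs_ge_self])
  have exp_int: "integrable M (\<lambda>\<omega>. exp (- (l * g (W \<omega>))))" if [measurable]: "W \<in> M \<rightarrow>\<^sub>M MA" for W
  proof (rule integrable_const_bound[where B="exp 1"])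
    show "AE \<omega> in M. norm (exp (- (l * g (W \<omega>)))) \<le> exp 1"
      using bd' measurable_space[OF that] by (intro AE_I2) (auto simp: abs_le_iff)
  qed measurable
  \<comment> \<open>The second-order term is at most l (l A) (m + 2 \<eta>). As l A \<le> 1/2, it
    consumes half of the linear term l m and adds l \<eta>; this is why the statement has m / 2 and
    \<eta>.\<close>
  have mgf: "expectation (\<lambda>\<omega>. exp (- (l * g (V0 \<omega>)))) \<le> exp (- l * m / 2 + l * \<eta>)"
  proof -
    \<comment> \<open>The mean m may be negative. Only m + 2 \<eta> has a sign, forced by the second
      moment on the left of the Bernstein condition.\<close>
    have m_pos: "0 \<le> m + 2 * \<eta>"
    proof -
      have "0 \<le> expectation (\<lambda>\<omega>. (g (V0 \<omega>))\<^sup>2)" by (intro integral_nonneg_AE) simp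
      also have "\<dots> \<le> A * (m + 2 * \<eta>)" using var by (simp add: m_def)
      finally show ?thesis using var(2) by (simp add: zero_le_mult_iff)
    qed
    have "expectation (\<lambda>\<omega>. exp (- (l * g (V0 \<omega>)))) \<le> expectation (\<lambda>\<omega>. 1 - l * g (V0 \<omega>) + l\<^sup>2 * (g (V0 \<omega>))\<^sup>2)"
    proof (rule integral_mono[OF exp_int[OF V0]])
      show "integrable M (\<lambda>\<omega>. 1 - l * g (V0 \<omega>) + l\<^sup>2 * (g (V0 \<omega>))\<^sup>2)"
        using int int2 by simp
      show "exp (- (l * g (V0 \<omega>))) \<le> 1 - l * g (V0 \<omega>) + l\<^sup>2 * (g (V0 \<omega>))\<^sup>2" if "\<omega> \<in> space M" for \<omega>
        using exp_neg_le[OF bV0(2)[OF that]] by (simp add: power_mult_distrib)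
    qed
    also have "\<dots> = 1 - l * m + l\<^sup>2 * expectation (\<lambda>\<omega>. (g (V0 \<omega>))\<^sup>2)"
      using int int2 by (simp add: m_def prob_space)
    also have "l\<^sup>2 * expectation (\<lambda>\<omega>. (g (V0 \<omega>))\<^sup>2) \<le> l * (1 / 2 * (m + 2 * \<eta>))"
    proof -
      have "l\<^sup>2 * expectation (\<lambda>\<omega>. (g (V0 \<omega>))\<^sup>2) \<le> l\<^sup>2 * (A * (m + 2 * \<eta>))"
        using var(1) by (intro mult_left_mono) (auto simp: m_def)
      also have "\<dots> = l * (l * A * (m + 2 * \<eta>))" by (simp add: power2_eq_square algebra_simps)
      also have "\<dots> \<le> l * (1 / 2 * (m + 2 * \<eta>))"
        using l var(3) m_pos by (intro mult_left_mono mult_right_mono) auto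
      finally show ?thesis .
    qed
    also have "1 - l * m + l * (1 / 2 * (m + 2 * \<eta>)) = 1 + (- l * m / 2 + l * \<eta>)"
      by (simp add: algebra_simps)
    also have "\<dots> \<le> exp (- l * m / 2 + l * \<eta>)" by (rule exp_ge_add_one_self)
    finally show ?thesis by simp
  qed
  have f: "?f = (\<lambda>\<omega>. exp (l * n * (m / 2 - \<eta>)) * (\<Prod>i<n. exp (- (l * g (V i \<omega>)))))"
  proof
    fix \<omega>
    have "l * n * (m / 2 - (\<Sum>i<n. g (V i \<omega>)) / n - \<eta>) = l * n * (m / 2 - \<eta>) + (\<Sum>i<n. - (l * g (V i \<omega>)))"
      using n by (simp add: sum_negf sum_distrib_left[symmetric] field_simps)
    then show "?f \<omega> = exp (l * n * (m / 2 - \<eta>)) * (\<Prod>i<n. exp (- (l * g (V i \<omega>))))"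
      by (simp add: exp_add exp_sum)
  qed
  have ind: "indep_vars (\<lambda>_. borel) (\<lambda>i \<omega>. exp (- (l * g (V i \<omega>)))) {..<n}"
    using indep_vars_compose2[where Y="\<lambda>_ z. exp (- (l * g z))" and N="\<lambda>_. borel", of "\<lambda>_. MA" V "{..<n}"] V
    by (simp add: independent_copies_def)
  have int_i: "integrable M (\<lambda>\<omega>. exp (- (l * g (V i \<omega>))))" if "i \<in> {..<n}" for i
    using that by (intro exp_int Vm) simp
  show "integrable M ?f"
    unfolding f using indep_vars_integrable[OF _ ind int_i] by simp
  have "expectation ?f = exp (l * n * (m / 2 - \<eta>)) * (\<Prod>i<n. expectation (\<lambda>\<omega>. exp (- (l * g (V i \<omega>)))))"
    unfolding f using indep_vars_lebesgue_integral[OF _ ind int_i] by simp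
  also have "(\<Prod>i<n. expectation (\<lambda>\<omega>. exp (- (l * g (V i \<omega>))))) = (\<Prod>i<n. expectation (\<lambda>\<omega>. exp (- (l * g (V0 \<omega>)))))"
  proof (intro prod.cong refl)
    fix i assume "i \<in> {..<n}"
    then have i: "i < n" by simp
    note [measurable] = Vm[OF i]
    have "expectation (\<lambda>\<omega>. exp (- (l * g (V i \<omega>)))) = (\<integral>z. exp (- (l * g z)) \<partial>distr M MA (V i))"
      by (subst integral_distr) auto
    also have "distr M MA (V i) = distr M MA V0"
      using V i by (simp add: independent_copies_def)
    also have "(\<integral>z. exp (- (l * g z)) \<partial>distr M MA V0) = expectation (\<lambda>\<omega>. exp (- (l * g (V0 \<omega>))))"
      by (subst integral_distr) auto
    finally show "expectation (\<lambda>\<omega>. exp (- (l * g (V i \<omega>)))) = expectation (\<lambda>\<omega>. exp (- (l * g (V0 \<omega>))))" .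
  qed
  also have "\<dots> \<le> (\<Prod>i<n. exp (- l * m / 2 + l * \<eta>))"
    using mgf by (intro prod_mono conjI integral_nonneg_AE) auto
  also have "\<dots> = exp (n * (- l * m / 2 + l * \<eta>))"
    by (simp add: exp_of_nat_mult)
  also have "exp (l * n * (m / 2 - \<eta>)) * \<dots> = exp (l * n * (m / 2 - \<eta>) + n * (- l * m / 2 + l * \<eta>))"
    by (rule exp_add[symmetric])
  also have "l * n * (m / 2 - \<eta>) + n * (- l * m / 2 + l * \<eta>) = 0"
    by (simp add: algebra_simps)
  finally show "expectation ?f \<le> 1" by simp
qed

text \<open>Apply \<open>y \<le> exp y - 1\<close> to \<open>y = a * Z c - ln (card C)\<close>.\<close>

lemma (in prob_space) finite_max_dominated:
  fixes Z :: "'c \<Rightarrow> 'a \<Rightarrow> real"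
  assumes C: "finite C" "C \<noteq> {}" and a: "0 < a"
    and int: "\<And>c. c \<in> C \<Longrightarrow> integrable M (\<lambda>\<omega>. exp (a * Z c \<omega>))"
    and le: "\<And>c. c \<in> C \<Longrightarrow> expectation (\<lambda>\<omega>. exp (a * Z c \<omega>)) \<le> 1"
  obtains T where "integrable M T" "\<And>c \<omega>. c \<in> C \<Longrightarrow> Z c \<omega> \<le> T \<omega>" "expectation T \<le> ln (card C) / a"
proof
  \<comment> \<open>A majorant of all \<open>Z c\<close> at once whose mean is computed termwise:
    the average of the exponentials has mean at most 1, which cancels the -1.\<close>
  define T where "T \<omega> = ((\<Sum>c\<in>C. exp (a * Z c \<omega>)) / card C - 1 + ln (card C)) / a" for \<omega>
  have card: "0 < real (card C)" using C by (simp add: card_gt_0_iff)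
  show "integrable M T"
    unfolding T_def using int by simp
  show "Z c \<omega> \<le> T \<omega>" if "c \<in> C" for c \<omega>
  proof -
    have "a * Z c \<omega> - ln (card C) \<le> exp (a * Z c \<omega> - ln (card C)) - 1"
      using exp_ge_add_one_self[of "a * Z c \<omega> - ln (card C)"] by linarith
    also have "exp (a * Z c \<omega> - ln (card C)) = exp (a * Z c \<omega>) / card C"
      using card by (simp add: exp_diff)
    also have "\<dots> \<le> (\<Sum>c\<in>C. exp (a * Z c \<omega>)) / card C"
      using C that card by (intro divide_right_mono member_le_sum) auto
    finally show ?thesis
      using a by (simp add: T_def field_simps)
  qed
  have "expectation T = ((\<Sum>c\<in>C. expectation (\<lambda>\<omega>. exp (a * Z c \<omega>))) / card C - 1 + ln (card C)) / a"
    unfolding T_def using int by (simp add: prob_space)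
  also have "\<dots> \<le> ((\<Sum>c\<in>C. 1) / card C - 1 + ln (card C)) / a"
    using le card a by (intro divide_right_mono add_right_mono diff_right_mono sum_mono) auto
  finally show "expectation T \<le> ln (card C) / a"
    using card by simp
qed

lemma Linf_norm_le_iff:
  "Linf_norm S K f \<le> ereal r \<longleftrightarrow> (\<forall>k\<in>{1..K}. \<forall>x\<in>space S. \<bar>f k x\<bar> \<le> r)"
  by (simp add: Linf_norm_def SUP_le_iff)

text \<open>The centres of a cover need not lie in the class; moving them into it doubles the radius.\<close>

lemma covering_number_internal:
  assumes "covering_number S K r F = enat m"
  obtains C where "finite C" "C \<subseteq> F" "card C \<le> m"
    "\<And>f. f \<in> F \<Longrightarrow> \<exists>c\<in>C. \<forall>k\<in>{1..K}. \<forall>x\<in>space S. \<bar>f k x - c k x\<bar> \<le> 2 * r"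
proof -
  \<comment> \<open>The strict inequality turns the infimum into an actual cover by at most m
    balls.\<close>
  have "covering_number S K r F < enat (Suc m)"
    using assms by simp
  then obtain C0 where C0: "finite C0" "F \<subseteq> (\<Union>g\<in>C0. Linf_cball S K g r)" "card C0 < Suc m"
    unfolding covering_number_def INF_less_iff mem_Collect_eq enat_ord_simps by blast
  define c where "c g = (SOME f. f \<in> F \<inter> Linf_cball S K g r)" for g
  define C1 where "C1 = {g \<in> C0. F \<inter> Linf_cball S K g r \<noteq> {}}"
  have c: "c g \<in> F \<inter> Linf_cball S K g r" if "g \<in> C1" for g
    unfolding c_def some_in_eq using that by (simp add: C1_def)
  show thesis
  proof
    show "finite (c ` C1)" using C0(1) by (simp add: C1_def)
    show "c ` C1 \<subseteq> F" using c by auto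
    have "card (c ` C1) \<le> card C1" using C0(1) by (intro card_image_le) (simp add: C1_def)
    also have "\<dots> \<le> card C0" using C0(1) by (intro card_mono) (auto simp: C1_def)
    finally show "card (c ` C1) \<le> m" using C0(3) by simp
    fix f assume "f \<in> F"
    then obtain g where g: "g \<in> C1" "f \<in> Linf_cball S K g r"
      using C0(2) unfolding C1_def by blast
    have "\<bar>f k x - c g k x\<bar> \<le> 2 * r" if "k \<in> {1..K}" "x \<in> space S" for k x
    proof -
      have "\<bar>f k x - g k x\<bar> \<le> r" "\<bar>c g k x - g k x\<bar> \<le> r"
        using g(2) c[OF g(1)] that by (auto simp: Linf_cball_def Linf_norm_le_iff)
      then show ?thesis by linarith
    qed
    then show "\<exists>c\<in>c ` C1. \<forall>k\<in>{1..K}. \<forall>x\<in>space S. \<bar>f k x - c k x\<bar> \<le> 2 * r"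
      using g(1) by blast
  qed
qed

section \<open>Fast rate for the empirical minimizer\<close>

context phi_risk_pair
begin

lemma loss_diff_le:
  "\<bar>loss f x y - loss g x y\<bar> \<le> L * (\<Sum>k=1..K. \<bar>f k x - g k x\<bar>)"
proof -
  have "\<bar>loss f x y - loss g x y\<bar> \<le>
      (\<Sum>k=1..K. \<bar>\<phi> ((2 * of_bool (y = k) - 1) * f k x) - \<phi> ((2 * of_bool (y = k) - 1) * g k x)\<bar>)"
    unfolding phi_loss_def sum_subtractf[symmetric] by (rule sum_abs)
  also have "\<dots> \<le> (\<Sum>k=1..K. L * \<bar>f k x - g k x\<bar>)"
  proof (rule sum_mono)
    fix k
    let ?s = "2 * of_bool (y = k) - 1 :: real"
    have "\<bar>\<phi> (?s * f k x) - \<phi> (?s * g k x)\<bar> \<le> L * \<bar>?s * f k x - ?s * g k x\<bar>"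
      using lipschitz_onD[OF lipschitz, of "?s * f k x" "?s * g k x"] by (simp add: dist_real_def)
    also have "\<bar>?s * f k x - ?s * g k x\<bar> = \<bar>f k x - g k x\<bar>" by auto
    finally show "\<bar>\<phi> (?s * f k x) - \<phi> (?s * g k x)\<bar> \<le> L * \<bar>f k x - g k x\<bar>" .
  qed
  finally show ?thesis by (simp add: sum_distrib_left)
qed

lemma loss_diff_le_uniform:
  assumes "\<And>k. k \<in> {1..K} \<Longrightarrow> \<bar>f k x - g k x\<bar> \<le> r"
  shows "\<bar>loss f x y - loss g x y\<bar> \<le> L * real K * r"
proof -
  have "(\<Sum>k=1..K. \<bar>f k x - g k x\<bar>) \<le> (\<Sum>k=1..K. r)"
    using assms by (intro sum_mono) auto
  then have "L * (\<Sum>k=1..K. \<bar>f k x - g k x\<bar>) \<le> L * (real K * r)"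
    using lipschitz_on_nonneg[OF lipschitz] by (intro mult_left_mono) auto
  then show ?thesis
    using loss_diff_le[of f x y g] by (simp add: mult.assoc)
qed

lemma phi_risk_diff:
  assumes "f \<in> bounded_scores B" "g \<in> bounded_scores B"
  shows "phi_risk M K X Y \<phi> f - phi_risk M K X Y \<phi> g = expectation (\<lambda>\<omega>. loss f (X \<omega>) (Y \<omega>) - loss g (X \<omega>) (Y \<omega>))"
  using loss_integrable[OF assms(1)] loss_integrable[OF assms(2)] by (simp add: phi_risk_def)

text \<open>Apply the modulus at \<epsilon> = sqrt e, with e the squared distance of f and g. The
  midpoint lies in \<open>F\<close> and has risk at least that of g minus \<eta>, so
  \<open>c\<^sub>1\<close> e is at most half the risk difference plus \<eta>. The Lipschitz bound
  and Cauchy-Schwarz over the labels turn e into the second moment at the price of a factor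
  K.\<close>

lemma second_moment_le:
  assumes F: "F \<subseteq> bounded_scores B" "convex_scores F" and fg: "f \<in> F" "g \<in> F"
    and modulus: "\<And>\<epsilon>. 0 < \<epsilon> \<Longrightarrow> ereal (c\<^sub>1 * \<epsilon>\<^sup>2) \<le> convexity_modulus M K X Y \<phi> F \<epsilon>" and c1: "0 < c\<^sub>1"
    and near_min: "\<And>h. h \<in> F \<Longrightarrow> phi_risk M K X Y \<phi> g \<le> phi_risk M K X Y \<phi> h + \<eta>"
  shows "expectation (\<lambda>\<omega>. (loss f (X \<omega>) (Y \<omega>) - loss g (X \<omega>) (Y \<omega>))\<^sup>2) \<le>
    L\<^sup>2 * K / (2 * c\<^sub>1) * (expectation (\<lambda>\<omega>. loss f (X \<omega>) (Y \<omega>) - loss g (X \<omega>) (Y \<omega>)) + 2 * \<eta>)"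
proof -
  have fB: "f \<in> bounded_scores B" and gB: "g \<in> bounded_scores B" using F fg by auto
  note [measurable] = scoreD[OF bounded_scoresD(1)[OF fB]] scoreD[OF bounded_scoresD(1)[OF gB]]
  let ?R = "phi_risk M K X Y \<phi>"
  define e where "e = (\<Sum>k=1..K. \<integral>\<omega>. (f k (X \<omega>) - g k (X \<omega>))\<^sup>2 \<partial>M)"
  have e_nonneg: "0 \<le> e" unfolding e_def by (intro sum_nonneg integral_nonneg_AE) auto
  have conv: "c\<^sub>1 * e \<le> (?R f - ?R g) / 2 + \<eta>"
  proof (cases "e = 0")
    case True
    \<comment> \<open>The modulus is bounded below only for positive arguments. For e = 0
      near-minimality suffices: tested with f and with g itself, it makes the right-hand side
      nonnegative.\<close>
    then show ?thesis using near_min[OF fg(1)] near_min[OF fg(2)] by (simp add: field_simps)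
  next
    case False
    with e_nonneg have e: "0 < e" by simp
    let ?mid = "\<lambda>k x. (f k x + g k x) / 2"
    have "ereal (c\<^sub>1 * (sqrt e)\<^sup>2) \<le> convexity_modulus M K X Y \<phi> F (sqrt e)"
      using e by (intro modulus) simp
    also have "\<dots> \<le> ereal ((?R f + ?R g) / 2 - ?R ?mid)"
      unfolding convexity_modulus_def
      by (rule INF_lower2[of "(f, g)"]) (use fg e in \<open>auto simp: e_def\<close>)
    finally have "c\<^sub>1 * e \<le> (?R f + ?R g) / 2 - ?R ?mid" using e by simp
    moreover have "?mid \<in> F"
    proof -
      have "(\<lambda>k x. (1 - 1/2) * f k x + 1/2 * g k x) \<in> F"
        using F(2)[unfolded convex_scores_def, rule_format, OF fg, of "1/2"] by simp
      also have "(\<lambda>k x. (1 - 1/2) * f k x + 1/2 * g k x) = ?mid"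
        by (intro ext) (simp add: field_simps)
      finally show ?thesis .
    qed
    ultimately show ?thesis using near_min[of ?mid] by (simp add: field_simps)
  qed
  have int: "integrable M (\<lambda>\<omega>. (f k (X \<omega>) - g k (X \<omega>))\<^sup>2)" if k: "k \<in> {1..K}" for k
  proof (rule integrable_const_bound[where B="(2 * B)\<^sup>2"])
    show "AE \<omega> in M. norm ((f k (X \<omega>) - g k (X \<omega>))\<^sup>2) \<le> (2 * B)\<^sup>2"
    proof (rule AE_I2)
      fix \<omega> assume "\<omega> \<in> space M"
      then have "\<bar>f k (X \<omega>)\<bar> \<le> B" "\<bar>g k (X \<omega>)\<bar> \<le> B"
        using bounded_scoresD(2)[OF fB k] bounded_scoresD(2)[OF gB k] measurable_space[OF X] by auto
      then have "\<bar>f k (X \<omega>) - g k (X \<omega>)\<bar> \<le> \<bar>2 * B\<bar>" by linarith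
      then show "norm ((f k (X \<omega>) - g k (X \<omega>))\<^sup>2) \<le> (2 * B)\<^sup>2"
        by (simp add: abs_le_square_iff)
    qed
    show "(\<lambda>\<omega>. (f k (X \<omega>) - g k (X \<omega>))\<^sup>2) \<in> borel_measurable M"
      using k by measurable
  qed
  have "expectation (\<lambda>\<omega>. (loss f (X \<omega>) (Y \<omega>) - loss g (X \<omega>) (Y \<omega>))\<^sup>2) \<le>
      expectation (\<lambda>\<omega>. L\<^sup>2 * K * (\<Sum>k=1..K. (f k (X \<omega>) - g k (X \<omega>))\<^sup>2))"
  proof (rule integral_mono_AE')
    show "integrable M (\<lambda>\<omega>. L\<^sup>2 * K * (\<Sum>k=1..K. (f k (X \<omega>) - g k (X \<omega>))\<^sup>2))"
      using int by (intro integrable_mult_right Bochner_Integration.integrable_sum)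
    show "AE \<omega> in M. (loss f (X \<omega>) (Y \<omega>) - loss g (X \<omega>) (Y \<omega>))\<^sup>2 \<le> L\<^sup>2 * K * (\<Sum>k=1..K. (f k (X \<omega>) - g k (X \<omega>))\<^sup>2)"
    proof (rule AE_I2)
      fix \<omega>
      let ?a = "\<lambda>k. \<bar>f k (X \<omega>) - g k (X \<omega>)\<bar>"
      have "(loss f (X \<omega>) (Y \<omega>) - loss g (X \<omega>) (Y \<omega>))\<^sup>2 \<le> (L * (\<Sum>k=1..K. ?a k))\<^sup>2"
        using loss_diff_le[of f "X \<omega>" "Y \<omega>" g]
        by (subst abs_le_square_iff[symmetric]) linarith
      also have "\<dots> = L\<^sup>2 * (\<Sum>k=1..K. ?a k)\<^sup>2" by (simp add: power_mult_distrib)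
      also have "\<dots> \<le> L\<^sup>2 * ((\<Sum>k=1..K. (?a k)\<^sup>2) * card {1..K})"
        by (intro mult_left_mono sum_squared_le_sum_of_squares) auto
      finally show "(loss f (X \<omega>) (Y \<omega>) - loss g (X \<omega>) (Y \<omega>))\<^sup>2 \<le> L\<^sup>2 * K * (\<Sum>k=1..K. (f k (X \<omega>) - g k (X \<omega>))\<^sup>2)"
        by (simp add: mult_ac)
    qed
    show "AE \<omega> in M. 0 \<le> L\<^sup>2 * K * (\<Sum>k=1..K. (f k (X \<omega>) - g k (X \<omega>))\<^sup>2)"
      by (intro AE_I2 mult_nonneg_nonneg sum_nonneg) auto
  qed
  also have "\<dots> = L\<^sup>2 * K * e"
    unfolding e_def using int by (simp add: Bochner_Integration.integral_sum)
  also have "\<dots> \<le> L\<^sup>2 * K * (((?R f - ?R g) / 2 + \<eta>) / c\<^sub>1)"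
    using conv c1 by (intro mult_left_mono) (auto simp: field_simps)
  also have "\<dots> = L\<^sup>2 * K / (2 * c\<^sub>1) * (?R f - ?R g + 2 * \<eta>)"
    using c1 by (simp add: field_simps)
  finally show ?thesis
    unfolding phi_risk_diff[OF fB gB] .
qed

lemma empirical_phi_risk_diff:
  "empirical_phi_risk K n \<phi> d f - empirical_phi_risk K n \<phi> d g =
    (\<Sum>i<n. loss f (fst (d i)) (snd (d i)) - loss g (fst (d i)) (snd (d i))) / n"
  by (simp add: empirical_phi_risk_def sum_subtractf diff_divide_distrib)

text \<open>The conclusion provides a single integrable \<open>T\<close> that bounds every empirical
  minimizer at \<omega>. The mean is then taken of \<open>T\<close>, and the excess risk of the
  estimated score need not be integrated as a function of \<omega>.\<close>

lemma erm_excess_le: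
  assumes F: "F \<subseteq> bounded_scores B" "convex_scores F" "F \<noteq> {}" and K: "0 < K" and n: "0 < n" and L: "0 < L"
    and D: "independent_copies M (pair_space S K) n D (\<lambda>\<omega>. (X \<omega>, Y \<omega>))"
    and modulus: "\<And>\<epsilon>. 0 < \<epsilon> \<Longrightarrow> ereal (c\<^sub>1 * \<epsilon>\<^sup>2) \<le> convexity_modulus M K X Y \<phi> F \<epsilon>" and c1: "0 < c\<^sub>1"
    and cover: "covering_number S K (1 / real n) F = enat m" and m: "2 \<le> m"
  obtains T where "integrable M T"
    "\<And>\<omega> f. \<omega> \<in> space M \<Longrightarrow> is_arg_min (empirical_phi_risk K n \<phi> (sample n D \<omega>)) (\<lambda>f. f \<in> F) f \<Longrightarrow> excess f \<le> T \<omega>"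
    "expectation T \<le> (INF f\<in>F. excess f) + (6 + 12 * L + 2 * (L\<^sup>2 / c\<^sub>1 + 2 * L * B)) * (real K * ln m / n)"
proof -
  let ?R = "phi_risk M K X Y \<phi>"
  obtain C where C: "finite C" "C \<subseteq> F" "card C \<le> m"
    and net: "\<And>f. f \<in> F \<Longrightarrow> \<exists>c\<in>C. \<forall>k\<in>{1..K}. \<forall>x\<in>space S. \<bar>f k x - c k x\<bar> \<le> 2 * (1 / n)"
    using covering_number_internal[OF cover] by metis
  have C_ne: "C \<noteq> {}" using net F(3) by fastforce
  obtain x0 where x0: "x0 \<in> space S" using not_empty measurable_space[OF X] by blast
  have B: "0 \<le> B"
  proof -
    obtain f where "f \<in> bounded_scores B" using F by auto
    from bounded_scoresD(2)[OF this, of 1 x0] show ?thesis using K x0 by simp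
  qed
  \<comment> \<open>A positive slack is needed to pick \<open>g\<close>, and one of order K / n is
    absorbed by the rate.\<close>
  define \<eta> where "\<eta> = real K / n"
  have \<eta>: "0 < \<eta>" using K n by (simp add: \<eta>_def)
  have bdd: "bdd_below (excess ` F)"
    using excess_nonneg F(1) by (intro bdd_belowI2[where m=0]) auto
  have "(INF f\<in>F. excess f) < (INF f\<in>F. excess f) + \<eta>" using \<eta> by simp
  then obtain g where g: "g \<in> F" "excess g < (INF f\<in>F. excess f) + \<eta>"
    unfolding cINF_less_iff[OF F(3) bdd] by blast
  have near_min: "?R g \<le> ?R h + \<eta>" if "h \<in> F" for h
    using g(2) cINF_lower[OF bdd that] by (simp add: excess_phi_risk_def)
  have gB: "g \<in> bounded_scores B" using g F by auto
  define A where "A = L\<^sup>2 * K / (2 * c\<^sub>1)"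
  \<comment> \<open>The inverse of 2 A + 2 L K B. One summand yields l A \<le> 1/2, the other yields
    l times the bound 2 L K B of the loss differences \<le> 1.\<close>
  define l where "l = 1 / (K * (L\<^sup>2 / c\<^sub>1 + 2 * L * B))"
  have den: "0 < L\<^sup>2 / c\<^sub>1 + 2 * L * B" using L c1 B by (simp add: add_pos_nonneg)
  have A: "0 < A" using L c1 K by (simp add: A_def)
  have l: "0 < l" using den K by (simp add: l_def)
  have lA: "l * A \<le> 1/2"
  proof -
    have "A \<le> K * (L\<^sup>2 / c\<^sub>1 + 2 * L * B) / 2"
      using L B K c1 by (simp add: A_def field_simps)
    then have "l * A \<le> l * (K * (L\<^sup>2 / c\<^sub>1 + 2 * L * B) / 2)" using l by (intro mult_left_mono) auto
    also have "\<dots> = 1/2" using den K by (simp add: l_def)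
    finally show ?thesis .
  qed
  have lb: "l * (L * real K * (2 * B)) \<le> 1"
  proof -
    have "L * real K * (2 * B) \<le> K * (L\<^sup>2 / c\<^sub>1 + 2 * L * B)"
      using c1 by (simp add: algebra_simps)
    then have "l * (L * real K * (2 * B)) \<le> l * (K * (L\<^sup>2 / c\<^sub>1 + 2 * L * B))" using l by (intro mult_left_mono) auto
    also have "\<dots> = 1" using den K by (simp add: l_def)
    finally show ?thesis .
  qed
  define d where "d c z = loss c (fst z) (snd z) - loss g (fst z) (snd z)" for c and z :: "'x \<times> nat"
  define mu where "mu c = expectation (\<lambda>\<omega>. d c (X \<omega>, Y \<omega>))" for c
  define Z where "Z c \<omega> = mu c / 2 - (\<Sum>i<n. d c (D i \<omega>)) / n - \<eta>" for c \<omega>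
  have mu: "mu f = ?R f - ?R g" if "f \<in> F" for f
    using phi_risk_diff[of f B g] that gB F by (auto simp: mu_def d_def)
  have moment: "integrable M (\<lambda>\<omega>. exp (l * n * Z c \<omega>))" "expectation (\<lambda>\<omega>. exp (l * n * Z c \<omega>)) \<le> 1" if "c \<in> C" for c
  proof -
    have cF: "c \<in> F" using that C by auto
    then have cB: "c \<in> bounded_scores B" using F by auto
    have meas: "d c \<in> borel_measurable (pair_space S K)"
      unfolding d_def using bounded_scoresD(1)[OF cB] bounded_scoresD(1)[OF gB]
      by (intro borel_measurable_diff phi_loss_measurable phi_measurable)
    have bd: "\<bar>d c z\<bar> \<le> L * real K * (2 * B)" if "z \<in> space (pair_space S K)" for z
      unfolding d_def
    proof (rule loss_diff_le_uniform)
      fix k assume k: "k \<in> {1..K}"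
      have "fst z \<in> space S" using that by (auto simp: space_pair_measure)
      then have "\<bar>c k (fst z)\<bar> \<le> B" "\<bar>g k (fst z)\<bar> \<le> B"
        using bounded_scoresD(2)[OF cB k] bounded_scoresD(2)[OF gB k] by auto
      then show "\<bar>c k (fst z) - g k (fst z)\<bar> \<le> 2 * B" by linarith
    qed
    have var: "expectation (\<lambda>\<omega>. (d c (X \<omega>, Y \<omega>))\<^sup>2) \<le> A * (expectation (\<lambda>\<omega>. d c (X \<omega>, Y \<omega>)) + 2 * \<eta>)"
      using second_moment_le[OF F(1,2) cF g(1) modulus c1 near_min] by (simp add: d_def A_def)
    have XY: "(\<lambda>\<omega>. (X \<omega>, Y \<omega>)) \<in> M \<rightarrow>\<^sub>M pair_space S K" using X Y by simp
    note * = exp_moment_le_one[OF D n XY meas bd l lb var A lA]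
    show "integrable M (\<lambda>\<omega>. exp (l * n * Z c \<omega>))" "expectation (\<lambda>\<omega>. exp (l * n * Z c \<omega>)) \<le> 1"
      unfolding Z_def mu_def using * by auto
  qed
  have ln_pos: "0 < l * n" using l n by simp
  obtain T0 where T0: "integrable M T0" "\<And>c \<omega>. c \<in> C \<Longrightarrow> Z c \<omega> \<le> T0 \<omega>" "expectation T0 \<le> ln (card C) / (l * n)"
    by (rule finite_max_dominated[OF C(1) C_ne ln_pos, of Z]) (use moment in blast, use moment in blast, rule that)
  \<comment> \<open>Passing from f to the net point c costs 2 L K / n in the population risk and the
    same in the empirical one. The bound on half of \<open>mu c\<close> is doubled, so the latter
    counts twice: 2 + 4 = 6. Likewise \<eta> counts twice there and once through
    \<open>excess g\<close>.\<close>
  define T where "T \<omega> = (INF f\<in>F. excess f) + 3 * \<eta> + 6 * (L * K / n) + 2 * T0 \<omega>" for \<omega>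
  have Dm: "D i \<omega> \<in> space (pair_space S K)" if "i < n" "\<omega> \<in> space M" for i \<omega>
    using D that by (auto simp: independent_copies_def indep_vars_def dest: measurable_space)
  show thesis
  proof
    show "integrable M T" unfolding T_def using T0(1) by simp
  next
    fix \<omega> f assume \<omega>: "\<omega> \<in> space M"
      and am: "is_arg_min (empirical_phi_risk K n \<phi> (sample n D \<omega>)) (\<lambda>f. f \<in> F) f"
    have fF: "f \<in> F" and min: "empirical_phi_risk K n \<phi> (sample n D \<omega>) f \<le> empirical_phi_risk K n \<phi> (sample n D \<omega>) g"
      using am g(1) by (auto simp: is_arg_min_linorder)
    have fB: "f \<in> bounded_scores B" using fF F by auto
    obtain c where c: "c \<in> C" and close: "\<And>k x. k \<in> {1..K} \<Longrightarrow> x \<in> space S \<Longrightarrow> \<bar>f k x - c k x\<bar> \<le> 2 / n"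
      using net[OF fF] by auto
    have cF: "c \<in> F" using c C by auto
    then have cB: "c \<in> bounded_scores B" using F by auto
    have cl: "\<bar>loss f x y - loss c x y\<bar> \<le> L * real K * (2 / n)" if "x \<in> space S" for x y
      using close that by (intro loss_diff_le_uniform) auto
    have "(\<Sum>i<n. d f (D i \<omega>)) / n \<le> 0"
      using min empirical_phi_risk_diff[of n "sample n D \<omega>" f g]
      by (simp add: d_def sample_def)
    moreover have "(\<Sum>i<n. d c (D i \<omega>)) / n \<le> (\<Sum>i<n. d f (D i \<omega>)) / n + L * real K * (2 / n)"
    proof -
      have "(\<Sum>i<n. d c (D i \<omega>)) \<le> (\<Sum>i<n. d f (D i \<omega>) + L * real K * (2 / n))"
      proof (rule sum_mono)
        fix i assume "i \<in> {..<n}"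
        then have "fst (D i \<omega>) \<in> space S" using Dm[of i \<omega>] \<omega> by (auto simp: space_pair_measure)
        from cl[OF this, of "snd (D i \<omega>)"] show "d c (D i \<omega>) \<le> d f (D i \<omega>) + L * real K * (2 / n)"
          unfolding d_def by linarith
      qed
      also have "\<dots> = (\<Sum>i<n. d f (D i \<omega>)) + n * (L * real K * (2 / n))" by (simp add: sum.distrib)
      finally show ?thesis using n by (simp add: field_simps)
    qed
    moreover have "?R f - ?R c \<le> L * real K * (2 / n)"
    proof -
      have "?R f - ?R c \<le> expectation (\<lambda>\<omega>. L * real K * (2 / n))"
        unfolding phi_risk_diff[OF fB cB]
        using loss_integrable[OF fB] loss_integrable[OF cB] measurable_space[OF X] cl
        by (intro integral_mono) (auto simp: abs_le_iff)
      then show ?thesis by (simp add: prob_space)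
    qed
    moreover have "mu c / 2 - (\<Sum>i<n. d c (D i \<omega>)) / n - \<eta> \<le> T0 \<omega>"
      using T0(2)[OF c, of \<omega>] by (simp add: Z_def)
    moreover have "excess f = (?R f - ?R c) + mu c + excess g"
      using mu[OF cF] by (simp add: excess_phi_risk_def)
    ultimately show "excess f \<le> T \<omega>"
      using g(2) unfolding T_def by simp
  next
    let ?r = "real K * ln m / n"
    \<comment> \<open>A cover by at least two balls makes ln m bounded below, so K / n is at most 2
      K ln m / n. Doubling 3 \<eta> and 6 L K / n gives the constants 6 and 12.\<close>
    have "ln 2 \<le> ln (real m)" using m by simp
    then have ln1: "1 \<le> 2 * ln (real m)" using ln2_ge_two_thirds by linarith
    have r1: "real K / n \<le> 2 * ?r"
      using mult_left_mono[OF ln1, of "real K / n"] by (simp add: mult_ac)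
    have "ln (card C) \<le> ln (real m)"
      using C C_ne by (subst ln_le_cancel_iff) (auto simp: card_gt_0_iff intro: order_trans)
    then have "ln (card C) / (l * n) \<le> ln (real m) / (l * n)"
      using ln_pos by (intro divide_right_mono) auto
    also have "\<dots> = (L\<^sup>2 / c\<^sub>1 + 2 * L * B) * ?r" by (simp add: l_def mult_ac)
    finally have 1: "expectation T0 \<le> (L\<^sup>2 / c\<^sub>1 + 2 * L * B) * ?r" using T0(3) by linarith
    have "expectation T = (INF f\<in>F. excess f) + 3 * \<eta> + 6 * (L * K / n) + 2 * expectation T0"
      unfolding T_def using T0(1) by (simp add: prob_space)
    also have "\<dots> \<le> (INF f\<in>F. excess f) + 3 * (2 * ?r) + 6 * (L * (2 * ?r)) + 2 * ((L\<^sup>2 / c\<^sub>1 + 2 * L * B) * ?r)"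
    proof -
      have "L * K / n \<le> L * (2 * ?r)" using mult_left_mono[OF r1, of L] L by simp
      then show ?thesis using 1 r1 unfolding \<eta>_def by linarith
    qed
    also have "\<dots> = (INF f\<in>F. excess f) + (6 + 12 * L + 2 * (L\<^sup>2 / c\<^sub>1 + 2 * L * B)) * ?r"
      by (simp add: algebra_simps)
    finally show "expectation T \<le> (INF f\<in>F. excess f) + (6 + 12 * L + 2 * (L\<^sup>2 / c\<^sub>1 + 2 * L * B)) * ?r" .
  qed
qed

end

subsection \<open>Excess risk of the empirical set\<close>

lemma (in prob_space) indep_of_sym:
  assumes "indep_of M MA A MB B"
  shows "indep_of M MB B MA A"
  using assms unfolding indep_of_def indep_sets2_eq by (metis Int_commute mult.commute)

text \<open>The freezing lemma: given \<open>W\<close>, the independent \<open>Z\<close> is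
  integrated out with \<open>W\<close> held fixed. Conditional expectations are characterized by
  integrals over preimages of sets under \<open>W\<close>, and these are computed by Fubini. The
  parameter \<open>W\<close> comes first in the product, as \<open>measurable_prob\<close> has
  it.\<close>

lemma (in prob_space) cond_exp_indep:
  assumes ind: "indep_of M MZ Z MW W"
    and P [measurable]: "Measurable.pred (MW \<Otimes>\<^sub>M MZ) (\<lambda>t. P (snd t) (fst t))"
  shows "AE \<omega> in M. real_cond_exp M (generated_algebra M W MW) (indicator {\<omega> \<in> space M. P (Z \<omega>) (W \<omega>)}) \<omega> =
    prob {\<omega>' \<in> space M. P (Z \<omega>') (W \<omega>)}"
proof -
  have Z [measurable]: "Z \<in> M \<rightarrow>\<^sub>M MZ" and W [measurable]: "W \<in> M \<rightarrow>\<^sub>M MW"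
    using ind by (auto simp: indep_of_def)
  let ?F = "generated_algebra M W MW"
  interpret sigma_finite_subalgebra M ?F
    by (rule sigma_finite_generated_algebra) simp
  define H where "H w = prob {\<omega>' \<in> space M. P (Z \<omega>') w}" for w
  have P2 [measurable]: "Measurable.pred (MW \<Otimes>\<^sub>M M) (\<lambda>t. P (Z (snd t)) (fst t))"
  proof -
    have "(\<lambda>t. (fst t, Z (snd t))) \<in> MW \<Otimes>\<^sub>M M \<rightarrow>\<^sub>M MW \<Otimes>\<^sub>M MZ" by measurable
    from measurable_compose[OF this P] show ?thesis by simp
  qed
  have H [measurable]: "H \<in> borel_measurable MW"
    unfolding H_def using P2 by (intro measurable_prob) simp
  have P3 [measurable]: "Measurable.pred M (\<lambda>\<omega>. P (Z \<omega>) (W \<omega>))"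
  proof -
    have "(\<lambda>\<omega>. (W \<omega>, Z \<omega>)) \<in> M \<rightarrow>\<^sub>M MW \<Otimes>\<^sub>M MZ" by measurable
    from measurable_compose[OF this P] show ?thesis by simp
  qed
  have P4: "Measurable.pred M (\<lambda>\<omega>'. P (Z \<omega>') w)" if "w \<in> space MW" for w
  proof -
    have "(\<lambda>\<omega>. (w, Z \<omega>)) \<in> M \<rightarrow>\<^sub>M MW \<Otimes>\<^sub>M MZ" using that by measurable
    from measurable_compose[OF this P] show ?thesis by simp
  qed
  have "AE \<omega> in M. real_cond_exp M ?F (indicator {\<omega> \<in> space M. P (Z \<omega>) (W \<omega>)}) \<omega> = H (W \<omega>)"
  proof (rule real_cond_exp_charact)
    show "integrable M (indicator {\<omega> \<in> space M. P (Z \<omega>) (W \<omega>)} :: 'a \<Rightarrow> real)"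
      by (intro integrable_const_bound[where B=1]) auto
    show iH: "integrable M (\<lambda>\<omega>. H (W \<omega>))"
    proof (intro integrable_const_bound[where B=1])
      show "AE \<omega> in M. norm (H (W \<omega>)) \<le> 1" by (simp add: H_def)
    qed measurable
    show "(\<lambda>\<omega>. H (W \<omega>)) \<in> borel_measurable ?F"
      by (rule measurable_generated_algebra[OF W H])
    fix E assume "E \<in> sets ?F"
    then obtain B where B [measurable]: "B \<in> sets MW" and E: "E = W -` B \<inter> space M"
      using measurable_space[OF W] by (auto simp: generated_algebra_def sets_vimage_algebra2)
    let ?h = "\<lambda>w z. indicator B w * indicator {t. P (snd t) (fst t)} (w, z) :: ennreal"
    have "{t \<in> space (MW \<Otimes>\<^sub>M MZ). P (snd t) (fst t)} \<in> sets (MW \<Otimes>\<^sub>M MZ)"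
      using P by (simp add: pred_def)
    then have "(indicator {t. P (snd t) (fst t)} :: _ \<Rightarrow> ennreal) \<in> borel_measurable (MW \<Otimes>\<^sub>M MZ)"
      by (intro borel_measurable_indicator') (simp add: Int_def conj_commute)
    then have "case_prod ?h \<in> borel_measurable (MW \<Otimes>\<^sub>M MZ)"
      by (simp add: case_prod_beta')
    note eq = indep_of_nn_integral[OF indep_of_sym[OF ind] this]
    have "ennreal (\<integral>\<omega>. indicator E \<omega> * indicator {\<omega> \<in> space M. P (Z \<omega>) (W \<omega>)} \<omega> \<partial>M) =
        (\<integral>\<^sup>+\<omega>. ennreal (indicator E \<omega> * indicator {\<omega> \<in> space M. P (Z \<omega>) (W \<omega>)} \<omega>) \<partial>M)"
      unfolding E
      by (intro nn_integral_eq_integral[symmetric] integrable_const_bound[where B=1]) (auto simp: indicator_def)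
    also have "\<dots> = (\<integral>\<^sup>+\<omega>. ?h (W \<omega>) (Z \<omega>) \<partial>M)"
      by (intro nn_integral_cong) (auto simp: E indicator_def)
    also have "\<dots> = (\<integral>\<^sup>+\<omega>. \<integral>\<^sup>+\<omega>'. ?h (W \<omega>) (Z \<omega>') \<partial>M \<partial>M)"
      by (rule eq)
    also have "\<dots> = (\<integral>\<^sup>+\<omega>. ennreal (indicator E \<omega> * H (W \<omega>)) \<partial>M)"
    proof (intro nn_integral_cong)
      fix \<omega> assume \<omega>: "\<omega> \<in> space M"
      note [measurable] = P4[OF measurable_space[OF W \<omega>]]
      have "(\<integral>\<^sup>+\<omega>'. ?h (W \<omega>) (Z \<omega>') \<partial>M) = (\<integral>\<^sup>+\<omega>'. indicator B (W \<omega>) * indicator {\<omega>' \<in> space M. P (Z \<omega>') (W \<omega>)} \<omega>' \<partial>M)"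
        by (intro nn_integral_cong) (auto simp: indicator_def)
      also have "\<dots> = indicator B (W \<omega>) * emeasure M {\<omega>' \<in> space M. P (Z \<omega>') (W \<omega>)}"
        by (subst nn_integral_cmult) auto
      finally show "(\<integral>\<^sup>+\<omega>'. ?h (W \<omega>) (Z \<omega>') \<partial>M) = ennreal (indicator E \<omega> * H (W \<omega>))"
        using \<omega> by (auto simp: E H_def emeasure_eq_measure indicator_def)
    qed
    also have "\<dots> = ennreal (\<integral>\<omega>. indicator E \<omega> * H (W \<omega>) \<partial>M)"
      unfolding E
    proof (intro nn_integral_eq_integral integrable_const_bound[where B=1])
      show "AE \<omega> in M. norm (indicator (W -` B \<inter> space M) \<omega> * H (W \<omega>)) \<le> 1"
        by (auto simp: indicator_def H_def)
      show "AE \<omega> in M. 0 \<le> indicator (W -` B \<inter> space M) \<omega> * H (W \<omega>)"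
        by (auto simp: indicator_def H_def)
    qed measurable
    finally have "(\<integral>\<omega>. indicator E \<omega> * indicator {\<omega> \<in> space M. P (Z \<omega>) (W \<omega>)} \<omega> \<partial>M) = (\<integral>\<omega>. indicator E \<omega> * H (W \<omega>) \<partial>M)"
      by (subst (asm) ennreal_inj) (auto intro!: integral_nonneg_AE simp: H_def)
    then show "(\<integral>\<omega>\<in>E. indicator {\<omega> \<in> space M. P (Z \<omega>) (W \<omega>)} \<omega> \<partial>M) = (\<integral>\<omega>\<in>E. H (W \<omega>) \<partial>M)"
      by (simp add: set_lebesgue_integral_def)
  qed
  then show ?thesis by (simp add: H_def)
qed

section \<open>The oracle threshold and its information\<close>

context class_prob_pair
begin

lemma oracle_set_eq: "oracle_set M K X p \<beta> = level_set K p (- G_inv M K X p \<beta>)"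
  by (simp add: oracle_set_def level_set_def fun_eq_iff)

lemma p_score: "p \<in> score_functions S K"
  by (simp add: score_functions_def)

text \<open>Since \<open>p k (X \<omega>)\<close> lies in [0, 1] almost surely, the tail function
  runs from K at 0 to 0 at 1 and attains \<beta> in between. By continuity the infimum belongs to
  the closed sublevel set, and by monotonicity its value cannot fall below \<beta>.\<close>

lemma G_fun_G_inv:
  assumes p: "p \<in> continuous_scores" and \<beta>: "0 < \<beta>" "\<beta> < real K"
  shows "G_fun M K X p (G_inv M K X p \<beta>) = \<beta>"
proof -
  let ?G = "G_fun M K X p"
  let ?T = "{t \<in> {0..1}. ?G t \<le> \<beta>}"
  have "prob {\<omega> \<in> space M. 0 \<le> p k (X \<omega>)} = 1" if "k \<in> {1..K}" for k
  proof -
    note [measurable] = p_measurable[OF that]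
    have "AE \<omega> in M. 0 \<le> p k (X \<omega>)" using p_bounds[OF that] by eventually_elim simp
    then show ?thesis by (subst prob_Collect_eq_1) auto
  qed
  then have G0: "?G 0 = real K" by (simp add: G_fun_eq(1)[OF p])
  have "prob {\<omega> \<in> space M. 1 < p k (X \<omega>)} = 0" if "k \<in> {1..K}" for k
  proof -
    note [measurable] = p_measurable[OF that]
    have "AE \<omega> in M. \<not> 1 < p k (X \<omega>)" using p_bounds[OF that] by eventually_elim simp
    then show ?thesis by (subst prob_Collect_eq_0) auto
  qed
  then have G1: "?G 1 = 0" by (simp add: G_fun_eq(2)[OF p])
  have "\<exists>t. 0 \<le> t \<and> t \<le> 1 \<and> ?G t = \<beta>"
    using G0 G1 \<beta> G_fun_continuous[OF p] by (intro IVT2') auto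
  then obtain t where t: "0 \<le> t" "t \<le> 1" "?G t = \<beta>" by blast
  have bdd: "bdd_below ?T" by (rule bdd_belowI[of _ 0]) simp
  have "closed ({0..1} \<inter> ?G -` {..\<beta>})"
    by (intro continuous_closed_preimage G_fun_continuous[OF p]) auto
  moreover have "{0..1} \<inter> ?G -` {..\<beta>} = ?T" by auto
  ultimately have "Inf ?T \<in> ?T"
    using t bdd by (intro closed_contains_Inf) auto
  moreover have "Inf ?T \<le> t" using t bdd by (intro cInf_lower) auto
  ultimately show ?thesis
    using G_fun_antimono[OF p, of "Inf ?T" t] t(3) by (simp add: G_inv_def)
qed

lemma info_oracle:
  assumes p: "p \<in> continuous_scores" and \<beta>: "0 < \<beta>" "\<beta> < real K"
  shows "info (oracle_set M K X p \<beta>) = \<beta>"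
proof -
  have "info (oracle_set M K X p \<beta>) = G_fun M K X p (G_inv M K X p \<beta>)"
    unfolding info_def G_fun_eq(1)[OF p] oracle_set_def by (intro sum.cong) auto
  then show ?thesis using G_fun_G_inv[OF assms] by simp
qed

end

context phi_risk_pair
begin

text \<open>Calibration replaces the oracle set by the level set of \<open>fs\<close> at the same
  \<delta>, so a disagreement is a separation of \<open>f k\<close> and \<open>fs k\<close> by
  -\<delta>. The bounds of the single labels add up because the marginal excesses sum to the excess
  risk.\<close>

lemma disagreement_oracle_le:
  assumes f: "f \<in> bounded_scores B" and p: "p \<in> continuous_scores"
    and cal: "calibrated_at M K X p fs \<beta> \<delta>"
    and pos: "0 < h" "0 < C\<^sub>0" "0 \<le> s"
    and noise: "\<And>k. k \<in> {1..K} \<Longrightarrow> AE \<omega> in M.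
      \<bar>p k (X \<omega>) - G_inv M K X p \<beta>\<bar> powr s \<le> C\<^sub>0 * marg k (\<lambda>_ _. - \<delta>) (X \<omega>)"
    and margin: "\<And>k. k \<in> {1..K} \<Longrightarrow> prob {\<omega> \<in> space M. 0 < \<bar>p k (X \<omega>) - G_inv M K X p \<beta>\<bar> \<and>
      \<bar>p k (X \<omega>) - G_inv M K X p \<beta>\<bar> \<le> h} \<le> c\<^sub>2 * h powr \<alpha>"
  shows "disagreement (level_set K f \<delta>) (oracle_set M K X p \<beta>) \<le>
    real K * (c\<^sub>2 * h powr \<alpha>) + C\<^sub>0 * h powr (- s) * excess f"
proof -
  have "disagreement (level_set K f \<delta>) (oracle_set M K X p \<beta>) \<le>
      (\<Sum>k=1..K. c\<^sub>2 * h powr \<alpha> + C\<^sub>0 * h powr (- s) * (\<integral>\<omega>. marg k f (X \<omega>) \<partial>M))"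
    unfolding disagreement_def
  proof (rule sum_mono)
    fix k assume k: "k \<in> {1..K}"
    note [measurable] = scoreD[OF minimizer_score k] scoreD[OF bounded_scoresD(1)[OF f] k] p_measurable[OF k]
    have "AE \<omega> in M. ((k \<in> level_set K f \<delta> (X \<omega>)) \<noteq> (k \<in> oracle_set M K X p \<beta> (X \<omega>))) \<longrightarrow>
        (- \<delta> \<le> f k (X \<omega>)) \<noteq> (- \<delta> \<le> fs k (X \<omega>))"
      using cal[unfolded calibrated_at_def] k
      by (auto elim!: eventually_mono simp: level_set_def set_eq_iff)
    then have "prob {\<omega> \<in> space M. (k \<in> level_set K f \<delta> (X \<omega>)) \<noteq> (k \<in> oracle_set M K X p \<beta> (X \<omega>))} \<le>
        prob {\<omega> \<in> space M. (- \<delta> \<le> f k (X \<omega>)) \<noteq> (- \<delta> \<le> fs k (X \<omega>))}"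
      by (intro finite_measure_mono_AE) auto
    also have "\<dots> \<le> c\<^sub>2 * h powr \<alpha> + C\<^sub>0 * h powr (- s) * (\<integral>\<omega>. marg k f (X \<omega>) \<partial>M)"
      using continuous_scoresD[OF p k]
      by (intro prob_threshold_diff_le[OF f k pos noise[OF k] margin[OF k]] prob_atom) auto
    finally show "prob {\<omega> \<in> space M. (k \<in> level_set K f \<delta> (X \<omega>)) \<noteq> (k \<in> oracle_set M K X p \<beta> (X \<omega>))} \<le>
        c\<^sub>2 * h powr \<alpha> + C\<^sub>0 * h powr (- s) * (\<integral>\<omega>. marg k f (X \<omega>) \<partial>M)" .
  qed
  also have "\<dots> = real K * (c\<^sub>2 * h powr \<alpha>) + C\<^sub>0 * h powr (- s) * (\<Sum>k=1..K. \<integral>\<omega>. marg k f (X \<omega>) \<partial>M)"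
    by (simp add: sum.distrib sum_distrib_left)
  finally show ?thesis
    unfolding sum_integral_marg[OF f] .
qed

text \<open>The level set at \<delta> is an intermediate set. Its distance to the oracle set is paid
  once for the risk and once for the deviation of its information from \<beta>, hence the factor
  2.\<close>

lemma risk_empirical_diff_le:
  assumes f: "f \<in> score_functions S K" and p: "p \<in> continuous_scores" and \<beta>: "0 < \<beta>" "\<beta> < real K"
  shows "\<bar>risk M X Y (empirical_set K N u f \<beta>) - risk M X Y (oracle_set M K X p \<beta>)\<bar> \<le>
    \<bar>info (empirical_set K N u f \<beta>) - \<beta>\<bar> + 2 * disagreement (level_set K f \<delta>) (oracle_set M K X p \<beta>)"
proof -
  let ?E = "empirical_set K N u f \<beta>" and ?L = "level_set K f \<delta>" and ?O = "oracle_set M K X p \<beta>"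
  have m: "measurable_confidence_set ?E" "measurable_confidence_set ?L" "measurable_confidence_set ?O"
    unfolding oracle_set_eq by (intro measurable_confidence_level f p_score)+
  have "\<bar>risk M X Y ?E - risk M X Y ?L\<bar> \<le> \<bar>info ?E - info ?L\<bar>"
    using risk_diff_le[OF m(1,2)] disagreement_nested[OF m(1,2) empirical_set_nested] by simp
  moreover have "\<bar>risk M X Y ?L - risk M X Y ?O\<bar> \<le> disagreement ?L ?O"
    by (rule risk_diff_le[OF m(2,3)])
  moreover have "\<bar>info ?L - \<beta>\<bar> \<le> disagreement ?L ?O"
    using info_diff_le[OF m(2,3)] info_oracle[OF p \<beta>] by simp
  ultimately show ?thesis by linarith
qed

end

section \<open>The procedure with both samples random\<close>

context labelled_pair
begin

text \<open>The space \<open>Q\<close> is arbitrary: the conditional risk takes the samples together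
  with a labelled point, the information takes the samples together with a point of
  \<open>M\<close>.\<close>

lemma empirical_set_joint_pred:
  assumes fhat: "\<And>k. k \<in> {1..K} \<Longrightarrow> (\<lambda>(d, x). fhat d k x) \<in> borel_measurable (labelled_space S K n \<Otimes>\<^sub>M S)"
    and d [measurable]: "d \<in> Q \<rightarrow>\<^sub>M labelled_space S K n" and u [measurable]: "u \<in> Q \<rightarrow>\<^sub>M unlabelled_space S N"
    and x [measurable]: "x \<in> Q \<rightarrow>\<^sub>M S" and k: "k \<in> {1..K}"
  shows "Measurable.pred Q (\<lambda>z. k \<in> empirical_set K N (u z) (fhat (d z)) \<beta> (x z))"
proof -
  have [measurable]: "(\<lambda>z. fhat (d z) k (x z)) \<in> borel_measurable Q"
    using measurable_compose[OF measurable_Pair[OF d x] fhat[OF k]] by simp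
  have [measurable]: "(\<lambda>z. empirical_G K N (u z) (fhat (d z)) (fhat (d z) k (x z))) \<in> borel_measurable Q"
  proof (rule empirical_G_measurable)
    fix j assume j: "j \<in> {1..K}"
    have "(\<lambda>w. (d (fst w), snd w)) \<in> Q \<Otimes>\<^sub>M S \<rightarrow>\<^sub>M labelled_space S K n \<Otimes>\<^sub>M S" by measurable
    from measurable_compose[OF this fhat[OF j]]
    show "(\<lambda>w. fhat (d (fst w)) j (snd w)) \<in> borel_measurable (Q \<Otimes>\<^sub>M S)" by simp
  qed measurable
  show ?thesis
    unfolding empirical_set_def mem_Collect_eq by measurable
qed

context
  fixes n N :: nat and D :: "nat \<Rightarrow> 'w \<Rightarrow> 'x \<times> nat" and U :: "nat \<Rightarrow> 'w \<Rightarrow> 'x"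
    and fhat :: "(nat \<Rightarrow> 'x \<times> nat) \<Rightarrow> 'x score"
  assumes data: "data_samples M S K X Y n N D U" and N: "0 < N" and K: "0 < K"
    and fhat_all: "\<forall>k\<in>{1..K}. (\<lambda>(d, x). fhat d k x) \<in> borel_measurable (labelled_space S K n \<Otimes>\<^sub>M S)"
begin

lemmas fhat = fhat_all[rule_format]

text \<open>The pair (X, Y) is independent of both samples jointly, so the freezing lemma gives the
  risk of the set with the samples held fixed. The event is written with a finite union over labels
  for measurability.\<close>

lemma empirical_set_risk_eq:
  "AE \<omega> in M. empirical_set_risk M S K X Y n N D U fhat \<beta> \<omega> =
    risk M X Y (empirical_set K N (sample N U \<omega>) (fhat (sample n D \<omega>)) \<beta>)"
proof -
  let ?P = "\<lambda>z w. snd z \<notin> empirical_set K N (snd w) (fhat (fst w)) \<beta> (fst z)"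
  let ?W = "labelled_space S K n \<Otimes>\<^sub>M unlabelled_space S N"
  let ?Q = "?W \<Otimes>\<^sub>M pair_space S K"
  have pred_k: "Measurable.pred ?Q (\<lambda>t. k \<in> empirical_set K N (snd (fst t)) (fhat (fst (fst t))) \<beta> (fst (snd t)))"
    if "k \<in> {1..K}" for k
    by (rule empirical_set_joint_pred[OF fhat _ _ _ that]) measurable
  have lab: "Measurable.pred ?Q (\<lambda>t. snd (snd t) = k)" for k
  proof -
    have "(\<lambda>t. snd (snd t)) \<in> ?Q \<rightarrow>\<^sub>M count_space {1..K}" by measurable
    then show ?thesis by (rule measurable_compose) simp
  qed
  have P_eq: "?P (snd t) (fst t) \<longleftrightarrow> \<not> (\<exists>k\<in>{1..K}. snd (snd t) = k \<and>
      k \<in> empirical_set K N (snd (fst t)) (fhat (fst (fst t))) \<beta> (fst (snd t)))" for t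
    by (auto simp: empirical_set_def)
  have "Measurable.pred ?Q (\<lambda>t. ?P (snd t) (fst t))"
    unfolding P_eq by (intro pred_intros_logic pred_intros_finite lab pred_k) auto
  moreover have "indep_of M (pair_space S K) (\<lambda>\<omega>. (X \<omega>, Y \<omega>)) ?W (\<lambda>\<omega>. (sample n D \<omega>, sample N U \<omega>))"
    using data by (simp add: data_samples_def)
  ultimately show ?thesis
    using cond_exp_indep[of "pair_space S K" "\<lambda>\<omega>. (X \<omega>, Y \<omega>)" ?W "\<lambda>\<omega>. (sample n D \<omega>, sample N U \<omega>)" ?P]
    by (simp add: empirical_set_risk_def risk_def)
qed

lemma info_estimated_measurable:
  "(\<lambda>w. info (empirical_set K N (snd w) (fhat (fst w)) \<beta>)) \<in>
    borel_measurable (labelled_space S K n \<Otimes>\<^sub>M unlabelled_space S N)"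
  unfolding info_def
  by (intro borel_measurable_sum measurable_prob empirical_set_joint_pred[OF fhat]) measurable

lemma sample_D_measurable: "sample n D \<in> M \<rightarrow>\<^sub>M labelled_space S K n"
  and sample_U_measurable': "sample N U \<in> M \<rightarrow>\<^sub>M unlabelled_space S N"
  using data by (auto simp: data_samples_def indep_of_def)

lemma integrable_info_estimated:
  "integrable M (\<lambda>\<omega>. \<bar>info (empirical_set K N (sample N U \<omega>) (fhat (sample n D \<omega>)) \<beta>) - \<beta>\<bar>)"
proof (rule integrable_const_bound[where B="real K + \<bar>\<beta>\<bar>"])
  show "AE \<omega> in M. norm \<bar>info (empirical_set K N (sample N U \<omega>) (fhat (sample n D \<omega>)) \<beta>) - \<beta>\<bar> \<le> real K + \<bar>\<beta>\<bar>"
  proof (rule AE_I2)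
    fix \<omega>
    show "norm \<bar>info (empirical_set K N (sample N U \<omega>) (fhat (sample n D \<omega>)) \<beta>) - \<beta>\<bar> \<le> real K + \<bar>\<beta>\<bar>"
      using info_bounds[of "empirical_set K N (sample N U \<omega>) (fhat (sample n D \<omega>)) \<beta>"] by simp
  qed
  show "(\<lambda>\<omega>. \<bar>info (empirical_set K N (sample N U \<omega>) (fhat (sample n D \<omega>)) \<beta>) - \<beta>\<bar>) \<in> borel_measurable M"
    using measurable_compose[OF measurable_Pair[OF sample_D_measurable sample_U_measurable'] info_estimated_measurable, of \<beta>]
    by simp
qed

lemma expectation_info_estimated:
  assumes \<beta>: "0 < \<beta>" "\<beta> < real K" and cont: "AE \<omega> in M. fhat (sample n D \<omega>) \<in> continuous_scores"
  shows "expectation (\<lambda>\<omega>. \<bar>info (empirical_set K N (sample N U \<omega>) (fhat (sample n D \<omega>)) \<beta>) - \<beta>\<bar>)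
    \<le> 3 * real K / sqrt N"
proof -
  let ?h = "\<lambda>d u. ennreal \<bar>info (empirical_set K N u (fhat d) \<beta>) - \<beta>\<bar>"
  have U: "independent_copies M S N U X" using data by (simp add: data_samples_def)
  have ind: "indep_of M (labelled_space S K n) (sample n D) (unlabelled_space S N) (sample N U)"
    using data by (simp add: data_samples_def)
  note [measurable] = info_estimated_measurable
  have "case_prod ?h \<in> borel_measurable (labelled_space S K n \<Otimes>\<^sub>M unlabelled_space S N)"
    unfolding case_prod_beta' by measurable
  note eq = indep_of_nn_integral[OF ind this]
  have "ennreal (expectation (\<lambda>\<omega>. \<bar>info (empirical_set K N (sample N U \<omega>) (fhat (sample n D \<omega>)) \<beta>) - \<beta>\<bar>)) =
      (\<integral>\<^sup>+\<omega>. ?h (sample n D \<omega>) (sample N U \<omega>) \<partial>M)"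
    using integrable_info_estimated by (intro nn_integral_eq_integral[symmetric]) auto
  also have "\<dots> = (\<integral>\<^sup>+\<omega>. \<integral>\<^sup>+\<omega>'. ?h (sample n D \<omega>) (sample N U \<omega>') \<partial>M \<partial>M)"
    by (rule eq)
  also have "\<dots> \<le> (\<integral>\<^sup>+\<omega>. ennreal (3 * real K / sqrt N) \<partial>M)"
  proof (rule nn_integral_mono_AE)
    show "AE \<omega> in M. (\<integral>\<^sup>+\<omega>'. ?h (sample n D \<omega>) (sample N U \<omega>') \<partial>M) \<le> ennreal (3 * real K / sqrt N)"
      using cont
    proof eventually_elim
      case (elim \<omega>)
      let ?q = "fhat (sample n D \<omega>)"
      have "integrable M (\<lambda>\<omega>'. \<bar>info (empirical_set K N (sample N U \<omega>') ?q \<beta>) - \<beta>\<bar>)"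
      proof (rule integrable_const_bound[where B="real K + \<bar>\<beta>\<bar>"])
        show "AE \<omega>' in M. norm \<bar>info (empirical_set K N (sample N U \<omega>') ?q \<beta>) - \<beta>\<bar> \<le> real K + \<bar>\<beta>\<bar>"
        proof (rule AE_I2)
          fix \<omega>'
          show "norm \<bar>info (empirical_set K N (sample N U \<omega>') ?q \<beta>) - \<beta>\<bar> \<le> real K + \<bar>\<beta>\<bar>"
            using info_bounds[of "empirical_set K N (sample N U \<omega>') ?q \<beta>"] by simp
        qed
        show "(\<lambda>\<omega>'. \<bar>info (empirical_set K N (sample N U \<omega>') ?q \<beta>) - \<beta>\<bar>) \<in> borel_measurable M"
          using info_empirical_measurable[OF U N K elim, of \<beta>] by measurable
      qed
      then have "(\<integral>\<^sup>+\<omega>'. ?h (sample n D \<omega>) (sample N U \<omega>') \<partial>M) =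
          ennreal (expectation (\<lambda>\<omega>'. \<bar>info (empirical_set K N (sample N U \<omega>') ?q \<beta>) - \<beta>\<bar>))"
        by (intro nn_integral_eq_integral) auto
      also have "\<dots> \<le> ennreal (3 * real K / sqrt N)"
        by (intro ennreal_leI expectation_info_empirical[OF U N K elim \<beta>])
      finally show ?case .
    qed
  qed
  also have "\<dots> = ennreal (3 * real K / sqrt N)"
    by (simp add: emeasure_space_1)
  finally show ?thesis
    by (subst (asm) ennreal_le_iff) auto
qed

end

end

text \<open>The chosen h solves k h^\<alpha> = q h^(-s). The common value is k^(s / (\<alpha> + s))
  q^(\<alpha> / (\<alpha> + s)), and s / (\<alpha> + s) = 1 - \<alpha> / (\<alpha> + s).\<close>

lemma rate_at_balanced_threshold:
  fixes k q \<alpha> s h :: real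
  assumes "0 < k" "0 < q" "0 < \<alpha>" "1 \<le> s" and h: "h = (q / k) powr (1 / (\<alpha> + s))"
  shows "k * h powr \<alpha> = k powr (1 - \<alpha> / (\<alpha> + s)) * q powr (\<alpha> / (\<alpha> + s))"
    and "h powr (- s) * q = k powr (1 - \<alpha> / (\<alpha> + s)) * q powr (\<alpha> / (\<alpha> + s))"
proof -
  have r: "1 - \<alpha> / (\<alpha> + s) = s / (\<alpha> + s)" using assms by (simp add: field_simps)
  have nz: "\<alpha> + s \<noteq> 0" using assms by linarith
  then have sum: "\<alpha> / (\<alpha> + s) + s / (\<alpha> + s) = 1"
    unfolding add_divide_distrib[symmetric] by simp
  have "k * h powr \<alpha> = k powr (\<alpha> / (\<alpha> + s) + s / (\<alpha> + s)) * (q powr (\<alpha> / (\<alpha> + s)) / k powr (\<alpha> / (\<alpha> + s)))"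
    using assms(1,2) unfolding h sum by (simp add: powr_powr powr_divide)
  then show "k * h powr \<alpha> = k powr (1 - \<alpha> / (\<alpha> + s)) * q powr (\<alpha> / (\<alpha> + s))"
    using assms(1) unfolding powr_add r by simp
  have "h powr (- s) * q = (q powr (- (s / (\<alpha> + s))) / k powr (- (s / (\<alpha> + s)))) * q powr (\<alpha> / (\<alpha> + s) + s / (\<alpha> + s))"
    using assms(1,2) unfolding h sum by (simp add: powr_powr powr_divide)
  then show "h powr (- s) * q = k powr (1 - \<alpha> / (\<alpha> + s)) * q powr (\<alpha> / (\<alpha> + s))"
    using assms(1,2) unfolding powr_add r by (simp add: powr_minus field_simps)
qed

lemma (in phi_risk_pair) expected_excess_risk_le:
  assumes K: "2 \<le> K" and p: "p \<in> continuous_scores" and \<beta>: "0 < \<beta>" "\<beta> < real K"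
    and nN: "0 < n" "0 < N" and data: "data_samples M S K X Y n N D U"
    and F: "F \<subseteq> bounded_scores B" "convex_scores F"
    and cover: "covering_number S K (1 / real n) F = enat m" and m: "2 \<le> m"
    and erm: "phi_erm M S K n D \<phi> F fhat"
    and cont: "AE \<omega> in M. \<forall>k\<in>{1..K}. continuous_on UNIV (cdf_of M (\<lambda>\<omega>'. fhat (sample n D \<omega>) k (X \<omega>')))"
    and cal: "calibrated_at M K X p fs \<beta> \<delta>" and s: "1 \<le> s" and C0: "0 < C\<^sub>0"
    and noise: "\<And>k. k \<in> {1..K} \<Longrightarrow> AE \<omega> in M.
      \<bar>p k (X \<omega>) - G_inv M K X p \<beta>\<bar> powr s \<le> C\<^sub>0 * marg k (\<lambda>_ _. - \<delta>) (X \<omega>)"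
    and modulus: "\<And>\<epsilon>. 0 < \<epsilon> \<Longrightarrow> ereal (c\<^sub>1 * \<epsilon>\<^sup>2) \<le> convexity_modulus M K X Y \<phi> F \<epsilon>" and c1: "0 < c\<^sub>1"
    and L: "0 < L" and \<alpha>: "0 < \<alpha>"
    and margin: "\<And>k t. k \<in> {1..K} \<Longrightarrow> 0 < t \<Longrightarrow> prob {\<omega> \<in> space M. 0 < \<bar>p k (X \<omega>) - G_inv M K X p \<beta>\<bar> \<and>
      \<bar>p k (X \<omega>) - G_inv M K X p \<beta>\<bar> \<le> t} \<le> c\<^sub>2 * t powr \<alpha>"
  shows "expectation (\<lambda>\<omega>. \<bar>empirical_set_risk M S K X Y n N D U fhat \<beta> \<omega> - risk M X Y (oracle_set M K X p \<beta>)\<bar>)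
    \<le> 2 * (c\<^sub>2 + C\<^sub>0 * (7 + 12 * L + 2 * (L\<^sup>2 / c\<^sub>1 + 2 * L * B))) * real K powr (1 - \<alpha> / (\<alpha> + s)) *
        ((INF f\<in>F. excess f) + real K * ln m / n) powr (\<alpha> / (\<alpha> + s)) + 3 * real K / sqrt N"
proof -
  have K0: "0 < K" using K by simp
  have fhat: "\<forall>k\<in>{1..K}. (\<lambda>(d, x). fhat d k x) \<in> borel_measurable (labelled_space S K n \<Otimes>\<^sub>M S)"
    using erm by (simp add: phi_erm_def)
  have am: "AE \<omega> in M. is_arg_min (empirical_phi_risk K n \<phi> (sample n D \<omega>)) (\<lambda>f. f \<in> F) (fhat (sample n D \<omega>))"
    using erm by (simp add: phi_erm_def)
  \<comment> \<open>The empty class is covered by no ball at all, which m \<ge> 2 excludes.\<close>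
  have F_ne: "F \<noteq> {}"
  proof
    assume "F = {}"
    then have "covering_number S K (1 / real n) F \<le> enat (card ({} :: 'x score set))"
      unfolding covering_number_def by (intro INF_lower) auto
    with cover m show False by simp
  qed
  have B: "0 \<le> B"
  proof -
    obtain f x where "f \<in> bounded_scores B" "x \<in> space S"
      using F_ne F(1) not_empty measurable_space[OF X] by blast
    from bounded_scoresD(2)[OF this(1) _ this(2), of 1] show ?thesis using K by simp
  qed
  have D: "independent_copies M (pair_space S K) n D (\<lambda>\<omega>. (X \<omega>, Y \<omega>))"
    using data by (simp add: data_samples_def)
  define I where "I \<omega> = \<bar>info (empirical_set K N (sample N U \<omega>) (fhat (sample n D \<omega>)) \<beta>) - \<beta>\<bar>" for \<omega>
  define r where "r = (INF f\<in>F. excess f)"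
  define q where "q = r + real K * ln m / n"
  \<comment> \<open>One more than the constant of \<open>erm_excess_le\<close>, so that c q bounds
    the infimum and the entropy term together. As h is chosen without c, this constant enters the
    result linearly.\<close>
  define c where "c = 7 + 12 * L + 2 * (L\<^sup>2 / c\<^sub>1 + 2 * L * B)"
  have r: "0 \<le> r"
    unfolding r_def using excess_nonneg F(1) by (intro cINF_greatest F_ne) auto
  have lnm: "0 < real K * ln m / n" using K m nN by simp
  then have q: "0 < q" using r by (simp add: q_def)
  have c: "7 \<le> c" using L c1 B by (simp add: c_def)
  define h where "h = (q / K) powr (1 / (\<alpha> + s))"
  have h: "0 < h" using q K by (simp add: h_def)
  obtain T where T: "integrable M T"
    "\<And>\<omega> f. \<omega> \<in> space M \<Longrightarrow> is_arg_min (empirical_phi_risk K n \<phi> (sample n D \<omega>)) (\<lambda>f. f \<in> F) f \<Longrightarrow> excess f \<le> T \<omega>"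
    "expectation T \<le> (INF f\<in>F. excess f) + (6 + 12 * L + 2 * (L\<^sup>2 / c\<^sub>1 + 2 * L * B)) * (real K * ln m / n)"
    by (rule erm_excess_le[OF F F_ne K0 nN(1) L D modulus c1 cover m]) auto
  have ET: "expectation T \<le> c * q"
  proof -
    have "expectation T \<le> r + (c - 1) * (real K * ln m / n)"
    proof -
      have "c - 1 = 6 + 12 * L + 2 * (L\<^sup>2 / c\<^sub>1 + 2 * L * B)" by (simp add: c_def)
      then show ?thesis using T(3) by (simp only: r_def)
    qed
    also have "\<dots> \<le> c * r + c * (real K * ln m / n)"
      using r c lnm by (intro add_mono mult_right_mono) (auto simp: mult_le_cancel_right1)
    finally show ?thesis by (simp add: q_def algebra_simps)
  qed
  have cont': "AE \<omega> in M. fhat (sample n D \<omega>) \<in> continuous_scores"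
    using cont am
  proof eventually_elim
    case (elim \<omega>)
    then have "fhat (sample n D \<omega>) \<in> F" by (simp add: is_arg_min_def)
    with elim show ?case
      using F(1) bounded_scoresD(1) by (auto simp: continuous_scores_def)
  qed
  have "expectation (\<lambda>\<omega>. \<bar>empirical_set_risk M S K X Y n N D U fhat \<beta> \<omega> - risk M X Y (oracle_set M K X p \<beta>)\<bar>)
      \<le> expectation (\<lambda>\<omega>. I \<omega> + 2 * (real K * (c\<^sub>2 * h powr \<alpha>) + C\<^sub>0 * h powr (- s) * T \<omega>))"
    (is "expectation ?l \<le> expectation ?r")
  \<comment> \<open>Integrability is required of the majorant alone: the integral of a
    non-integrable function is 0 by convention, which a nonnegative majorant also dominates.\<close>
  proof (rule integral_mono_AE')
    have int_I: "integrable M I"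
      unfolding I_def by (rule integrable_info_estimated[OF data nN(2) K0 fhat])
    show "integrable M ?r" using T(1) int_I by simp
    show le: "AE \<omega> in M. ?l \<omega> \<le> ?r \<omega>"
      using empirical_set_risk_eq[OF data nN(2) K0 fhat, where \<beta>=\<beta>] am AE_space
    proof eventually_elim
      case (elim \<omega>)
      let ?f = "fhat (sample n D \<omega>)"
      have fB: "?f \<in> bounded_scores B"
        using elim(2) F(1) by (auto simp: is_arg_min_def)
      have 1: "?l \<omega> \<le> I \<omega> + 2 * disagreement (level_set K ?f \<delta>) (oracle_set M K X p \<beta>)"
        unfolding elim(1) I_def by (intro risk_empirical_diff_le bounded_scoresD(1)[OF fB] p \<beta>)
      have "disagreement (level_set K ?f \<delta>) (oracle_set M K X p \<beta>) \<le>
          real K * (c\<^sub>2 * h powr \<alpha>) + C\<^sub>0 * h powr (- s) * excess ?f"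
        using s by (intro disagreement_oracle_le[OF fB p cal h C0 _ noise margin]) (auto simp: h)
      also have "\<dots> \<le> real K * (c\<^sub>2 * h powr \<alpha>) + C\<^sub>0 * h powr (- s) * T \<omega>"
        using C0 by (intro add_left_mono mult_left_mono T(2)[OF elim(3,2)]) auto
      finally have 2: "2 * disagreement (level_set K ?f \<delta>) (oracle_set M K X p \<beta>) \<le>
          2 * (real K * (c\<^sub>2 * h powr \<alpha>) + C\<^sub>0 * h powr (- s) * T \<omega>)"
        by (rule mult_left_mono) simp
      show ?case
        using order_trans[OF 1 add_left_mono[OF 2]] .
    qed
    show "AE \<omega> in M. 0 \<le> ?r \<omega>"
      using le by eventually_elim linarith
  qed
  also have "\<dots> = expectation I + 2 * (real K * (c\<^sub>2 * h powr \<alpha>) + C\<^sub>0 * h powr (- s) * expectation T)"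
    using T(1) integrable_info_estimated[OF data nN(2) K0 fhat, where \<beta>=\<beta>]
    by (simp add: I_def[abs_def] prob_space)
  also have "\<dots> \<le> 3 * real K / sqrt N + 2 * (real K * (c\<^sub>2 * h powr \<alpha>) + C\<^sub>0 * h powr (- s) * (c * q))"
    using ET C0 expectation_info_estimated[OF data nN(2) K0 fhat \<beta> cont']
    by (intro order_refl add_mono mult_left_mono) (auto simp: I_def[abs_def])
  also have "\<dots> = 2 * (c\<^sub>2 * (real K * h powr \<alpha>) + C\<^sub>0 * c * (h powr (- s) * q)) + 3 * real K / sqrt N"
    by (simp add: algebra_simps)
  also have "\<dots> = 2 * (c\<^sub>2 + C\<^sub>0 * c) * real K powr (1 - \<alpha> / (\<alpha> + s)) * q powr (\<alpha> / (\<alpha> + s)) + 3 * real K / sqrt N"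
  proof -
    have "0 < real K" using K by simp
    note * = rate_at_balanced_threshold[OF this q \<alpha> s h_def]
    show ?thesis unfolding * by (simp add: algebra_simps)
  qed
  finally show ?thesis
    by (simp add: c_def q_def r_def)
qed

theorem theorem2:
  shows "\<exists>C'>0::real. \<forall>C\<^sub>0>0::real. \<forall>c\<^sub>1>0::real. \<forall>c\<^sub>2>0::real.
    \<exists>C :: real \<Rightarrow> real \<Rightarrow> real \<Rightarrow> real \<Rightarrow> real.
    (\<forall>B L s \<alpha>. C B L s \<alpha> > 0) \<and>
    (\<forall>(M :: 'w measure) (S :: 'x measure) (K :: nat) X Y p
      (\<beta> :: real) (\<phi> :: real \<Rightarrow> real) fs (F :: 'x score set) (B :: real)
      (n :: nat) (N :: nat) D U fhat (M\<^sub>n :: nat)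
      (\<delta>s :: real) (s :: real) (L :: real) (\<alpha> :: real).
      2 \<le> K \<longrightarrow> random_pair M S K X Y \<longrightarrow> class_prob M S K X Y p \<longrightarrow>
      0 < \<beta> \<longrightarrow> \<beta> < real K \<longrightarrow>
      convex_on UNIV \<phi> \<longrightarrow> phi_minimizer M S K X Y \<phi> fs \<longrightarrow>
      0 < n \<longrightarrow> 0 < N \<longrightarrow> data_samples M S K X Y n N D U \<longrightarrow>
      F \<subseteq> score_functions S K \<longrightarrow> convex_scores F \<longrightarrow>
      (\<forall>f\<in>F. Linf_norm S K f \<le> ereal B) \<longrightarrow>
      covering_number S K (1 / real n) F = enat M\<^sub>n \<longrightarrow> 2 \<le> M\<^sub>n \<longrightarrow>
      phi_erm M S K n D \<phi> F fhat \<longrightarrow>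
      \<comment> \<open>(A1)\<close>
      (\<forall>k\<in>{1..K}. continuous_on UNIV (cdf_of M (\<lambda>\<omega>. p k (X \<omega>)))) \<longrightarrow>
      \<comment> \<open>(A2)\<close>
      (AE \<omega> in M. \<forall>k\<in>{1..K}.
         continuous_on UNIV (cdf_of M (\<lambda>\<omega>'. fhat (sample n D \<omega>) k (X \<omega>')))) \<longrightarrow>
      \<comment> \<open>(a)\<close>
      confidence_set_calibrated M K X p fs \<longrightarrow>
      calibrated_at M K X p fs \<beta> \<delta>s \<longrightarrow>
      1 \<le> s \<longrightarrow>
      (\<forall>k\<in>{1..K}. AE \<omega> in M.
         \<bar>p k (X \<omega>) - G_inv M K X p \<beta>\<bar> powr s
           \<le> C\<^sub>0 * marginal_excess p \<phi> fs k (\<lambda>_ _. - \<delta>s) (X \<omega>)) \<longrightarrow>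
      \<comment> \<open>(b)\<close>
      (\<forall>\<epsilon>>0. ereal (c\<^sub>1 * \<epsilon>\<^sup>2) \<le> convexity_modulus M K X Y \<phi> F \<epsilon>) \<longrightarrow>
      \<comment> \<open>(c)\<close>
      0 < L \<longrightarrow> L-lipschitz_on UNIV \<phi> \<longrightarrow>
      \<comment> \<open>(d)\<close>
      0 < \<alpha> \<longrightarrow>
      (\<forall>k\<in>{1..K}. \<forall>t>0.
         measure M {\<omega> \<in> space M. 0 < \<bar>p k (X \<omega>) - G_inv M K X p \<beta>\<bar> \<and>
                                 \<bar>p k (X \<omega>) - G_inv M K X p \<beta>\<bar> \<le> t} \<le> c\<^sub>2 * t powr \<alpha>) \<longrightarrow>
      (\<integral>\<omega>. \<bar>empirical_set_risk M S K X Y n N D U fhat \<beta> \<omega> - risk M X Y (oracle_set M K X p \<beta>)\<bar> \<partial>M)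
        \<le> C B L s \<alpha> * real K powr (1 - \<alpha> / (\<alpha> + s)) *
            ((INF f\<in>F. excess_phi_risk M K X Y \<phi> fs f) + real K * ln (real M\<^sub>n) / real n)
              powr (\<alpha> / (\<alpha> + s))
          + C' * real K / sqrt (real N))"
proof (rule exI[of _ 3], intro conjI allI impI, goal_cases)
  case 1
  show ?case by simp
next
  case (2 C\<^sub>0 c\<^sub>1 c\<^sub>2)
  note pos = this
  \<comment> \<open>Positivity is claimed at all real arguments, before any hypothesis on
    \<open>B\<close> and \<open>L\<close>, hence the absolute values. Correspondingly
    \<open>F\<close> is placed in the ball of radius \<bar>B\<bar> below.\<close>
  define C :: "real \<Rightarrow> real \<Rightarrow> real \<Rightarrow> real \<Rightarrow> real" where
    "C B L s \<alpha> = 2 * (c\<^sub>2 + C\<^sub>0 * (7 + 12 * \<bar>L\<bar> + 2 * (L\<^sup>2 / c\<^sub>1 + 2 * \<bar>L\<bar> * \<bar>B\<bar>)))" for B L s \<alpha>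
  have C_pos: "0 < C B L s \<alpha>" for B L s \<alpha>
    unfolding C_def using pos by (intro mult_pos_pos add_pos_nonneg mult_nonneg_nonneg) auto
  show ?case
  proof (rule exI[of _ C], intro conjI allI impI)
    show "0 < C B L s \<alpha>" for B L s \<alpha> by (rule C_pos)
    fix M :: "'w measure" and S :: "'x measure" and K :: nat and X Y p
      and \<beta> :: real and \<phi> :: "real \<Rightarrow> real" and fs and F :: "'x score set" and B :: real
      and n N :: nat and D U fhat and m :: nat and \<delta> s L \<alpha> :: real
    assume K: "2 \<le> K" and rp: "random_pair M S K X Y" and cp: "class_prob M S K X Y p"
      and \<beta>: "0 < \<beta>" "\<beta> < real K" and conv: "convex_on UNIV \<phi>" and min: "phi_minimizer M S K X Y \<phi> fs"
      and nN: "0 < n" "0 < N" and data: "data_samples M S K X Y n N D U"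
      and F: "F \<subseteq> score_functions S K" "convex_scores F" "\<forall>f\<in>F. Linf_norm S K f \<le> ereal B"
      and cover: "covering_number S K (1 / real n) F = enat m" "2 \<le> m"
      and erm: "phi_erm M S K n D \<phi> F fhat"
      and A1: "\<forall>k\<in>{1..K}. continuous_on UNIV (cdf_of M (\<lambda>\<omega>. p k (X \<omega>)))"
      and A2: "AE \<omega> in M. \<forall>k\<in>{1..K}. continuous_on UNIV (cdf_of M (\<lambda>\<omega>'. fhat (sample n D \<omega>) k (X \<omega>')))"
      and "confidence_set_calibrated M K X p fs"
      and cal: "calibrated_at M K X p fs \<beta> \<delta>" and s: "1 \<le> s"
      and noise: "\<forall>k\<in>{1..K}. AE \<omega> in M. \<bar>p k (X \<omega>) - G_inv M K X p \<beta>\<bar> powr s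
           \<le> C\<^sub>0 * marginal_excess p \<phi> fs k (\<lambda>_ _. - \<delta>) (X \<omega>)"
      and modulus: "\<forall>\<epsilon>>0. ereal (c\<^sub>1 * \<epsilon>\<^sup>2) \<le> convexity_modulus M K X Y \<phi> F \<epsilon>"
      and L: "0 < L" "L-lipschitz_on UNIV \<phi>" and \<alpha>: "0 < \<alpha>"
      and margin: "\<forall>k\<in>{1..K}. \<forall>t>0. measure M {\<omega> \<in> space M. 0 < \<bar>p k (X \<omega>) - G_inv M K X p \<beta>\<bar> \<and>
             \<bar>p k (X \<omega>) - G_inv M K X p \<beta>\<bar> \<le> t} \<le> c\<^sub>2 * t powr \<alpha>"
    interpret prob_space M using rp by (simp add: random_pair_def)
    interpret phi_risk_pair M S K X Y p \<phi> L fs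
      using rp cp conv min L by unfold_locales (auto simp: random_pair_def)
    have p: "p \<in> continuous_scores"
      using A1 p_score by (simp add: continuous_scores_def)
    have FB: "F \<subseteq> bounded_scores \<bar>B\<bar>"
      using F(1,3) by (force simp: bounded_scores_def Linf_norm_le_iff)
    show "(\<integral>\<omega>. \<bar>empirical_set_risk M S K X Y n N D U fhat \<beta> \<omega> - risk M X Y (oracle_set M K X p \<beta>)\<bar> \<partial>M)
        \<le> C B L s \<alpha> * real K powr (1 - \<alpha> / (\<alpha> + s)) *
            ((INF f\<in>F. excess_phi_risk M K X Y \<phi> fs f) + real K * ln (real m) / real n)
              powr (\<alpha> / (\<alpha> + s))
          + 3 * real K / sqrt (real N)"
      using expected_excess_risk_le[OF K p \<beta> nN data FB F(2) cover erm A2 cal s pos(1)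
          bspec[OF noise] modulus[rule_format] pos(2) L(1) \<alpha> margin[rule_format]] L(1)
      by (simp add: C_def)
  qed
qed

end
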